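(* Let $x\in D_1$, $\nu,\mu\in\mathbb{C}$, $\nu+\mu\notin-\mathbb{N}$, $\nu+\frac12\notin\mathbb{Z}$. Then, for the upper sign chosen everywhere as well as for the lower sign chosen everywhere, $$\mathsf{Q}_\nu^\mu(x)=\sqrt{\pi}\,2^{\mu-1}(1-x^2)^{\frac12\mu}\Bigg[e^{\pm i\pi(\mu+\frac12)}\frac{\Gamma(\nu+\frac12)}{\Gamma(\nu-\mu+1)}\big(x\pm i\sqrt{1-x^2}\big)^{\nu-\mu}{}_2F_1\!\left(\tfrac12+\mu,\mu-\nu;\tfrac12-\nu;\frac{x\mp i\sqrt{1-x^2}}{x\pm i\sqrt{1-x^2}}\right)$$ $$+\,\frac{\Gamma(\nu+\mu+1)}{\Gamma(\nu+\frac32)}\left(1+e^{\pm i\pi(\nu+\mu)}\frac{\cos(\pi\mu)}{\cos(\pi\nu)}\right)\big(x\mp i\sqrt{1-x^2}\big)^{\nu+\mu+1}{}_2F_1\!\left(\tfrac12+\mu,\nu+\mu+1;\nu+\tfrac32;\frac{x\mp i\sqrt{1-x^2}}{x\pm i\sqrt{1-x^2}}\right)\Bigg],$$ or equivalently, for $\operatorname{Re}\theta\in(0,\pi)$, $$\mathsf{Q}_\nu^\mu(\cos\theta)=\sqrt{\pi}\,2^{\mu-1}(\sin\theta)^\mu\Bigg[e^{\pm i\pi(\mu+\frac12)}\frac{\Gamma(\nu+\frac12)}{\Gamma(\nu-\mu+1)}e^{\pm i(\nu-\mu)\theta}{}_2F_1\!\left(\tfrac12+\mu,\mu-\nu;\tfrac12-\nu;e^{\mp2i\theta}\right)$$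 $$+\,\frac{\Gamma(\nu+\mu+1)}{\Gamma(\nu+\frac32)}\left(1+e^{\pm i\pi(\nu+\mu)}\frac{\cos(\pi\mu)}{\cos(\pi\nu)}\right)e^{\mp i(\nu+\mu+1)\theta}{}_2F_1\!\left(\tfrac12+\mu,\nu+\mu+1;\nu+\tfrac32;e^{\mp2i\theta}\right)\Bigg].$$
   Context: $\mathbb{N}=\{1,2,3,\dots\}$, $-\mathbb{N}=\{-1,-2,\dots\}$. $D_1=\mathbb{C}\setminus((-\infty,-1]\cup[1,\infty))$, $D_2=\mathbb{C}\setminus(-\infty,1]$. Complex powers and roots are principal values. ${}_2F_1(a,b;c;w)$ is the Gauss hypergeometric function, principal branch on $\mathbb{C}\setminus[1,\infty)$ (the analytic continuation of $\sum_{n\ge0}\frac{(a)_n(b)_n}{(c)_n}\frac{w^n}{n!}$). $1/\Gamma$ is read as the entire function (zero at the poles of $\Gamma$). Associated Legendre function of the second kind: for $z\in D_2$, $\nu+\mu\in\mathbb{C}\setminus-\mathbb{N}$, $$Q_\nu^\mu(z)=\frac{\sqrt{\pi}\,e^{i\pi\mu}\Gamma(\nu+\mu+1)(z^2-1)^{\frac12\mu}}{2^{\nu+1}\Gamma(\nu+\frac32)z^{\nu+\mu+1}}\,{}_2F_1\!\left(\tfrac{\nu+\mu+2}{2},\tfrac{\nu+\mu+1}{2};\nu+\tfrac32;\tfrac1{z^2}\right),$$ where $(z^2-1)^\alpha:=(z+1)^\alpha(z-1)^\alpha$. Ferrers function of the second kind: for $x\in(-1,1)$, $$\mathsf{Q}_\nu^\mu(x)=\tfrac12\big[e^{-\frac12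 i\pi\mu}\,e^{-i\pi\mu}Q_\nu^\mu(x+i0)+e^{\frac12 i\pi\mu}\,e^{-i\pi\mu}Q_\nu^\mu(x-i0)\big],$$ where $x\pm i0$ denotes the limit from the upper/lower half-plane, and $\mathsf{Q}_\nu^\mu$ is extended analytically to $D_1$. *)

theory Defs
  imports "HOL-Complex_Analysis.Complex_Analysis"
begin

definition neg_naturals :: "complex set"
  where
    "neg_naturals = {- of_nat n | n :: nat. n \<ge> 1}"

definition D1 :: "complex set"
  where "D1 = - (complex_of_real ` ({..-1} \<union> {1..}))"

text \<open>
  The principal branch of the Gauss hypergeometric function on the plane cut along
  \<open>[1, \<infinity>)\<close>: the value at \<open>w\<close> of the analytic continuation of the Gauss series. By the
  identity theorem this value does not depend on the choice of \<open>f\<close>. It is meaningful for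
  \<open>w\<close> off the cut and \<open>c\<close> not in \<open>{0, -1, -2, \<dots>}\<close>.
\<close>
definition hyp2F1 :: "complex \<Rightarrow> complex \<Rightarrow> complex \<Rightarrow> complex \<Rightarrow> complex"
  where "hyp2F1 a b c w =
    (THE v. \<exists>f. f holomorphic_on - (complex_of_real ` {1..}) \<and>
       (\<forall>u. norm u < 1 \<longrightarrow>
          (\<lambda>n. pochhammer a n * pochhammer b n / pochhammer c n * u ^ n / fact n) sums f u) \<and>
       v = f w)"

text \<open>
  Associated Legendre function of the second kind, for \<open>z\<close> in the plane cut along
  \<open>(-\<infinity>, 1]\<close> and \<open>\<nu> + \<mu>\<close> not in \<open>{-1, -2, \<dots>}\<close>; as a total function it takes irrelevant
  values elsewhere. Reciprocals of Gamma are written with the entire function \<open>rGamma\<close>. For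
  \<open>\<nu> + 3/2\<close> in \<open>{0, -1, -2, \<dots>}\<close> the formula would need the regularized hypergeometric
  function; it is only used for \<open>\<nu> + 1/2\<close> not an integer.
\<close>
definition legendreQ :: "complex \<Rightarrow> complex \<Rightarrow> complex \<Rightarrow> complex"
  where "legendreQ \<nu> \<mu> z =
    of_real (sqrt pi) * exp (\<i> * of_real pi * \<mu>) * Gamma (\<nu> + \<mu> + 1)
      * ((z + 1) powr (\<mu> / 2) * (z - 1) powr (\<mu> / 2))
      / (2 powr (\<nu> + 1) * z powr (\<nu> + \<mu> + 1)) * rGamma (\<nu> + 3/2)
      * hyp2F1 ((\<nu> + \<mu> + 2) / 2) ((\<nu> + \<mu> + 1) / 2) (\<nu> + 3/2) (1 / z\<^sup>2)"

text \<open>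
  Ferrers function of the second kind on the interval \<open>(-1, 1)\<close>; the two limits are the
  boundary values of \<open>legendreQ\<close> from the upper and the lower half-plane.
\<close>
definition ferrersQ_interval :: "complex \<Rightarrow> complex \<Rightarrow> real \<Rightarrow> complex"
  where "ferrersQ_interval \<nu> \<mu> t =
    1/2 * (exp (- (1/2) * \<i> * of_real pi * \<mu>) * exp (- \<i> * of_real pi * \<mu>)
             * Lim (at (of_real t) within {z. Im z > 0}) (legendreQ \<nu> \<mu>)
         + exp (1/2 * \<i> * of_real pi * \<mu>) * exp (- \<i> * of_real pi * \<mu>)
             * Lim (at (of_real t) within {z. Im z < 0}) (legendreQ \<nu> \<mu>))"

text \<open>Its analytic extension to \<open>D1\<close>, again unique by the identity theorem.\<close>
definition ferrersQ :: "complex \<Rightarrow> complex \<Rightarrow> complex \<Rightarrow> complex"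
  where "ferrersQ \<nu> \<mu> x =
    (THE v. \<exists>f. f holomorphic_on D1 \<and>
       (\<forall>t \<in> {-1<..<1}. f (of_real t) = ferrersQ_interval \<nu> \<mu> t) \<and>
       v = f x)"

end

theory Submission
  imports Defs
begin

text \<open>
  On the upper and the lower half-plane, put \<open>z = cos \<theta>\<close>. A quadratic transformation turns \<open>legendreQ\<close> into a
  constant times \<open>(sin \<theta>)\<^sup>\<mu> w\<^sup>\<alpha> F(1/2 + \<mu>, \<nu> + \<mu> + 1; \<nu> + 3/2; w\<^sup>2)\<close> with \<open>w = exp (- \<i> \<theta>)\<close> or
  \<open>w = exp (\<i> \<theta>)\<close> and \<open>\<alpha> = \<nu> + \<mu> + 1\<close>. Both expressions continue across the interval, and \<open>ferrersQ\<close> is half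
  their sum. The theorem follows by applying to one of them the connection formula between the hypergeometric
  functions of \<open>u\<close> and \<open>1/u\<close>.

  Continuation and connection formula are obtained together. If the real part of \<open>c\<close> is large, all series
  converge on the unit circle, where the solutions of the hypergeometric equation at \<open>0\<close> and \<open>\<infinity>\<close> are linearly
  related by a Wronskian argument; the coefficients come from Gauss's theorem at \<open>u = 1\<close>, and the two sides are
  glued along the circle. The operator \<open>u d/du + c\<close> then lowers \<open>c + 1\<close> to \<open>c\<close>.
\<close>

section \<open>The hypergeometric series\<close>

text \<open>The description \<open>THE v\<close> in \<open>hyp2F1\<close> denotes something useful
  only once a continuation to the slit plane is known to exist; the formula at infinity is itself
  the means to get one, because it displays the function for \<open>norm u > 1\<close>. The excess
  \<open>c - a - b\<close> governs the behaviour on the unit circle: if its real part is at least 5,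
  the coefficients are of order n^-4, which leaves room for two applications of
  \<open>u d/du\<close> with absolute convergence. Both series at infinity have this same excess, so
  one hypothesis serves both sides. The substitution \<open>u = - exp \<zeta>\<close> turns the cut
  plane into the strip \<open>\<bar>Im \<zeta>\<bar> < pi\<close>, the branch factor
  \<open>(- u) powr (- a)\<close> into \<open>exp (- a * \<zeta>)\<close>, inversion into a change
  of sign, and the circle into an imaginary segment, which is convex, so that a vanishing derivative
  gives a constant. In the application the numerator parameters differ by \<open>\<nu> + 1/2\<close>
  up to sign; that this is no integer keeps the two solutions at infinity distinct and free of
  logarithms.\<close>

definition hyp_coeff :: "complex \<Rightarrow> complex \<Rightarrow> complex \<Rightarrow> nat \<Rightarrow> complex"
  where "hyp_coeff a b c n = pochhammer a n * pochhammer b n / (pochhammer c n * fact n)"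

definition hyp_series :: "complex \<Rightarrow> complex \<Rightarrow> complex \<Rightarrow> complex \<Rightarrow> complex"
  where "hyp_series a b c u = (\<Sum>n. hyp_coeff a b c n * u ^ n)"

lemma hyp_coeff_0 [simp]: "hyp_coeff a b c 0 = 1"
  by (simp add: hyp_coeff_def)

lemma hyp_coeff_Suc:
  "hyp_coeff a b c (Suc n) =
     hyp_coeff a b c n * ((a + of_nat n) * (b + of_nat n) / ((c + of_nat n) * of_nat (Suc n)))"
  by (simp add: hyp_coeff_def pochhammer_Suc mult_ac)

lemma hyp_coeff_commute: "hyp_coeff a b c n = hyp_coeff b a c n"
  by (simp add: hyp_coeff_def mult_ac)

lemma hyp_series_commute: "hyp_series a b c u = hyp_series b a c u"
  by (simp add: hyp_series_def hyp_coeff_commute[of a b])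

lemma nonpos_Ints_add_of_nat_neq_0:
  assumes "(c::complex) \<notin> \<int>\<^sub>\<le>\<^sub>0"
  shows "c + of_nat n \<noteq> 0"
  using assms by (metis plus_of_nat_eq_0_imp)

lemma nonpos_Ints_add_of_nat:
  assumes "(c::complex) \<notin> \<int>\<^sub>\<le>\<^sub>0"
  shows "c + of_nat m \<notin> \<int>\<^sub>\<le>\<^sub>0"
proof
  assume "c + of_nat m \<in> \<int>\<^sub>\<le>\<^sub>0"
  then obtain n where "c + of_nat m = - of_nat n" by (elim nonpos_Ints_cases')
  hence "c + of_nat (m + n) = 0" by (simp add: add.assoc[symmetric])
  thus False using nonpos_Ints_add_of_nat_neq_0[OF assms] by blast
qed

text \<open>The action of \<open>u d/du + c\<close> on coefficients. It serves twice: in the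
  telescoping step of Gauss's theorem and in the descent from \<open>c + 1\<close> to
  \<open>c\<close>.\<close>

lemma hyp_coeff_lower_c:
  assumes c: "c \<notin> \<int>\<^sub>\<le>\<^sub>0"
  shows "(c + of_nat n) * hyp_coeff a b (c + 1) n = c * hyp_coeff a b c n"
proof -
  have c0: "c + of_nat n \<noteq> 0" for n using nonpos_Ints_add_of_nat_neq_0[OF c] .
  have "pochhammer c n * (c + of_nat n) = c * pochhammer (c + 1) n"
    by (metis pochhammer_Suc pochhammer_rec)
  moreover have "pochhammer c n \<noteq> 0" "pochhammer (c + 1) n \<noteq> 0"
    using c0[of "_"] c0[of "Suc _"] by (auto simp: pochhammer_eq_0_iff add_ac eq_neg_iff_add_eq_0)
  ultimately have "(c + of_nat n) / pochhammer (c + 1) n = c / pochhammer c n"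
    by (simp add: frac_eq_eq mult_ac)
  hence "(c + of_nat n) / pochhammer (c + 1) n * (pochhammer a n * pochhammer b n / fact n) =
     c / pochhammer c n * (pochhammer a n * pochhammer b n / fact n)" by simp
  thus ?thesis unfolding hyp_coeff_def by (simp add: mult_ac)
qed

lemma hyp_coeff_recurrence:
  assumes "c \<notin> \<int>\<^sub>\<le>\<^sub>0"
  shows "(c + of_nat n) * of_nat (Suc n) * hyp_coeff a b c (Suc n) =
     (a + of_nat n) * (b + of_nat n) * hyp_coeff a b c n"
  using nonpos_Ints_add_of_nat_neq_0[OF assms, of n]
  by (simp add: hyp_coeff_Suc del: of_nat_Suc)

text \<open>
  With \<open>p = c - a - b\<close>, the numerator is \<open>(c + n) * (n - p) + (c - a) * (c - b)\<close>. The threshold for \<open>n\<close>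
  depends on the parameters only through \<open>M\<close>, so that the resulting bounds are locally uniform in them.
\<close>

lemma hyp_coeff_ratio_bound:
  fixes a b c :: complex and n :: nat
  assumes M: "norm a \<le> M" "norm b \<le> M" "norm c \<le> M" "M \<ge> 1"
    and Re: "Re (c - a - b) \<ge> 5" and n: "real n \<ge> 100 * M^2"
  shows "norm ((a + of_nat n) * (b + of_nat n)) * real (Suc n) ^ 4
           \<le> norm ((c + of_nat n) * of_nat (Suc n)) * real n ^ 4"
proof -
  define p where "p = c - a - b"
  have M2: "M \<le> M^2" using M by (simp add: power2_eq_square)
  have n100: "real n \<ge> 100" using n M2 M by linarith
  have "norm p \<le> norm c + norm a + norm b"
    unfolding p_def by (meson add_mono norm_triangle_ineq4 order_refl order_trans)
  hence np: "norm p \<le> 3 * M" using M by linarith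
  have np2: "(norm p)^2 \<le> 9 * M^2"
    using power_mono[OF np, of 2] by (simp add: power_mult_distrib)
  \<comment> \<open>Since \<open>Re p\<close> is at least 5, the square loses \<open>10 * n\<close>,
    while \<open>(n - 4)^2\<close> loses only \<open>8 * n\<close>; the spare \<open>2 * n\<close>
    absorbs \<open>9 * M^2\<close>. The remainder \<open>(c - a) * (c - b)\<close> later costs one
    more unit, which leaves \<open>n - 3\<close>.\<close>
  have "(norm (of_nat n - p))^2 = real n ^ 2 - 2 * n * Re p + (norm p)^2"
    unfolding cmod_power2 by (simp add: power2_eq_square algebra_simps)
  also have "\<dots> \<le> real n^2 - 10 * n + 9 * M^2"
  proof -
    have "5 * real n \<le> n * Re p" using Re n100 unfolding p_def[symmetric]
      by (subst mult.commute) (intro mult_left_mono, auto)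
    thus ?thesis using np2 by linarith
  qed
  also have "\<dots> \<le> (real n - 4)^2"
    using n by (simp add: power2_eq_square algebra_simps)
  finally have nnp: "norm (of_nat n - p) \<le> real n - 4"
    by (rule power2_le_imp_le) (use n100 in linarith)
  have id: "(a + of_nat n) * (b + of_nat n) = (c + of_nat n) * (of_nat n - p) + (c - a) * (c - b)"
    unfolding p_def by (simp add: algebra_simps)
  have "norm ((c-a)*(c-b)) \<le> (2*M)*(2*M)"
    unfolding norm_mult using M norm_triangle_ineq4[of c a] norm_triangle_ineq4[of c b]
    by (intro mult_mono) auto
  hence r: "norm ((c-a)*(c-b)) \<le> 4 * M^2" by (simp add: power2_eq_square)
  have "norm (of_nat n :: complex) \<le> norm (c + of_nat n) + norm c"
    using norm_triangle_ineq4[of "c + of_nat n" c] by simp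
  hence cn: "norm (c + of_nat n) \<ge> 4 * M^2" using n M2 M by simp
  have "norm ((a + of_nat n) * (b + of_nat n)) \<le>
          norm (c + of_nat n) * norm (of_nat n - p) + norm ((c-a)*(c-b))"
    unfolding id norm_mult[symmetric] by (rule norm_triangle_ineq)
  also have "\<dots> \<le> norm (c + of_nat n) * (real n - 4) + norm (c + of_nat n)"
    using r cn nnp by (intro add_mono mult_left_mono) auto
  also have "\<dots> = norm (c + of_nat n) * (real n - 3)" by (simp add: algebra_simps)
  finally have 1: "norm ((a + of_nat n) * (b + of_nat n)) \<le> norm (c + of_nat n) * (real n - 3)" .
  \<comment> \<open>Bernoulli's inequality turns the linear bound \<open>n - 3\<close> against
    \<open>n + 1\<close> into the ratio of fourth powers; this is where the exponent 4 comes
    from.\<close>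
  have "(1 + of_nat 4 * (- 1 / real (Suc n))) \<le> (1 + (- 1 / real (Suc n)))^4"
    by (rule Bernoulli_inequality) (simp add: field_simps)
  also have "1 + (- 1 / real (Suc n)) = real n / real (Suc n)" by (simp add: field_simps)
  finally have "(1 - 4 / real (Suc n)) * real (Suc n) \<le> (real n / real (Suc n))^4 * real (Suc n)"
    by (intro mult_right_mono) auto
  moreover have "(1 - 4 / real (Suc n)) * real (Suc n) = real n - 3"
    by (simp add: field_simps)
  ultimately have "real n - 3 \<le> (real n / real (Suc n))^4 * real (Suc n)"
    by metis
  hence "(real n - 3) * real (Suc n)^4 \<le> (real n / real (Suc n))^4 * real (Suc n) * real (Suc n)^4"
    by (intro mult_right_mono) auto
  hence 2: "(real n - 3) * real (Suc n)^4 \<le> real (Suc n) * real n^4"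
    by (simp add: power_divide mult.commute del: of_nat_Suc)
  have "norm ((a + of_nat n) * (b + of_nat n)) * real (Suc n) ^ 4 \<le>
          norm (c + of_nat n) * (real n - 3) * real (Suc n)^4"
    using 1 by (intro mult_right_mono) auto
  also have "\<dots> \<le> norm (c + of_nat n) * (real (Suc n) * real n^4)"
    using mult_left_mono[OF 2, of "norm (c + of_nat n)"] by (simp add: mult_ac)
  finally show ?thesis unfolding norm_mult norm_of_nat by (simp add: mult_ac)
qed

text \<open>The ratio bound is one step of a monotonicity statement: from \<open>N\<close> on, the
  coefficients weighted with the fourth power of the index do not increase.\<close>

lemma hyp_coeff_decay:
  fixes a b c :: complex
  assumes M: "norm a \<le> M" "norm b \<le> M" "norm c \<le> M" "M \<ge> 1"
    and Re: "Re (c - a - b) \<ge> 5" and N: "real N \<ge> 100 * M^2" and n: "n \<ge> N"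
  shows "norm (hyp_coeff a b c n) * real n ^ 4 \<le> norm (hyp_coeff a b c N) * real N ^ 4"
  using n
proof (induction n rule: dec_induct)
  case (step n)
  have nM: "real n \<ge> 100 * M^2" using N step by linarith
  have "M \<le> M^2" using M by (simp add: power2_eq_square)
  hence "real n > M" using nM M by linarith
  moreover have "norm (of_nat n :: complex) \<le> norm (c + of_nat n) + norm c"
    using norm_triangle_ineq4[of "c + of_nat n" c] by simp
  ultimately have "norm (c + of_nat n) > 0" using M unfolding norm_of_nat by linarith
  hence pos: "norm ((c + of_nat n) * of_nat (Suc n)) > 0"
    by (simp add: norm_mult del: of_nat_Suc)
  have "norm (hyp_coeff a b c (Suc n)) * real (Suc n) ^ 4 =
     norm (hyp_coeff a b c n) * ((norm ((a + of_nat n) * (b + of_nat n)) * real (Suc n) ^ 4) /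
       norm ((c + of_nat n) * of_nat (Suc n)))"
    unfolding hyp_coeff_Suc by (simp add: norm_mult norm_divide del: of_nat_Suc)
  also have "\<dots> \<le> norm (hyp_coeff a b c n) * real n ^ 4"
    using hyp_coeff_ratio_bound[OF M Re nM] pos
    by (intro mult_left_mono) (auto simp: field_simps)
  finally show ?case using step by linarith
qed auto

lemma hyp_coeff_tendsto:
  assumes "(a \<longlongrightarrow> a0) F" "(b \<longlongrightarrow> b0) F" "(c \<longlongrightarrow> c0) F" "c0 \<notin> \<int>\<^sub>\<le>\<^sub>0"
  shows "((\<lambda>k. hyp_coeff (a k) (b k) (c k) n) \<longlongrightarrow> hyp_coeff a0 b0 c0 n) F"
proof (induction n)
  case (Suc n)
  show ?case unfolding hyp_coeff_Suc
    using nonpos_Ints_add_of_nat_neq_0[OF assms(4), of n]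
    by (intro tendsto_intros assms Suc) (simp del: of_nat_Suc)
qed auto

lemma summable_inverse_power4: "summable (\<lambda>n. K / real n ^ 4)"
  using summable_mult[OF inverse_power_summable[of 4, where 'a = real], of K] 
  by (simp add: field_simps)

text \<open>Continuity in the parameters on the closed disc, by Tannery's theorem. The inequality
  for the excess is strict so that it persists for parameters near the limit.\<close>

lemma hyp_series_tendsto:
  assumes lim: "(a \<longlongrightarrow> a0) F" "(b \<longlongrightarrow> b0) F" "(c \<longlongrightarrow> c0) F" and c0: "c0 \<notin> \<int>\<^sub>\<le>\<^sub>0"
    and Re: "Re (c0 - a0 - b0) > 5" and F: "F \<noteq> bot" and u: "norm u \<le> 1"
  shows "((\<lambda>k. hyp_series (a k) (b k) (c k) u) \<longlongrightarrow> hyp_series a0 b0 c0 u) F"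
proof -
  define M where "M = norm a0 + norm b0 + norm c0 + 1"
  define N where "N = nat \<lceil>100 * M^2\<rceil>"
  have N: "real N \<ge> 100 * M^2" unfolding N_def by (metis of_nat_ceiling)
  have M1: "M \<ge> 1" unfolding M_def by simp
  \<comment> \<open>The summand 1 leaves room for the \<open>N\<close>-th coefficient to vary, so
    that one \<open>K\<close> works for all parameters close to the limit.\<close>
  define K where "K = (norm (hyp_coeff a0 b0 c0 N) + 1) * real N ^ 4"
  have "eventually (\<lambda>k. norm (a k) < M) F" "eventually (\<lambda>k. norm (b k) < M) F"
       "eventually (\<lambda>k. norm (c k) < M) F"
    unfolding M_def
    by (rule order_tendstoD[OF tendsto_norm[OF lim(1)]] order_tendstoD[OF tendsto_norm[OF lim(2)]]
      order_tendstoD[OF tendsto_norm[OF lim(3)]]; auto simp: add_nonneg_pos add_pos_nonneg)+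
  moreover have "eventually (\<lambda>k. Re (c k - a k - b k) > 5) F"
    by (rule order_tendstoD(1)[OF tendsto_Re Re]) (intro tendsto_intros lim)
  moreover have "eventually (\<lambda>k. norm (hyp_coeff (a k) (b k) (c k) N) < norm (hyp_coeff a0 b0 c0 N) + 1) F"
    by (rule order_tendstoD[OF tendsto_norm[OF hyp_coeff_tendsto[OF lim c0]]]) simp
  ultimately have "eventually (\<lambda>k. \<forall>n\<ge>N. norm (hyp_coeff (a k) (b k) (c k) n * u ^ n) \<le> K / real n ^ 4) F"
  proof eventually_elim
    case (elim k)
    show ?case
    proof (intro allI impI)
      fix n assume n: "n \<ge> N"
      have "norm (hyp_coeff (a k) (b k) (c k) n) * real n ^ 4 \<le> K"
        unfolding K_def using elim
        by (intro order_trans[OF hyp_coeff_decay[OF _ _ _ M1 _ N n]] mult_right_mono) auto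
      moreover have "M ^ 2 \<ge> 1" using M1 by simp
      hence "real n > 0" using N n by linarith
      ultimately have "norm (hyp_coeff (a k) (b k) (c k) n) \<le> K / real n ^ 4"
        by (simp add: field_simps)
      moreover have "norm (u ^ n) \<le> 1" using u by (simp add: norm_power power_le_one)
      ultimately show "norm (hyp_coeff (a k) (b k) (c k) n * u ^ n) \<le> K / real n ^ 4"
        unfolding norm_mult by (meson mult_left_le norm_ge_zero order_trans)
    qed
  qed
  hence "eventually (\<lambda>(n,k). norm (hyp_coeff (a k) (b k) (c k) n * u ^ n) \<le> K / real n ^ 4) (at_top \<times>\<^sub>F F)"
    unfolding eventually_prod_filter
    by (intro exI[of _ "\<lambda>n. n \<ge> N"] exI conjI) (auto intro: eventually_ge_at_top)
  from tannerys_theorem[OF _ this summable_inverse_power4 F, of "\<lambda>n. hyp_coeff a0 b0 c0 n * u ^ n"]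
  show ?thesis unfolding hyp_series_def
    using tendsto_mult[OF hyp_coeff_tendsto[OF lim c0] tendsto_const] by blast
qed

text \<open>The factor n^2 accounts for the two derivatives in the differential equation, which
  thereby stays valid up to the unit circle.\<close>

lemma summable_hyp_coeff_square:
  assumes "Re (c - a - b) \<ge> 5"
  shows "summable (\<lambda>n. real n ^ 2 * norm (hyp_coeff a b c n))"
proof -
  define M where "M = norm a + norm b + norm c + 1"
  define N where "N = nat \<lceil>100 * M^2\<rceil>"
  have N: "real N \<ge> 100 * M^2" unfolding N_def by (metis of_nat_ceiling)
  have M: "norm a \<le> M" "norm b \<le> M" "norm c \<le> M" "M \<ge> 1" unfolding M_def by auto
  define K where "K = norm (hyp_coeff a b c N) * real N ^ 4"
  show ?thesis
  proof (rule summable_comparison_test_ev)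
    show "summable (\<lambda>n. K * inverse (real n ^ 2))"
      by (intro summable_mult inverse_power_summable) auto
    show "eventually (\<lambda>n. norm (real n ^ 2 * norm (hyp_coeff a b c n)) \<le> K * inverse (real n ^ 2)) sequentially"
      using eventually_ge_at_top[of N] eventually_gt_at_top[of 0]
    proof eventually_elim
      case (elim n)
      have "norm (hyp_coeff a b c n) * real n ^ 4 \<le> K"
        unfolding K_def by (rule hyp_coeff_decay[OF M assms N]) (use elim in auto)
      hence "real n ^ 2 * norm (hyp_coeff a b c n) * real n ^ 2 \<le> K"
        by (simp add: power_numeral_reduce mult_ac)
      thus ?case using elim by (simp add: field_simps)
    qed
  qed
qed

lemma summable_hyp_coeff_norm:
  assumes "Re (c - a - b) \<ge> 5"
  shows "summable (\<lambda>n. norm (hyp_coeff a b c n))"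
  by (rule summable_comparison_test_ev[OF _ summable_hyp_coeff_square[OF assms]])
     (use eventually_gt_at_top[of 0] in eventually_elim, auto simp: mult_le_cancel_right1)

section \<open>Gauss's summation theorem\<close>

text \<open>A majorant with real parameters, from \<open>norm (a + n) \<le> norm a + n\<close> and
  \<open>norm (c + n) \<ge> Re c + n\<close>. It does not change as \<open>c\<close> moves to the
  right, which is the domination needed for the limit of large \<open>c\<close>.\<close>

lemma norm_hyp_coeff_le:
  assumes "Re c \<ge> R" "R > 0"
  shows "norm (hyp_coeff a b c n) \<le> norm (hyp_coeff (of_real (norm a)) (of_real (norm b)) (of_real R) n)"
proof (induction n)
  case (Suc n)
  have *: "norm (x + of_nat n) \<le> norm (complex_of_real (norm x) + of_nat n)" for x :: complex
    using norm_triangle_ineq[of x "of_nat n"]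
    by (metis norm_of_nat norm_of_real of_real_add of_real_of_nat_eq abs_of_nonneg add_nonneg_nonneg norm_ge_zero of_nat_0_le_iff)
  have "norm (complex_of_real R + of_nat n) = R + real n"
    using assms by (metis norm_of_real of_real_add of_real_of_nat_eq abs_of_nonneg add_nonneg_nonneg less_imp_le of_nat_0_le_iff)
  also have "\<dots> \<le> Re (c + of_nat n)" using assms by simp
  also have "\<dots> \<le> norm (c + of_nat n)" by (rule complex_Re_le_cmod)
  finally have **: "norm (complex_of_real R + of_nat n) \<le> norm (c + of_nat n)" .
  have pos: "norm (complex_of_real R + of_nat n) > 0"
    using assms by (metis \<open>cmod (complex_of_real R + of_nat n) = R + real n\<close> add_pos_nonneg of_nat_0_le_iff)
  show ?case unfolding hyp_coeff_Suc norm_mult norm_divide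
    by (intro mult_mono frac_le Suc * **) (use pos in \<open>auto simp del: of_nat_Suc intro!: mult_nonneg_nonneg\<close>)
qed auto

lemma hyp_coeff_tendsto_at_infinity:
  "(\<lambda>m. hyp_coeff a b (c + of_nat m) n) \<longlonglongrightarrow> (if n = 0 then 1 else 0)"
proof (induction n)
  case (Suc n)
  have "filterlim (\<lambda>m. (c + of_nat n) + (of_nat m :: complex)) at_infinity sequentially"
    by (rule tendsto_add_filterlim_at_infinity[OF tendsto_const tendsto_of_nat])
  hence "filterlim (\<lambda>m. of_nat (Suc n) * ((c + of_nat n) + (of_nat m :: complex))) at_infinity sequentially"
    by (intro tendsto_mult_filterlim_at_infinity[OF tendsto_const]) (auto simp del: of_nat_Suc)
  hence "(\<lambda>m. (a + of_nat n) * (b + of_nat n) / (of_nat (Suc n) * ((c + of_nat n) + (of_nat m :: complex)))) \<longlonglongrightarrow> 0"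
    by (intro tendsto_divide_0[OF tendsto_const])
  from tendsto_mult[OF Suc this]
  show ?case unfolding hyp_coeff_Suc by (simp add: algebra_simps)
qed auto

text \<open>Every coefficient but the constant one has a factor \<open>c + m + k\<close> in its
  denominator and dies out; the majorant permits the limit under the sum.\<close>

lemma hyp_series_1_tendsto:
  "(\<lambda>m. hyp_series a b (c + of_nat m) 1) \<longlonglongrightarrow> 1"
proof -
  \<comment> \<open>Chosen so that the majorant, with parameters \<open>norm a\<close>,
    \<open>norm b\<close>, \<open>R\<close>, has excess exactly 5.\<close>
  define R where "R = norm a + norm b + 5"
  define m0 where "m0 = nat \<lceil>R - Re c\<rceil>"
  have m0: "Re (c + of_nat m) \<ge> R" if "m \<ge> m0" for m
  proof -
    have "R - Re c \<le> real m0" unfolding m0_def by (rule of_nat_ceiling)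
    thus ?thesis using that by simp
  qed
  have sm: "summable (\<lambda>n. norm (hyp_coeff (of_real (norm a)) (of_real (norm b)) (of_real R) n))"
    by (rule summable_hyp_coeff_norm) (simp add: R_def)
  have R: "R > 0" unfolding R_def by (simp add: add_nonneg_pos)
  have "eventually (\<lambda>(n,m). norm (hyp_coeff a b (c + of_nat m) n * 1 ^ n) \<le>
       norm (hyp_coeff (of_real (norm a)) (of_real (norm b)) (of_real R) n)) (at_top \<times>\<^sub>F sequentially)"
    unfolding eventually_prod_filter
  proof (rule exI[of _ "\<lambda>_. True"], rule exI[of _ "\<lambda>m. m \<ge> m0"], intro conjI)
    show "eventually (\<lambda>m. m \<ge> m0) sequentially" by (rule eventually_ge_at_top)
  qed (use norm_hyp_coeff_le[OF m0 R] in auto)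
  from tannerys_theorem[OF _ this sm sequentially_bot, of "\<lambda>n. if n = 0 then 1 else 0"]
  have "(\<lambda>m. \<Sum>n. hyp_coeff a b (c + of_nat m) n * 1 ^ n) \<longlonglongrightarrow> (\<Sum>n. if n = 0 then 1 else 0)"
    using hyp_coeff_tendsto_at_infinity[of a b c] by simp
  moreover have "(\<Sum>n::nat. if n = 0 then 1 else 0 :: complex) = 1"
    using sums_If_finite_set'[of "\<lambda>_. 0::complex" 0 "{0}"] sums_single[of 0 "\<lambda>_. 1 :: complex"]
    by (metis (no_types, lifting) sums_unique)
  ultimately show ?thesis unfolding hyp_series_def by simp
qed

text \<open>This is the boundary term at infinity of the telescoping sum that follows.\<close>

lemma hyp_coeff_times_n_tendsto:
  assumes "Re (c - a - b) \<ge> 5"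
  shows "(\<lambda>n. of_nat n * hyp_coeff a b c n) \<longlonglongrightarrow> 0"
proof (rule tendsto_norm_zero_cancel, rule tendsto_sandwich[OF _ _ tendsto_const])
  show "(\<lambda>n. real n ^ 2 * norm (hyp_coeff a b c n)) \<longlonglongrightarrow> 0"
    by (rule summable_LIMSEQ_zero[OF summable_hyp_coeff_square[OF assms]])
  have "real n \<le> real n ^ 2" for n by (cases n) (auto simp: power2_eq_square)
  thus "eventually (\<lambda>n. norm (of_nat n * hyp_coeff a b c n) \<le> real n ^ 2 * norm (hyp_coeff a b c n)) sequentially"
    by (auto simp: norm_mult intro!: always_eventually mult_right_mono)
qed auto

text \<open>
  The difference of the two sides telescopes, with partial sums \<open>- c * n * hyp_coeff a b c n\<close>.
\<close>

lemma hyp_series_1_Suc: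
  assumes c: "c \<notin> \<int>\<^sub>\<le>\<^sub>0" and Re: "Re (c - a - b) \<ge> 5"
  shows "c * (c - a - b) * hyp_series a b c 1 = (c - a) * (c - b) * hyp_series a b (c + 1) 1"
proof -
  let ?t = "hyp_coeff a b c" and ?t' = "hyp_coeff a b (c + 1)"
  have c0: "c + of_nat n \<noteq> 0" for n using nonpos_Ints_add_of_nat_neq_0[OF c] .
  note rel = hyp_coeff_lower_c[OF c, of _ a b]
  have tel: "c * (c - a - b) * ?t n - (c - a) * (c - b) * ?t' n =
       (- c) * (of_nat (Suc n) * ?t (Suc n)) - (- c) * (of_nat n * ?t n)" for n
  proof -
    \<comment> \<open>Multiplication by \<open>c + n\<close> makes the terms of \<open>?t'\<close>
      terms of \<open>?t\<close>; then the recurrence replaces the product with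
      \<open>(a + n) * (b + n)\<close> by the next term.\<close>
    have "(c + of_nat n) * (c * (c - a - b) * ?t n - (c - a) * (c - b) * ?t' n)
        = c * (c + of_nat n) * (c - a - b) * ?t n - (c - a) * (c - b) * ((c + of_nat n) * ?t' n)"
      by (simp add: algebra_simps)
    also have "\<dots> = - c * ((a + of_nat n) * (b + of_nat n) * ?t n) + c * (c + of_nat n) * (of_nat n * ?t n)"
      unfolding rel by (simp add: algebra_simps)
    also have "\<dots> = (c + of_nat n) * ((- c) * (of_nat (Suc n) * ?t (Suc n)) - (- c) * (of_nat n * ?t n))"
      unfolding hyp_coeff_recurrence[OF c, symmetric] by (simp add: algebra_simps)
    finally show ?thesis using c0[of n] mult_left_cancel by blast
  qed
  have "(\<lambda>n. (- c) * (of_nat (Suc n) * ?t (Suc n)) - (- c) * (of_nat n * ?t n)) sums (- c * 0 - (- c) * (of_nat 0 * ?t 0))"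
    by (rule telescope_sums) (intro tendsto_intros hyp_coeff_times_n_tendsto Re)
  hence "(\<lambda>n. c * (c - a - b) * ?t n - (c - a) * (c - b) * ?t' n) sums 0"
    unfolding tel by simp
  moreover have "?t sums hyp_series a b c 1"
    using summable_norm_cancel[OF summable_hyp_coeff_norm[OF Re]] by (simp add: hyp_series_def summable_sums)
  moreover have "?t' sums hyp_series a b (c+1) 1"
    using summable_norm_cancel[OF summable_hyp_coeff_norm[of "c+1" a b]] Re by (simp add: hyp_series_def summable_sums)
  ultimately have "0 = c * (c - a - b) * hyp_series a b c 1 - (c - a) * (c - b) * hyp_series a b (c + 1) 1"
    by (intro sums_unique2[OF _ sums_diff[OF sums_mult sums_mult]])
  thus ?thesis by simp
qed

text \<open>The step from \<open>c\<close> to \<open>c + 1\<close> is iterated \<open>m\<close>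
  times. The accumulated Pochhammer symbols are those of Euler's product for the reciprocal Gamma
  function, and the remaining series tends to 1 as \<open>m\<close> grows.\<close>

theorem Gauss_hyp_series_1:
  assumes c: "c \<notin> \<int>\<^sub>\<le>\<^sub>0" and Re: "Re (c - a - b) \<ge> 5"
  shows "hyp_series a b c 1 = Gamma c * Gamma (c - a - b) * rGamma (c - a) * rGamma (c - b)"
proof -
  have s: "c - a - b \<notin> \<int>\<^sub>\<le>\<^sub>0" using Re by (auto elim!: nonpos_Ints_cases dest: arg_cong[of _ _ Re])
  note shift = nonpos_Ints_add_of_nat[OF c]
  have step: "pochhammer c m * pochhammer (c - a - b) m * hyp_series a b c 1 =
        pochhammer (c - a) m * pochhammer (c - b) m * hyp_series a b (c + of_nat m) 1" for m
  proof (induction m)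
    case (Suc m)
    have "pochhammer c (Suc m) * pochhammer (c - a - b) (Suc m) * hyp_series a b c 1 =
       (c + of_nat m) * (c - a - b + of_nat m) * (pochhammer c m * pochhammer (c - a - b) m * hyp_series a b c 1)"
      by (simp add: pochhammer_Suc mult_ac)
    also have "\<dots> = pochhammer (c - a) m * pochhammer (c - b) m *
        ((c + of_nat m) * ((c + of_nat m) - a - b) * hyp_series a b (c + of_nat m) 1)"
      unfolding Suc by (simp add: algebra_simps)
    also have "(c + of_nat m) * ((c + of_nat m) - a - b) * hyp_series a b (c + of_nat m) 1 =
       ((c + of_nat m) - a) * ((c + of_nat m) - b) * hyp_series a b ((c + of_nat m) + 1) 1"
      by (rule hyp_series_1_Suc[OF shift]) (use Re in simp)
    finally show ?case by (simp add: pochhammer_Suc algebra_simps)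
  qed auto
  have "rGamma_series c m * rGamma_series (c - a - b) m * hyp_series a b c 1 =
        rGamma_series (c - a) m * rGamma_series (c - b) m * hyp_series a b (c + of_nat (Suc m)) 1" for m
  proof -
    let ?e = "\<lambda>z. exp (z * of_real (ln (real m))) :: complex"
    \<comment> \<open>The powers of \<open>m\<close> in Euler's product cancel because both pairs of
      parameters have the sum \<open>2 * c - a - b\<close>.\<close>
    have "?e c * ?e (c - a - b) = ?e (c - a) * ?e (c - b)"
      unfolding exp_add[symmetric] by (simp add: algebra_simps)
    hence "rGamma_series c m * rGamma_series (c - a - b) m * hyp_series a b c 1 =
       pochhammer c (Suc m) * pochhammer (c - a - b) (Suc m) * hyp_series a b c 1 /
         (fact m * fact m * (?e (c - a) * ?e (c - b)))"
      unfolding rGamma_series_def by (simp add: mult_ac)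
    thus ?thesis unfolding step unfolding rGamma_series_def by (simp add: mult_ac)
  qed
  moreover have "(\<lambda>m. rGamma_series c m * rGamma_series (c - a - b) m * hyp_series a b c 1) \<longlonglongrightarrow>
      rGamma c * rGamma (c - a - b) * hyp_series a b c 1"
    by (intro tendsto_intros)
  moreover have "(\<lambda>m. rGamma_series (c - a) m * rGamma_series (c - b) m * hyp_series a b (c + of_nat (Suc m)) 1)
     \<longlonglongrightarrow> rGamma (c - a) * rGamma (c - b) * 1"
    by (intro tendsto_intros filterlim_compose[OF hyp_series_1_tendsto filterlim_Suc])
  ultimately have "rGamma c * rGamma (c - a - b) * hyp_series a b c 1 = rGamma (c - a) * rGamma (c - b)"
    using LIMSEQ_unique by (metis (no_types, lifting) ext mult.right_neutral)
  moreover have "Gamma c * rGamma c = 1" "Gamma (c - a - b) * rGamma (c - a - b) = 1"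
    using c s by (auto simp: rGamma_inverse_Gamma Gamma_eq_zero_iff)
  moreover have "hyp_series a b c 1 * (Gamma c * rGamma c) * (Gamma (c - a - b) * rGamma (c - a - b)) =
     Gamma c * Gamma (c - a - b) * (rGamma c * rGamma (c - a - b) * hyp_series a b c 1)"
    by (simp only: mult_ac)
  ultimately show ?thesis by (simp add: mult.assoc)
qed

section \<open>The hypergeometric equation in logarithmic coordinates\<close>

text \<open>A power series read at \<open>u = - exp \<zeta>\<close>, so that differentiation in
  \<zeta> is the operator \<open>u d/du\<close> and merely multiplies \<open>t n\<close> by
  \<open>n\<close>. The minus sign sends the positive real axis to the edges
  \<open>Im \<zeta> = pi\<close> and \<open>Im \<zeta> = - pi\<close> of the strip.\<close>

definition exp_series :: "(nat \<Rightarrow> complex) \<Rightarrow> complex \<Rightarrow> complex"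
  where "exp_series t \<zeta> = (\<Sum>n. t n * (- exp \<zeta>) ^ n)"

lemma norm_exp_series_term_le:
  assumes "Re \<zeta> \<le> 0"
  shows "norm (t n * (- exp \<zeta>) ^ n) \<le> norm (t n)"
proof -
  have "norm ((- exp \<zeta>) ^ n) \<le> 1"
    using assms by (simp add: norm_power power_le_one)
  thus ?thesis unfolding norm_mult by (simp add: mult_left_le)
qed

lemma exp_series_sums:
  assumes "summable (\<lambda>n. norm (t n))" "Re \<zeta> \<le> 0"
  shows "(\<lambda>n. t n * (- exp \<zeta>) ^ n) sums exp_series t \<zeta>"
  unfolding exp_series_def
  by (rule summable_sums, rule summable_comparison_test'[OF assms(1)])
     (use norm_exp_series_term_le[OF assms(2)] in auto)

text \<open>The differentiated series converges uniformly on the closed half-plane by the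
  Weierstrass test. Derivatives within \<open>X\<close> are essential: later \<open>X\<close> is a
  segment on the boundary line.\<close>

lemma exp_series_has_field_derivative:
  assumes sm: "summable (\<lambda>n. real n * norm (t n))" and X: "X \<subseteq> {\<zeta>. Re \<zeta> \<le> 0}" "\<zeta> \<in> X"
  shows "(exp_series t has_field_derivative exp_series (\<lambda>n. of_nat n * t n) \<zeta>) (at \<zeta> within X)"
proof -
  let ?S = "{\<zeta>. Re \<zeta> \<le> 0}"
  have smn: "summable (\<lambda>n. norm (of_nat n * t n))"
    using sm by (simp add: norm_mult)
  have smt: "summable (\<lambda>n. norm (t n))"
    by (rule summable_comparison_test_ev[OF _ sm])
       (use eventually_gt_at_top[of 0] in eventually_elim, auto simp: mult_le_cancel_right1)
  have "\<exists>g. \<forall>x\<in>?S. (\<lambda>n. t n * (- exp x) ^ n) sums g x \<and>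
     (g has_field_derivative exp_series (\<lambda>n. of_nat n * t n) x) (at x within ?S)"
  proof (rule has_field_derivative_series)
    show "convex ?S" using convex_halfspace_Re_le[of 0] by simp
    show "uniform_limit ?S (\<lambda>n x. \<Sum>i<n. (of_nat i * t i) * (- exp x) ^ i)
            (exp_series (\<lambda>n. of_nat n * t n)) sequentially"
      unfolding exp_series_def
      by (rule Weierstrass_m_test[OF _ smn], rule norm_exp_series_term_le) auto
    show "((\<lambda>x. t n * (- exp x) ^ n) has_field_derivative (of_nat n * t n) * (- exp x) ^ n) (at x within ?S)"
      for n x
    proof -
      have "((\<lambda>x. t n * (- exp x) ^ n) has_field_derivative
          t n * (of_nat n * (- exp x * (- exp x) ^ (n - Suc 0)))) (at x within ?S)"
        by (auto intro!: derivative_eq_intros)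
      moreover have "of_nat n * (- exp x * (- exp x) ^ (n - Suc 0)) = of_nat n * (- exp x) ^ n"
        by (cases n) auto
      ultimately show ?thesis by (simp only: mult_ac)
    qed
    show "0 \<in> ?S" by simp
    show "summable (\<lambda>n. t n * (- exp 0) ^ n)"
      using exp_series_sums[OF smt, of 0] by (simp add: sums_iff)
  qed
  then obtain g where g: "\<And>x. x \<in> ?S \<Longrightarrow> (\<lambda>n. t n * (- exp x) ^ n) sums g x"
     "\<And>x. x \<in> ?S \<Longrightarrow> (g has_field_derivative exp_series (\<lambda>n. of_nat n * t n) x) (at x within ?S)"
    by blast
  have eq: "g x = exp_series t x" if "x \<in> ?S" for x
    using sums_unique2[OF g(1)[OF that] exp_series_sums[OF smt]] that by simp
  have "\<zeta> \<in> ?S" using X by auto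
  from g(2)[OF this] have "(exp_series t has_field_derivative exp_series (\<lambda>n. of_nat n * t n) \<zeta>) (at \<zeta> within ?S)"
    by (rule has_field_derivative_transform_within[of _ _ _ _ 1]) (use eq X in auto)
  thus ?thesis using X(1) by (rule has_field_derivative_subset)
qed

text \<open>Moving far to the left in \<zeta> means \<open>u\<close> tending to 0. The limit serves
  to evaluate the constant of a Wronskian.\<close>

lemma exp_series_tendsto_0:
  assumes "summable (\<lambda>n. norm (t n))"
  shows "(\<lambda>k. exp_series t (- of_nat k)) \<longlonglongrightarrow> t 0"
proof -
  have sm: "summable (\<lambda>n. t n * 1 ^ n)" using summable_norm_cancel[OF assms] by simp
  have "((\<lambda>w. \<Sum>n. t n * w ^ n) \<longlongrightarrow> t 0) (at 0)"
    by (rule powser_limit_0[of 1])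
       (use sm powser_inside[OF sm] in \<open>auto intro!: summable_sums\<close>)
  moreover have "filterlim (\<lambda>k. - exp (- of_nat k) :: complex) (at 0) sequentially"
  proof -
    have "(\<lambda>k. exp (- real k)) \<longlonglongrightarrow> 0"
      by (intro filterlim_compose[OF exp_at_bot] filterlim_compose[OF filterlim_uminus_at_bot_at_top] filterlim_real_sequentially)
    hence "(\<lambda>k. - complex_of_real (exp (- real k))) \<longlonglongrightarrow> - of_real 0"
      by (intro tendsto_intros)
    hence "(\<lambda>k. - exp (- of_nat k) :: complex) \<longlonglongrightarrow> 0"
      by (simp add: exp_of_real[symmetric])
    thus ?thesis by (simp add: filterlim_at)
  qed
  ultimately show ?thesis unfolding exp_series_def by (rule filterlim_compose)
qed

text \<open>The hypergeometric equation in the variable \<open>\<zeta> = Ln (-u)\<close>, solved for the second derivative.\<close>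

definition hyp_ode :: "complex \<Rightarrow> complex \<Rightarrow> complex \<Rightarrow> complex set \<Rightarrow> (complex \<Rightarrow> complex) \<Rightarrow> (complex \<Rightarrow> complex) \<Rightarrow> bool"
  where "hyp_ode a b c X y y' \<longleftrightarrow>
    (\<forall>\<zeta>\<in>X. (y has_field_derivative y' \<zeta>) (at \<zeta> within X) \<and>
       (y' has_field_derivative
          (- ((a + b) * exp \<zeta> + c - 1) * y' \<zeta> - a * b * exp \<zeta> * y \<zeta>) / (1 + exp \<zeta>)) (at \<zeta> within X))"

lemma hyp_ode_commute: "hyp_ode a b c X y y' = hyp_ode b a c X y y'"
  unfolding hyp_ode_def by (simp add: add.commute mult.commute)

text \<open>The function \<open>(- u) powr (1 - c) * (1 - u) powr (c - 1 - a - b)\<close> at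
  \<open>u = - exp \<zeta>\<close>: the solution of the first-order equation that Abel's identity
  prescribes for every Wronskian.\<close>

definition wronskian_weight :: "complex \<Rightarrow> complex \<Rightarrow> complex \<Rightarrow> complex \<Rightarrow> complex"
  where "wronskian_weight a b c \<zeta> = exp (- (c - 1) * \<zeta>) * (1 + exp \<zeta>) powr (c - 1 - a - b)"

lemma one_plus_exp_not_nonpos_Reals:
  assumes "\<bar>Im \<zeta>\<bar> < pi"
  shows "1 + exp \<zeta> \<notin> \<real>\<^sub>\<le>\<^sub>0"
proof
  assume "1 + exp \<zeta> \<in> \<real>\<^sub>\<le>\<^sub>0"
  hence re: "1 + exp (Re \<zeta>) * cos (Im \<zeta>) \<le> 0" and im: "exp (Re \<zeta>) * sin (Im \<zeta>) = 0"
    by (auto simp: complex_nonpos_Reals_iff Re_exp Im_exp)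
  from im have "sin (Im \<zeta>) = 0" by simp
  hence "Im \<zeta> = 0" using assms by (metis abs_less_iff minus_less_iff sin_eq_0_pi)
  with re show False using exp_gt_zero[of "Re \<zeta>"] by (simp add: not_le add_pos_pos)
qed

lemma wronskian_weight_nonzero: "\<bar>Im \<zeta>\<bar> < pi \<Longrightarrow> wronskian_weight a b c \<zeta> \<noteq> 0"
  using one_plus_exp_not_nonpos_Reals[of \<zeta>] by (auto simp: wronskian_weight_def)

lemma wronskian_weight_has_field_derivative:
  assumes "\<bar>Im \<zeta>\<bar> < pi"
  shows "(wronskian_weight a b c has_field_derivative
     - ((a + b) * exp \<zeta> + c - 1) / (1 + exp \<zeta>) * wronskian_weight a b c \<zeta>) (at \<zeta> within X)"
proof -
  have n: "1 + exp \<zeta> \<notin> \<real>\<^sub>\<le>\<^sub>0" by (rule one_plus_exp_not_nonpos_Reals[OF assms])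
  hence nz: "1 + exp \<zeta> \<noteq> 0" by auto
  define s where "s = c - 1 - a - b"
  have "((\<lambda>\<zeta>. exp (- (c - 1) * \<zeta>) * (1 + exp \<zeta>) powr s) has_field_derivative
      (- (c - 1)) * exp (- (c - 1) * \<zeta>) * (1 + exp \<zeta>) powr s
       + exp (- (c - 1) * \<zeta>) * (s * (1 + exp \<zeta>) powr (s - 1) * exp \<zeta>)) (at \<zeta> within X)"
    using n by (auto intro!: derivative_eq_intros)
  also have "(1 + exp \<zeta>) powr (s - 1) = (1 + exp \<zeta>) powr s / (1 + exp \<zeta>)"
    using nz by (simp add: powr_diff)
  also have "(- (c - 1)) * exp (- (c - 1) * \<zeta>) * (1 + exp \<zeta>) powr s
       + exp (- (c - 1) * \<zeta>) * (s * ((1 + exp \<zeta>) powr s / (1 + exp \<zeta>)) * exp \<zeta>) =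
      ((- (c - 1)) + s * exp \<zeta> / (1 + exp \<zeta>)) * (exp (- (c - 1) * \<zeta>) * (1 + exp \<zeta>) powr s)"
    by (simp add: algebra_simps)
  also have "(- (c - 1)) + s * exp \<zeta> / (1 + exp \<zeta>) = - ((a + b) * exp \<zeta> + c - 1) / (1 + exp \<zeta>)"
    using nz by (simp add: s_def divide_simps) (simp add: algebra_simps)
  finally show ?thesis unfolding wronskian_weight_def[abs_def] s_def .
qed

text \<open>Abel's identity: the Wronskian and the weight satisfy the same first-order linear
  equation, so their quotient has derivative zero, and convexity of \<open>X\<close> makes it
  constant. A segment without interior is allowed.\<close>

lemma hyp_ode_wronskian:
  assumes y: "hyp_ode a b c X y y'" and z: "hyp_ode a b c X z z'"
    and X: "convex X" "\<And>\<zeta>. \<zeta> \<in> X \<Longrightarrow> \<bar>Im \<zeta>\<bar> < pi"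
  shows "\<exists>C. \<forall>\<zeta>\<in>X. y \<zeta> * z' \<zeta> - y' \<zeta> * z \<zeta> = C * wronskian_weight a b c \<zeta>"
proof -
  let ?w = "wronskian_weight a b c"
  have "((\<lambda>\<zeta>. (y \<zeta> * z' \<zeta> - y' \<zeta> * z \<zeta>) / ?w \<zeta>) has_field_derivative 0) (at \<zeta> within X)" if "\<zeta> \<in> X" for \<zeta>
  proof -
    define p where "p = - ((a + b) * exp \<zeta> + c - 1) / (1 + exp \<zeta>)"
    define q where "q = - a * b * exp \<zeta> / (1 + exp \<zeta>)"
    have w: "(?w has_field_derivative p * ?w \<zeta>) (at \<zeta> within X)"
      unfolding p_def by (rule wronskian_weight_has_field_derivative[OF X(2)[OF that]])
    have wn: "?w \<zeta> \<noteq> 0" by (rule wronskian_weight_nonzero[OF X(2)[OF that]])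
    have *: "(- ((a + b) * exp \<zeta> + c - 1) * f' - a * b * exp \<zeta> * f) / (1 + exp \<zeta>) = p * f' + q * f" for f f'
      unfolding p_def q_def by (simp add: diff_divide_distrib add_divide_distrib algebra_simps)
    note d = y[unfolded hyp_ode_def, rule_format, OF that, unfolded *]
      z[unfolded hyp_ode_def, rule_format, OF that, unfolded *]
    note d' = d(1)[THEN conjunct1] d(1)[THEN conjunct2] d(2)[THEN conjunct1] d(2)[THEN conjunct2]
    show ?thesis
      by (rule DERIV_cong[OF DERIV_divide[OF DERIV_diff[OF DERIV_mult[OF d'(1) d'(4)] DERIV_mult[OF d'(2) d'(3)]] w wn]])
         (use wn in \<open>simp add: field_simps\<close>)
  qed
  from has_field_derivative_zero_constant[OF X(1) this] obtain C where
    "\<And>\<zeta>. \<zeta> \<in> X \<Longrightarrow> (y \<zeta> * z' \<zeta> - y' \<zeta> * z \<zeta>) / ?w \<zeta> = C" by blast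
  hence "\<forall>\<zeta>\<in>X. y \<zeta> * z' \<zeta> - y' \<zeta> * z \<zeta> = C * ?w \<zeta>"
    using wronskian_weight_nonzero[OF X(2)] by (metis nonzero_divide_eq_eq)
  thus ?thesis by blast
qed

text \<open>The coefficient recurrence, multiplied by the power \<open>Suc n\<close> of
  \<open>- exp \<zeta>\<close> and summed; the factors \<open>n\<close> become derivatives.\<close>

lemma hyp_coeff_exp_series_ode:
  assumes c: "c \<notin> \<int>\<^sub>\<le>\<^sub>0" and Re: "Re (c - a - b) \<ge> 5" and \<zeta>: "Re \<zeta> \<le> 0"
  defines "t \<equiv> hyp_coeff a b c"
  shows "(1 + exp \<zeta>) * exp_series (\<lambda>n. of_nat n * (of_nat n * t n)) \<zeta> =
    - ((a + b) * exp \<zeta> + c - 1) * exp_series (\<lambda>n. of_nat n * t n) \<zeta> - a * b * exp \<zeta> * exp_series t \<zeta>"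
proof -
  let ?u = "- exp \<zeta>"
  let ?T0 = "exp_series t \<zeta>" and ?T1 = "exp_series (\<lambda>n. of_nat n * t n) \<zeta>"
   and ?T2 = "exp_series (\<lambda>n. of_nat n * (of_nat n * t n)) \<zeta>"
  note sm = summable_hyp_coeff_square[OF Re, folded t_def]
  have le: "real n \<le> real n ^ 2" for n by (cases n) (auto simp: power2_eq_square)
  have s0: "(\<lambda>n. t n * ?u ^ n) sums ?T0"
    by (rule exp_series_sums[OF _ \<zeta>]) (use summable_hyp_coeff_norm[OF Re] t_def in simp)
  have s1: "(\<lambda>n. of_nat n * t n * ?u ^ n) sums ?T1"
    by (rule exp_series_sums[OF _ \<zeta>], rule summable_comparison_test'[OF sm])
       (use le in \<open>auto simp: norm_mult intro!: mult_right_mono\<close>)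
  have s2: "(\<lambda>n. of_nat n * (of_nat n * t n) * ?u ^ n) sums ?T2"
    by (rule exp_series_sums[OF _ \<zeta>]) (use sm in \<open>simp add: norm_mult power2_eq_square mult.assoc\<close>)
  have "(\<lambda>n. of_nat n * (of_nat n * t n) * ?u ^ n + (c - 1) * (of_nat n * t n * ?u ^ n)) sums (?T2 + (c - 1) * ?T1)"
    by (intro sums_add sums_mult s1 s2)
  \<comment> \<open>The index may be shifted without a correction, since the term of index 0 carries
    a factor 0.\<close>
  hence "(\<lambda>n. of_nat (Suc n) * (of_nat (Suc n) * t (Suc n)) * ?u ^ Suc n +
     (c - 1) * (of_nat (Suc n) * t (Suc n) * ?u ^ Suc n)) sums (?T2 + (c - 1) * ?T1)"
    by (subst sums_Suc_iff) simp
  also have "(\<lambda>n. of_nat (Suc n) * (of_nat (Suc n) * t (Suc n)) * ?u ^ Suc n +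
     (c - 1) * (of_nat (Suc n) * t (Suc n) * ?u ^ Suc n)) =
     (\<lambda>n. ?u * (of_nat n * (of_nat n * t n) * ?u ^ n + (a + b) * (of_nat n * t n * ?u ^ n) + a * b * (t n * ?u ^ n)))"
  proof
    fix n
    have "of_nat (Suc n) * (of_nat (Suc n) * t (Suc n)) * ?u ^ Suc n +
        (c - 1) * (of_nat (Suc n) * t (Suc n) * ?u ^ Suc n) =
       ?u ^ Suc n * ((c + of_nat n) * of_nat (Suc n) * t (Suc n))"
      by (simp add: algebra_simps)
    also have "\<dots> = ?u ^ Suc n * ((a + of_nat n) * (b + of_nat n) * t n)"
      unfolding t_def hyp_coeff_recurrence[OF c] ..
    also have "\<dots> = ?u * (of_nat n * (of_nat n * t n) * ?u ^ n + (a + b) * (of_nat n * t n * ?u ^ n) + a * b * (t n * ?u ^ n))"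
      by (simp add: algebra_simps)
    finally show "of_nat (Suc n) * (of_nat (Suc n) * t (Suc n)) * ?u ^ Suc n +
        (c - 1) * (of_nat (Suc n) * t (Suc n) * ?u ^ Suc n) = \<dots>" .
  qed
  finally have A: "\<dots> sums (?T2 + (c - 1) * ?T1)" .
  have "(\<lambda>n. ?u * (of_nat n * (of_nat n * t n) * ?u ^ n + (a + b) * (of_nat n * t n * ?u ^ n) + a * b * (t n * ?u ^ n)))
      sums (?u * (?T2 + (a + b) * ?T1 + a * b * ?T0))"
    by (intro sums_add sums_mult s0 s1 s2)
  from sums_unique2[OF A this] show ?thesis by (simp add: algebra_simps)
qed

lemma summable_n_hyp_coeff:
  assumes "Re (c - a - b) \<ge> 5"
  shows "summable (\<lambda>n. real n * norm (hyp_coeff a b c n))"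
proof -
  have "real n \<le> real n ^ 2" for n by (cases n) (auto simp: power2_eq_square)
  thus ?thesis
    by (intro summable_comparison_test'[OF summable_hyp_coeff_square[OF assms]])
       (auto intro!: mult_right_mono)
qed

lemma hyp_series_eq_exp_series: "hyp_series a b c (- exp \<zeta>) = exp_series (hyp_coeff a b c) \<zeta>"
  by (simp add: hyp_series_def exp_series_def)

lemma hyp_ode_at_0:
  assumes c: "c \<notin> \<int>\<^sub>\<le>\<^sub>0" and Re: "Re (c - a - b) \<ge> 5"
    and X: "X \<subseteq> {\<zeta>. Re \<zeta> \<le> 0}" "\<And>\<zeta>. \<zeta> \<in> X \<Longrightarrow> \<bar>Im \<zeta>\<bar> < pi"
  shows "hyp_ode a b c X (exp_series (hyp_coeff a b c)) (exp_series (\<lambda>n. of_nat n * hyp_coeff a b c n))"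
  unfolding hyp_ode_def
proof (intro ballI conjI)
  fix \<zeta> assume \<zeta>: "\<zeta> \<in> X"
  let ?t = "hyp_coeff a b c"
  show "(exp_series ?t has_field_derivative exp_series (\<lambda>n. of_nat n * ?t n) \<zeta>) (at \<zeta> within X)"
    by (rule exp_series_has_field_derivative[OF summable_n_hyp_coeff[OF Re] X(1) \<zeta>])
  have nz: "1 + exp \<zeta> \<noteq> 0" using one_plus_exp_not_nonpos_Reals[OF X(2)[OF \<zeta>]] by auto
  have "(exp_series (\<lambda>n. of_nat n * ?t n) has_field_derivative exp_series (\<lambda>n. of_nat n * (of_nat n * ?t n)) \<zeta>) (at \<zeta> within X)"
    by (rule exp_series_has_field_derivative[OF _ X(1) \<zeta>])
       (use summable_hyp_coeff_square[OF Re] in \<open>simp add: norm_mult power2_eq_square mult.assoc\<close>)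
  also have "exp_series (\<lambda>n. of_nat n * (of_nat n * ?t n)) \<zeta> =
      (- ((a + b) * exp \<zeta> + c - 1) * exp_series (\<lambda>n. of_nat n * ?t n) \<zeta> - a * b * exp \<zeta> * exp_series ?t \<zeta>) / (1 + exp \<zeta>)"
    using hyp_coeff_exp_series_ode[OF c Re, of \<zeta>] X(1) \<zeta> nz by (auto simp: eq_divide_eq mult.commute)
  finally show "(exp_series (\<lambda>n. of_nat n * ?t n) has_field_derivative \<dots>) (at \<zeta> within X)" .
qed

text \<open>
  The solution with exponent \<open>a\<close> at \<open>u = \<infinity>\<close>, in the variable \<open>\<zeta>\<close>, and its derivative.
\<close>

definition hyp_sol_inf :: "complex \<Rightarrow> complex \<Rightarrow> complex \<Rightarrow> complex \<Rightarrow> complex"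
  where "hyp_sol_inf a b c \<zeta> = exp (- a * \<zeta>) * hyp_series a (a - c + 1) (a - b + 1) (- exp (- \<zeta>))"

definition hyp_sol_inf' :: "complex \<Rightarrow> complex \<Rightarrow> complex \<Rightarrow> complex \<Rightarrow> complex"
  where "hyp_sol_inf' a b c \<zeta> =
    exp (- a * \<zeta>) * (- a * exp_series (hyp_coeff a (a - c + 1) (a - b + 1)) (- \<zeta>)
       - exp_series (\<lambda>n. of_nat n * hyp_coeff a (a - c + 1) (a - b + 1) n) (- \<zeta>))"

lemma add_1_not_nonpos_Ints: "(z::complex) \<notin> \<int> \<Longrightarrow> z + 1 \<notin> \<int>\<^sub>\<le>\<^sub>0"
  by (metis Ints_1 Ints_diff add_diff_cancel_right' nonpos_Ints_Int)

text \<open>The reflection of \<zeta> and the factor \<open>exp (- a * \<zeta>)\<close> carry the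
  equation with parameters \<open>a\<close>, \<open>a - c + 1\<close>, \<open>a - b + 1\<close> to
  the one with \<open>a\<close>, \<open>b\<close>, \<open>c\<close>.\<close>

lemma hyp_ode_at_inf:
  assumes ab: "a - b \<notin> \<int>" and Re: "Re (c - a - b) \<ge> 5"
    and X: "X \<subseteq> {\<zeta>. Re \<zeta> \<ge> 0}" "\<And>\<zeta>. \<zeta> \<in> X \<Longrightarrow> \<bar>Im \<zeta>\<bar> < pi"
  shows "hyp_ode a b c X (hyp_sol_inf a b c) (hyp_sol_inf' a b c)"
  unfolding hyp_ode_def
proof (intro ballI conjI)
  fix \<zeta> assume \<zeta>: "\<zeta> \<in> X"
  let ?s = "hyp_coeff a (a - c + 1) (a - b + 1)"
  let ?e = "a - c + 1" and ?d = "a - b + 1"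
  have d: "?d \<notin> \<int>\<^sub>\<le>\<^sub>0" by (rule add_1_not_nonpos_Ints[OF ab])
  \<comment> \<open>The excess of the new parameters is again \<open>c - a - b\<close>.\<close>
  have Re': "Re (?d - a - ?e) \<ge> 5" using Re by simp
  have X': "uminus ` X \<subseteq> {\<zeta>. Re \<zeta> \<le> 0}" "- \<zeta> \<in> uminus ` X" using X \<zeta> by auto
  define Y0 where "Y0 = exp_series ?s"
  define Y1 where "Y1 = exp_series (\<lambda>n. of_nat n * ?s n)"
  define Y2 where "Y2 = exp_series (\<lambda>n. of_nat n * (of_nat n * ?s n))"
  have y0: "(Y0 has_field_derivative Y1 (- \<zeta>)) (at (- \<zeta>) within uminus ` X)"
    unfolding Y0_def Y1_def
    by (rule exp_series_has_field_derivative[OF summable_n_hyp_coeff[OF Re'] X'])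
  have y1: "(Y1 has_field_derivative Y2 (- \<zeta>)) (at (- \<zeta>) within uminus ` X)"
    unfolding Y1_def Y2_def
    by (rule exp_series_has_field_derivative[OF _ X'])
       (use summable_hyp_coeff_square[OF Re'] in \<open>simp add: norm_mult power2_eq_square mult.assoc\<close>)
  have neg: "((uminus :: complex \<Rightarrow> complex) has_field_derivative - 1) (at \<zeta> within X)"
    by (auto intro!: derivative_eq_intros)
  note y0' = DERIV_image_chain[OF y0 neg, unfolded o_def]
  note y1' = DERIV_image_chain[OF y1 neg, unfolded o_def]
  have ex: "((\<lambda>x. exp (- a * x)) has_field_derivative - a * exp (- a * \<zeta>)) (at \<zeta> within X)"
    by (auto intro!: derivative_eq_intros)
  have eq0: "hyp_sol_inf a b c = (\<lambda>\<zeta>. exp (- a * \<zeta>) * Y0 (- \<zeta>))"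
    unfolding hyp_sol_inf_def hyp_series_eq_exp_series Y0_def by simp
  have eq1: "hyp_sol_inf' a b c = (\<lambda>\<zeta>. exp (- a * \<zeta>) * (- a * Y0 (- \<zeta>) - Y1 (- \<zeta>)))"
    unfolding hyp_sol_inf'_def Y0_def Y1_def by simp
  show "(hyp_sol_inf a b c has_field_derivative hyp_sol_inf' a b c \<zeta>) (at \<zeta> within X)"
    unfolding eq0 eq1
    by (rule DERIV_cong[OF DERIV_mult[OF ex y0']]) (simp add: algebra_simps)
  have nz: "1 + exp \<zeta> \<noteq> 0" using one_plus_exp_not_nonpos_Reals[OF X(2)[OF \<zeta>]] by auto
  have "(1 + exp (- \<zeta>)) * Y2 (- \<zeta>) = - ((a + ?e) * exp (- \<zeta>) + ?d - 1) * Y1 (- \<zeta>) - a * ?e * exp (- \<zeta>) * Y0 (- \<zeta>)"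
    unfolding Y0_def Y1_def Y2_def
    by (rule hyp_coeff_exp_series_ode[OF d Re']) (use X \<zeta> in auto)
  \<comment> \<open>Multiplying by \<open>exp \<zeta>\<close> clears \<open>exp (- \<zeta>)\<close>
    and restores the leading factor \<open>1 + exp \<zeta>\<close> of the target equation.\<close>
  hence "exp \<zeta> * ((1 + exp (- \<zeta>)) * Y2 (- \<zeta>)) = 
     exp \<zeta> * (- ((a + ?e) * exp (- \<zeta>) + ?d - 1) * Y1 (- \<zeta>) - a * ?e * exp (- \<zeta>) * Y0 (- \<zeta>))"
    by (simp only:)
  also have "\<dots> = - ((a + ?e) * (exp \<zeta> * exp (- \<zeta>)) + (a - b) * exp \<zeta>) * Y1 (- \<zeta>)
      - a * ?e * (exp \<zeta> * exp (- \<zeta>)) * Y0 (- \<zeta>)"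
    by (simp add: algebra_simps)
  also have "exp \<zeta> * ((1 + exp (- \<zeta>)) * Y2 (- \<zeta>)) = (exp \<zeta> + exp \<zeta> * exp (- \<zeta>)) * Y2 (- \<zeta>)"
    by (simp add: algebra_simps)
  also have "exp \<zeta> * exp (- \<zeta>) = 1" by (simp add: exp_minus)
  finally have ode: "(1 + exp \<zeta>) * Y2 (- \<zeta>) = - (a + ?e + (a - b) * exp \<zeta>) * Y1 (- \<zeta>) - a * ?e * Y0 (- \<zeta>)"
    by (simp add: add.commute)
  let ?E = "exp (- a * \<zeta>)"
  have "(hyp_sol_inf' a b c has_field_derivative ?E * (a\<^sup>2 * Y0 (- \<zeta>) + 2 * a * Y1 (- \<zeta>) + Y2 (- \<zeta>))) (at \<zeta> within X)"
    unfolding eq1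
    by (rule DERIV_cong[OF DERIV_mult[OF ex DERIV_diff[OF DERIV_cmult[OF y0'] y1']]])
       (simp add: algebra_simps power2_eq_square)
  also have "?E * (a\<^sup>2 * Y0 (- \<zeta>) + 2 * a * Y1 (- \<zeta>) + Y2 (- \<zeta>)) =
     (- ((a + b) * exp \<zeta> + c - 1) * hyp_sol_inf' a b c \<zeta> - a * b * exp \<zeta> * hyp_sol_inf a b c \<zeta>) / (1 + exp \<zeta>)"
  proof -
    have "(1 + exp \<zeta>) * (a\<^sup>2 * Y0 (- \<zeta>) + 2 * a * Y1 (- \<zeta>) + Y2 (- \<zeta>)) =
      (1 + exp \<zeta>) * (a\<^sup>2 * Y0 (- \<zeta>) + 2 * a * Y1 (- \<zeta>)) + (1 + exp \<zeta>) * Y2 (- \<zeta>)"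
      by (simp add: algebra_simps)
    also have "\<dots> = - ((a + b) * exp \<zeta> + c - 1) * (- a * Y0 (- \<zeta>) - Y1 (- \<zeta>)) - a * b * exp \<zeta> * Y0 (- \<zeta>)"
      unfolding ode by (simp add: algebra_simps power2_eq_square)
    finally have "?E * ((1 + exp \<zeta>) * (a\<^sup>2 * Y0 (- \<zeta>) + 2 * a * Y1 (- \<zeta>) + Y2 (- \<zeta>))) =
       ?E * (- ((a + b) * exp \<zeta> + c - 1) * (- a * Y0 (- \<zeta>) - Y1 (- \<zeta>)) - a * b * exp \<zeta> * Y0 (- \<zeta>))" by simp
    also have "\<dots> = - ((a + b) * exp \<zeta> + c - 1) * (?E * (- a * Y0 (- \<zeta>) - Y1 (- \<zeta>))) - a * b * exp \<zeta> * (?E * Y0 (- \<zeta>))"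
      by (simp add: right_diff_distrib mult_ac)
    finally show ?thesis using nz unfolding eq0 eq1
      by (subst eq_divide_eq) (simp add: mult_ac)
  qed
  finally show "(hyp_sol_inf' a b c has_field_derivative \<dots>) (at \<zeta> within X)" .
qed

text \<open>Far to the right, \<open>1 + exp \<zeta>\<close> behaves like
  \<open>exp \<zeta>\<close>, so the weight behaves like \<open>exp (- (a + b) * \<zeta>)\<close>,
  the product of the leading factors of the two solutions at infinity.\<close>

lemma wronskian_weight_tendsto:
  "(\<lambda>k. exp ((a + b) * of_nat k) * wronskian_weight a b c (of_nat k)) \<longlonglongrightarrow> 1"
proof -
  define s where "s = c - 1 - a - b"
  have eq: "exp ((a + b) * of_nat k) * wronskian_weight a b c (of_nat k) =
      exp (s * of_real (ln (1 + exp (- real k))))" for k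
  proof -
    have pos: "1 + exp (real k) > 0" by (simp add: add_pos_pos)
    have "1 + exp (of_nat k :: complex) = of_real (1 + exp (real k))"
      by (simp add: exp_of_real[symmetric])
    hence "(1 + exp (of_nat k :: complex)) powr s = exp (s * of_real (ln (1 + exp (real k))))"
      using pos by (simp add: powr_def Ln_of_real del: of_real_add)
    moreover have "1 + exp (real k) = exp (real k) * (1 + exp (- real k))"
      by (simp add: exp_minus field_simps)
    hence "ln (1 + exp (real k)) = real k + ln (1 + exp (- real k))"
      by (simp add: ln_mult_pos add_pos_pos)
    ultimately have "wronskian_weight a b c (of_nat k) =
       exp (- (c - 1) * of_nat k) * exp (s * (of_nat k + of_real (ln (1 + exp (- real k)))))"
      unfolding wronskian_weight_def s_def by simp
    thus ?thesis unfolding s_def by (simp add: exp_add[symmetric] algebra_simps)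
  qed
  have "(\<lambda>k. exp (- real k)) \<longlonglongrightarrow> 0"
    by (intro filterlim_compose[OF exp_at_bot] filterlim_compose[OF filterlim_uminus_at_bot_at_top] filterlim_real_sequentially)
  hence "(\<lambda>k. exp (s * of_real (ln (1 + exp (- real k))))) \<longlonglongrightarrow> exp (s * of_real (ln (1 + 0)))"
    by (intro tendsto_intros) auto
  thus ?thesis unfolding eq by simp
qed

text \<open>The constant in Abel's identity is read off along the positive integers. It is nonzero,
  so the two solutions at infinity form a basis.\<close>

lemma wronskian_at_inf:
  assumes ab: "a - b \<notin> \<int>" and Re: "Re (c - a - b) \<ge> 5" and \<zeta>: "Re \<zeta> \<ge> 0" "\<bar>Im \<zeta>\<bar> < pi"
  shows "hyp_sol_inf a b c \<zeta> * hyp_sol_inf' b a c \<zeta> - hyp_sol_inf' a b c \<zeta> * hyp_sol_inf b a c \<zeta> =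
     (a - b) * wronskian_weight a b c \<zeta>"
proof -
  define X where "X = {\<zeta>. Re \<zeta> \<ge> 0} \<inter> ({\<zeta>. Im \<zeta> < pi} \<inter> {\<zeta>. Im \<zeta> > - pi})"
  have X: "convex X" "X \<subseteq> {\<zeta>. Re \<zeta> \<ge> 0}" "\<And>\<zeta>. \<zeta> \<in> X \<Longrightarrow> \<bar>Im \<zeta>\<bar> < pi"
    unfolding X_def
    by (intro convex_Int convex_halfspace_Re_ge convex_halfspace_Im_lt convex_halfspace_Im_gt) auto
  have ba: "b - a \<notin> \<int>" using ab by (metis Ints_minus minus_diff_eq)
  have Re': "Re (c - b - a) \<ge> 5" using Re by simp
  have "hyp_ode a b c X (hyp_sol_inf b a c) (hyp_sol_inf' b a c)"
    using hyp_ode_at_inf[OF ba Re' X(2,3)] by (simp add: hyp_ode_commute)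
  from hyp_ode_wronskian[OF hyp_ode_at_inf[OF ab Re X(2,3)] this X(1,3)] obtain C where
    C: "\<And>\<zeta>. \<zeta> \<in> X \<Longrightarrow> hyp_sol_inf a b c \<zeta> * hyp_sol_inf' b a c \<zeta> - hyp_sol_inf' a b c \<zeta> * hyp_sol_inf b a c \<zeta> =
       C * wronskian_weight a b c \<zeta>" by blast
  define S0 where "S0 a b k = exp_series (hyp_coeff a (a - c + 1) (a - b + 1)) (- of_nat k)" for a b and k :: nat
  define S1 where "S1 a b k = exp_series (\<lambda>n. of_nat n * hyp_coeff a (a - c + 1) (a - b + 1) n) (- of_nat k)"
    for a b and k :: nat
  have S0_lim: "S0 a b \<longlonglongrightarrow> 1" and S1_lim: "S1 a b \<longlonglongrightarrow> 0" if "Re (c - a - b) \<ge> 5" for a b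
    using exp_series_tendsto_0[of "hyp_coeff a (a - c + 1) (a - b + 1)"]
      exp_series_tendsto_0[of "\<lambda>n. of_nat n * hyp_coeff a (a - c + 1) (a - b + 1) n"]
      summable_hyp_coeff_norm[of "a - b + 1" a "a - c + 1"]
      summable_n_hyp_coeff[of "a - b + 1" a "a - c + 1"] that
    by (simp_all add: S0_def[abs_def] S1_def[abs_def] norm_mult)
  have "exp ((a + b) * of_nat k) * (C * wronskian_weight a b c (of_nat k)) =
      S0 a b k * (- b * S0 b a k - S1 b a k) - (- a * S0 a b k - S1 a b k) * S0 b a k" for k
  proof -
    have "of_nat k \<in> X" unfolding X_def by simp
    have "hyp_sol_inf a b c (of_nat k) * hyp_sol_inf' b a c (of_nat k) - hyp_sol_inf' a b c (of_nat k) * hyp_sol_inf b a c (of_nat k)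
       = exp (- a * of_nat k) * exp (- b * of_nat k) *
        (S0 a b k * (- b * S0 b a k - S1 b a k) - (- a * S0 a b k - S1 a b k) * S0 b a k)"
      unfolding hyp_sol_inf_def hyp_sol_inf'_def hyp_series_eq_exp_series S0_def S1_def by (simp add: algebra_simps)
    also have "hyp_sol_inf a b c (of_nat k) * hyp_sol_inf' b a c (of_nat k) - hyp_sol_inf' a b c (of_nat k) * hyp_sol_inf b a c (of_nat k)
       = C * wronskian_weight a b c (of_nat k)" by (rule C) fact
    finally have "exp ((a + b) * of_nat k) * (C * wronskian_weight a b c (of_nat k)) =
       (exp ((a + b) * of_nat k) * (exp (- a * of_nat k) * exp (- b * of_nat k))) *
        (S0 a b k * (- b * S0 b a k - S1 b a k) - (- a * S0 a b k - S1 a b k) * S0 b a k)"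
      by (simp only: mult.assoc)
    also have "exp ((a + b) * of_nat k) * (exp (- a * of_nat k) * exp (- b * of_nat k)) = 1"
      unfolding exp_add[symmetric] by (simp add: algebra_simps)
    finally show ?thesis by simp
  qed
  moreover have "(\<lambda>k. C * (exp ((a + b) * of_nat k) * wronskian_weight a b c (of_nat k))) \<longlonglongrightarrow> C * 1"
    by (intro tendsto_intros wronskian_weight_tendsto)
  \<comment> \<open>Only leading coefficients survive: 1 for \<open>S0\<close>, and 0 for
    \<open>S1\<close> because of the factor \<open>n\<close>. What remains is
    \<open>- b + a\<close>.\<close>
  moreover have "(\<lambda>k. S0 a b k * (- b * S0 b a k - S1 b a k) - (- a * S0 a b k - S1 a b k) * S0 b a k)
      \<longlonglongrightarrow> 1 * (- b * 1 - 0) - (- a * 1 - 0) * 1"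
    by (intro tendsto_intros S0_lim S1_lim Re Re')
  ultimately have "C = a - b"
    using LIMSEQ_unique by (fastforce simp: mult_ac)
  moreover have "\<zeta> \<in> X" using \<zeta> unfolding X_def by auto
  ultimately show ?thesis using C by blast
qed

text \<open>On the open segment all three functions solve the equation, and Cramer's rule expresses
  one by the other two with Wronskians as coefficients. Since all Wronskians are multiples of one
  weight, the coefficients are constants.\<close>

lemma hyp_line_relation:
  assumes ab: "a - b \<notin> \<int>" and c: "c \<notin> \<int>\<^sub>\<le>\<^sub>0" and Re: "Re (c - a - b) \<ge> 5"
  obtains P Q where "\<And>y. \<bar>y\<bar> \<le> pi \<Longrightarrow> hyp_series a b c (- exp (\<i> * of_real y)) =
     P * hyp_sol_inf a b c (\<i> * of_real y) + Q * hyp_sol_inf b a c (\<i> * of_real y)"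
proof -
  define X where "X = {\<zeta>. Re \<zeta> = 0} \<inter> ({\<zeta>. Im \<zeta> < pi} \<inter> {\<zeta>. Im \<zeta> > - pi})"
  have "convex {\<zeta>. Re \<zeta> = 0}" using convex_hyperplane[of "1::complex" 0] by simp
  hence X: "convex X" "X \<subseteq> {\<zeta>. Re \<zeta> \<ge> 0}" "X \<subseteq> {\<zeta>. Re \<zeta> \<le> 0}" "\<And>\<zeta>. \<zeta> \<in> X \<Longrightarrow> \<bar>Im \<zeta>\<bar> < pi"
    unfolding X_def
    by (auto intro!: convex_Int convex_halfspace_Im_lt convex_halfspace_Im_gt)
  have ba: "b - a \<notin> \<int>" using ab by (metis Ints_minus minus_diff_eq)
  have Re': "Re (c - b - a) \<ge> 5" using Re by simp
  define F where "F = exp_series (hyp_coeff a b c)"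
  define F' where "F' = exp_series (\<lambda>n. of_nat n * hyp_coeff a b c n)"
  define A where "A = hyp_sol_inf a b c" define A' where "A' = hyp_sol_inf' a b c"
  define B where "B = hyp_sol_inf b a c" define B' where "B' = hyp_sol_inf' b a c"
  have oF: "hyp_ode a b c X F F'" unfolding F_def F'_def by (rule hyp_ode_at_0[OF c Re X(3,4)])
  have oA: "hyp_ode a b c X A A'" unfolding A_def A'_def by (rule hyp_ode_at_inf[OF ab Re X(2,4)])
  have oB: "hyp_ode a b c X B B'" unfolding B_def B'_def 
    using hyp_ode_at_inf[OF ba Re' X(2,4)] by (simp add: hyp_ode_commute)
  obtain C1 where C1: "\<And>\<zeta>. \<zeta> \<in> X \<Longrightarrow> F \<zeta> * B' \<zeta> - F' \<zeta> * B \<zeta> = C1 * wronskian_weight a b c \<zeta>"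
    using hyp_ode_wronskian[OF oF oB X(1,4)] by blast
  obtain C2 where C2: "\<And>\<zeta>. \<zeta> \<in> X \<Longrightarrow> A \<zeta> * F' \<zeta> - A' \<zeta> * F \<zeta> = C2 * wronskian_weight a b c \<zeta>"
    using hyp_ode_wronskian[OF oA oF X(1,4)] by blast
  have anb: "a - b \<noteq> 0" using ab by auto
  have rel: "F \<zeta> = C1 / (a - b) * A \<zeta> + C2 / (a - b) * B \<zeta>" if "\<zeta> \<in> X" for \<zeta>
  proof -
    let ?w = "wronskian_weight a b c \<zeta>"
    have W: "A \<zeta> * B' \<zeta> - A' \<zeta> * B \<zeta> = (a - b) * ?w"
      unfolding A_def A'_def B_def B'_def
      by (rule wronskian_at_inf[OF ab Re]) (use that in \<open>auto simp: X_def\<close>)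
    \<comment> \<open>The identity behind Cramer's rule: the mixed terms with
      \<open>A * B * F'\<close> cancel.\<close>
    have "?w * ((a - b) * F \<zeta>) = (A \<zeta> * B' \<zeta> - A' \<zeta> * B \<zeta>) * F \<zeta>" unfolding W by simp
    also have "\<dots> = A \<zeta> * (F \<zeta> * B' \<zeta> - F' \<zeta> * B \<zeta>) + B \<zeta> * (A \<zeta> * F' \<zeta> - A' \<zeta> * F \<zeta>)"
      by (simp add: algebra_simps)
    also have "\<dots> = ?w * (C1 * A \<zeta> + C2 * B \<zeta>)" unfolding C1[OF that] C2[OF that] by (simp add: algebra_simps)
    finally have "(a - b) * F \<zeta> = C1 * A \<zeta> + C2 * B \<zeta>"
      using wronskian_weight_nonzero[OF X(4)[OF that]] by simp
    hence "F \<zeta> = (C1 * A \<zeta> + C2 * B \<zeta>) / (a - b)" using anb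
      by (metis nonzero_mult_div_cancel_left)
    thus ?thesis by (simp add: add_divide_distrib)
  qed
  define g where "g y = F (\<i> * of_real y) - (C1 / (a - b) * A (\<i> * of_real y) + C2 / (a - b) * B (\<i> * of_real y))" for y
  have cE: "continuous_on {\<zeta>. Re \<zeta> = 0} (exp_series (hyp_coeff a b c))" if "Re (c - a - b) \<ge> 5" for a b c
    by (rule DERIV_continuous_on[OF exp_series_has_field_derivative[OF summable_n_hyp_coeff[OF that]]]) auto
  have cE1: "continuous_on UNIV (\<lambda>y::real. exp_series (hyp_coeff a b c) (\<i> * of_real y))"
           "continuous_on UNIV (\<lambda>y::real. exp_series (hyp_coeff a b c) (- (\<i> * of_real y)))"
    if "Re (c - a - b) \<ge> 5" for a b c
    by (rule continuous_on_compose2[OF cE[OF that]], auto intro!: continuous_intros)+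
  \<comment> \<open>At the endpoints \<open>1 + exp \<zeta>\<close> vanishes and the equation is
    singular, but the series still converge there; continuity extends the relation to
    \<open>\<bar>y\<bar> = pi\<close>.\<close>
  have "continuous_on UNIV g"
    unfolding g_def F_def A_def B_def hyp_sol_inf_def hyp_series_eq_exp_series
    by (intro continuous_intros cE1) (use Re in auto)
  hence "continuous_on (closure {- pi<..<pi}) g" by (rule continuous_on_subset) auto
  moreover have "g y = 0" if "y \<in> {- pi<..<pi}" for y
    unfolding g_def using rel[of "\<i> * of_real y"] that by (simp add: X_def)
  ultimately have "g y = 0" if "y \<in> closure {- pi<..<pi}" for y
    using continuous_constant_on_closure that by blast
  hence "g y = 0" if "\<bar>y\<bar> \<le> pi" for y using that by (simp add: closure_greaterThanLessThan abs_le_iff)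
  hence "F (\<i> * of_real y) = C1 / (a - b) * A (\<i> * of_real y) + C2 / (a - b) * B (\<i> * of_real y)" if "\<bar>y\<bar> \<le> pi" for y
    using that unfolding g_def by simp
  thus ?thesis
    by (intro that[of "C1 / (a - b)" "C2 / (a - b)"]) (simp add: F_def A_def B_def hyp_series_eq_exp_series)
qed

text \<open>The coefficient of the solution with exponent \<open>a\<close> at infinity. With
  \<open>rGamma\<close> it is simply 0 when \<open>b\<close> or \<open>c - a\<close> is a
  nonpositive integer.\<close>

definition conn_coeff :: "complex \<Rightarrow> complex \<Rightarrow> complex \<Rightarrow> complex"
  where "conn_coeff a b c = Gamma c * Gamma (b - a) * rGamma b * rGamma (c - a)"

lemma sin_pi_times_nonzero:
  assumes "(z::complex) \<notin> \<int>"
  shows "sin (of_real pi * z) \<noteq> 0"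
proof -
  have "1 - z \<notin> \<int>" using assms by (metis Ints_1 Ints_diff add_diff_cancel_left' diff_add_cancel)
  hence "rGamma z * rGamma (1 - z) \<noteq> 0" using assms by (auto simp: rGamma_eq_zero_iff)
  thus ?thesis unfolding rGamma_reflection_complex by simp
qed

text \<open>Two uses of the reflection formula turn the Gamma factors into sines. In this form the
  coefficient appears when the linear system at \<open>y = pi\<close> and \<open>y = - pi\<close> is
  solved.\<close>

lemma Gauss_conn_coeff:
  assumes ab: "a - b \<notin> \<int>" and c: "c \<notin> \<int>\<^sub>\<le>\<^sub>0" and Re: "Re (c - a - b) \<ge> 5"
  shows "conn_coeff a b c * hyp_series a (a - c + 1) (a - b + 1) 1 * sin (of_real pi * (b - a)) =
     hyp_series a b c 1 * sin (of_real pi * b)"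
proof -
  have d: "a - b + 1 \<notin> \<int>\<^sub>\<le>\<^sub>0" by (rule add_1_not_nonpos_Ints[OF ab])
  have "hyp_series a (a - c + 1) (a - b + 1) 1 =
      Gamma (a - b + 1) * Gamma (a - b + 1 - a - (a - c + 1)) * rGamma (a - b + 1 - a) * rGamma (a - b + 1 - (a - c + 1))"
    by (rule Gauss_hyp_series_1[OF d]) (use Re in simp)
  hence g1: "hyp_series a (a - c + 1) (a - b + 1) 1 =
      Gamma (1 - (b - a)) * Gamma (c - a - b) * rGamma (1 - b) * rGamma (c - b)"
    by (simp add: algebra_simps)
  have g: "hyp_series a b c 1 = Gamma c * Gamma (c - a - b) * rGamma (c - a) * rGamma (c - b)"
    by (rule Gauss_hyp_series_1[OF c Re])
  have ba: "b - a \<notin> \<int>" using ab by (metis Ints_minus minus_diff_eq)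
  note nz = sin_pi_times_nonzero[OF ba]
  have r: "Gamma (b - a) * Gamma (1 - (b - a)) * sin (of_real pi * (b - a)) = of_real pi"
    using Gamma_reflection_complex[of "b - a"] nz by simp
  have r2: "sin (of_real pi * b) = of_real pi * (rGamma b * rGamma (1 - b))"
    using rGamma_reflection_complex[of b] by simp
  have "conn_coeff a b c * hyp_series a (a - c + 1) (a - b + 1) 1 * sin (of_real pi * (b - a)) =
      (Gamma (b - a) * Gamma (1 - (b - a)) * sin (of_real pi * (b - a))) *
      (Gamma c * Gamma (c - a - b) * rGamma (c - a) * rGamma (c - b) * rGamma b * rGamma (1 - b))"
    unfolding conn_coeff_def g1 by (simp only: mult_ac)
  also have "\<dots> = hyp_series a b c 1 * sin (of_real pi * b)"
    unfolding r r2 g by (simp only: mult_ac)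
  finally show ?thesis .
qed

lemma exp_ii_pi: "exp (\<i> * of_real pi) = -1" "exp (- (\<i> * of_real pi)) = -1"
  by (simp_all add: exp_minus)

text \<open>
  At \<open>y = pi\<close> and \<open>y = - pi\<close> the point \<open>u = 1\<close> is reached from both sides of the cut. Gauss's theorem then
  gives two linear equations for the coefficients, which determine them unless one of the sums vanishes.
\<close>

lemma hyp_line_connection_generic:
  assumes ab: "a - b \<notin> \<int>" and c: "c \<notin> \<int>\<^sub>\<le>\<^sub>0" and Re: "Re (c - a - b) \<ge> 5" "Re (c - a) > 0" "Re (c - b) > 0"
    and nd: "1 - a \<notin> \<int>\<^sub>\<le>\<^sub>0" "1 - b \<notin> \<int>\<^sub>\<le>\<^sub>0" and y: "\<bar>y\<bar> \<le> pi"
  shows "hyp_series a b c (- exp (\<i> * of_real y)) =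
     conn_coeff a b c * hyp_sol_inf a b c (\<i> * of_real y) + conn_coeff b a c * hyp_sol_inf b a c (\<i> * of_real y)"
proof -
  obtain P Q where PQ: "\<And>y. \<bar>y\<bar> \<le> pi \<Longrightarrow> hyp_series a b c (- exp (\<i> * of_real y)) =
     P * hyp_sol_inf a b c (\<i> * of_real y) + Q * hyp_sol_inf b a c (\<i> * of_real y)"
    using hyp_line_relation[OF ab c Re(1)] by blast
  let ?g = "hyp_series a b c 1"
  let ?g1 = "hyp_series a (a - c + 1) (a - b + 1) 1" and ?g2 = "hyp_series b (b - c + 1) (b - a + 1) 1"
  define \<alpha> where "\<alpha> = exp (\<i> * of_real pi * a)" define \<beta> where "\<beta> = exp (\<i> * of_real pi * b)"
  have nz: "\<alpha> \<noteq> 0" "\<beta> \<noteq> 0" unfolding \<alpha>_def \<beta>_def by auto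
  have inv: "exp (- (\<i> * of_real pi * a)) = 1 / \<alpha>" "exp (- (\<i> * of_real pi * b)) = 1 / \<beta>"
    unfolding \<alpha>_def \<beta>_def by (simp_all add: exp_minus field_simps)
  \<comment> \<open>Both equations hold at \<open>u = 1\<close>; they differ only in the branch
    factor \<open>exp (- a * \<zeta>)\<close>, which is \<open>1 / \<alpha>\<close> at one endpoint
    and \<open>\<alpha>\<close> at the other, and likewise with \<open>b\<close> and
    \<beta>.\<close>
  have 1: "?g = P * (?g1 / \<alpha>) + Q * (?g2 / \<beta>)"
    using PQ[of pi] inv by (simp add: hyp_sol_inf_def exp_ii_pi mult_ac)
  have 2: "?g = P * (?g1 * \<alpha>) + Q * (?g2 * \<beta>)"
    using PQ[of "- pi"] unfolding \<alpha>_def \<beta>_def by (simp add: hyp_sol_inf_def exp_ii_pi mult_ac)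
  have sin: "sin (of_real pi * (b - a)) = (\<beta> / \<alpha> - \<alpha> / \<beta>) / (2 * \<i>)" "sin (of_real pi * (a - b)) = (\<alpha> / \<beta> - \<beta> / \<alpha>) / (2 * \<i>)"
      "sin (of_real pi * a) = (\<alpha> - 1 / \<alpha>) / (2 * \<i>)" "sin (of_real pi * b) = (\<beta> - 1 / \<beta>) / (2 * \<i>)"
    unfolding sin_exp_eq \<alpha>_def \<beta>_def by (simp_all add: algebra_simps exp_diff exp_minus divide_simps)
  have ba: "b - a \<notin> \<int>" using ab by (metis Ints_minus minus_diff_eq)
  have Re': "Re (c - b - a) \<ge> 5" using Re by simp
  have comm: "hyp_series b a c 1 = ?g" by (rule hyp_series_commute)
  note s1 = sin_pi_times_nonzero[OF ba] sin_pi_times_nonzero[OF ab]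
  have gamma: "Gamma z \<noteq> 0" "rGamma z \<noteq> 0" if "Re z > 0" for z
    using that by (auto simp: Gamma_eq_zero_iff rGamma_eq_zero_iff elim!: nonpos_Ints_cases)
  note d = add_1_not_nonpos_Ints[OF ab] add_1_not_nonpos_Ints[OF ba]
  \<comment> \<open>Gauss's theorem gives \<open>?g1\<close> the factor
    \<open>rGamma (1 - b)\<close> and \<open>?g2\<close> the factor \<open>rGamma (1 - a)\<close>;
    the hypotheses on these and on the real parts keep every factor nonzero.\<close>
  have "?g1 = Gamma (a - b + 1) * Gamma (a - b + 1 - a - (a - c + 1)) * rGamma (a - b + 1 - a) * rGamma (a - b + 1 - (a - c + 1))"
    by (rule Gauss_hyp_series_1[OF d(1)]) (use Re in simp)
  moreover have "?g2 = Gamma (b - a + 1) * Gamma (b - a + 1 - b - (b - c + 1)) * rGamma (b - a + 1 - b) * rGamma (b - a + 1 - (b - c + 1))"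
    by (rule Gauss_hyp_series_1[OF d(2)]) (use Re in simp)
  ultimately have gnz: "?g1 \<noteq> 0" "?g2 \<noteq> 0"
    using Re nd d gamma[of "c - a - b"] gamma[of "c - a"] gamma[of "c - b"]
    by (auto simp: Gamma_eq_zero_iff rGamma_eq_zero_iff algebra_simps)
  have "P * ?g1 * sin (of_real pi * (b - a)) = ?g * sin (of_real pi * b)"
  proof -
    have "?g * (\<beta> - 1 / \<beta>) = P * ?g1 * (\<beta> / \<alpha> - \<alpha> / \<beta>)"
    proof -
      \<comment> \<open>\<beta> times the first equation minus the second divided by \<beta>: the
        terms with \<open>Q\<close> cancel.\<close>
      have "?g * (\<beta> - 1 / \<beta>) = ?g * \<beta> - ?g / \<beta>" by (simp add: right_diff_distrib)
      also have "\<dots> = (P * (?g1 / \<alpha>) + Q * (?g2 / \<beta>)) * \<beta> - (P * (?g1 * \<alpha>) + Q * (?g2 * \<beta>)) / \<beta>"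
        using 1 2 by simp
      also have "\<dots> = P * ?g1 * (\<beta> / \<alpha> - \<alpha> / \<beta>)" using nz by (simp add: field_simps)
      finally show ?thesis .
    qed
    thus ?thesis unfolding sin by (simp only: times_divide_eq_right)
  qed
  hence "(P - conn_coeff a b c) * (?g1 * sin (of_real pi * (b - a))) = 0"
    using Gauss_conn_coeff[OF ab c Re(1)] by (simp add: algebra_simps)
  hence P: "P = conn_coeff a b c" using s1 gnz by simp
  have "Q * ?g2 * sin (of_real pi * (a - b)) = ?g * sin (of_real pi * a)"
  proof -
    have "?g * (\<alpha> - 1 / \<alpha>) = Q * ?g2 * (\<alpha> / \<beta> - \<beta> / \<alpha>)"
    proof -
      have "?g * (\<alpha> - 1 / \<alpha>) = ?g * \<alpha> - ?g / \<alpha>" by (simp add: right_diff_distrib)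
      also have "\<dots> = (P * (?g1 / \<alpha>) + Q * (?g2 / \<beta>)) * \<alpha> - (P * (?g1 * \<alpha>) + Q * (?g2 * \<beta>)) / \<alpha>"
        using 1 2 by simp
      also have "\<dots> = Q * ?g2 * (\<alpha> / \<beta> - \<beta> / \<alpha>)" using nz by (simp add: field_simps)
      finally show ?thesis .
    qed
    thus ?thesis unfolding sin by (simp only: times_divide_eq_right)
  qed
  hence "(Q - conn_coeff b a c) * (?g2 * sin (of_real pi * (a - b))) = 0"
    using Gauss_conn_coeff[OF ba c Re'] unfolding comm by (simp add: algebra_simps)
  hence Q: "Q = conn_coeff b a c" using s1 gnz by simp
  show ?thesis using PQ[OF y] unfolding P Q .
qed

section \<open>The connection formula at infinity\<close>

text \<open>Integers are isolated, so an exceptional integer value of \<open>b\<close> is a limit of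
  generic ones.\<close>

lemma eventually_at_not_Ints:
  assumes "(b::complex) \<in> \<int>"
  shows "eventually (\<lambda>z. z \<notin> \<int>) (at b)"
  unfolding eventually_at
proof (intro exI[of _ 1] conjI ballI impI)
  fix z assume z: "z \<noteq> b \<and> dist z b < 1"
  show "z \<notin> \<int>"
  proof
    assume "z \<in> \<int>"
    hence "z - b \<in> \<int>" using assms by simp
    then obtain n where n: "z - b = of_int n" by (auto elim: Ints_cases)
    have "norm (z - b) < 1" using z by (simp add: dist_norm)
    hence "n = 0" unfolding n by simp
    thus False using n z by simp
  qed
qed auto

lemma tendsto_rGamma:
  assumes "(f \<longlongrightarrow> (z :: complex)) F"
  shows "((\<lambda>x. rGamma (f x)) \<longlongrightarrow> rGamma z) F"
  by (rule isCont_tendsto_compose[OF _ assms]) (intro continuous_intros)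

text \<open>
  If \<open>b\<close> is a positive integer, the solution with exponent \<open>a\<close> vanishes at \<open>u = 1\<close> and its coefficient
  is not determined by the values there; the formula then follows by continuity in \<open>b\<close>.
\<close>

lemma hyp_line_connection_half:
  assumes ab: "a - b \<notin> \<int>" and c: "c \<notin> \<int>\<^sub>\<le>\<^sub>0" and Re: "Re (c - a - b) > 5" "Re (c - a) > 0" "Re (c - b) > 0"
    and nd: "1 - a \<notin> \<int>\<^sub>\<le>\<^sub>0" and y: "\<bar>y\<bar> \<le> pi"
  shows "hyp_series a b c (- exp (\<i> * of_real y)) =
     conn_coeff a b c * hyp_sol_inf a b c (\<i> * of_real y) + conn_coeff b a c * hyp_sol_inf b a c (\<i> * of_real y)"
proof (cases "b \<in> \<int>")
  case False
  hence "1 - b \<notin> \<int>" by (metis Ints_1 Ints_diff add_diff_cancel_left' diff_add_cancel)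
  thus ?thesis using assms by (intro hyp_line_connection_generic) auto
next
  case True
  let ?\<zeta> = "\<i> * of_real y"
  have ba: "b - a \<notin> \<int>" using ab by (metis Ints_minus minus_diff_eq)
  have open_Ints: "open (- \<int> :: complex set)" by (simp add: closed_Ints open_Compl)
  have "eventually (\<lambda>z. a - z \<in> - \<int>) (at b)"
    by (rule topological_tendstoD[OF _ open_Ints]) (use ab in \<open>auto intro!: tendsto_eq_intros\<close>)
  moreover have "eventually (\<lambda>z. Re (c - a - z) > 5) (at b)" 
    by (rule order_tendstoD(1)[of _ "Re (c - a - b)"]) (use Re in \<open>auto intro!: tendsto_eq_intros\<close>)
  moreover have "eventually (\<lambda>z. Re (c - z) > 0) (at b)" 
    by (rule order_tendstoD(1)[of _ "Re (c - b)"]) (use Re in \<open>auto intro!: tendsto_eq_intros\<close>)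
  ultimately have ev: "eventually (\<lambda>z. hyp_series a z c (- exp ?\<zeta>) = conn_coeff a z c * hyp_sol_inf a z c ?\<zeta> +
     conn_coeff z a c * hyp_sol_inf z a c ?\<zeta>) (at b)"
    using eventually_at_not_Ints[OF True]
  proof eventually_elim
    case (elim z)
    hence "1 - z \<notin> \<int>" by (metis Ints_1 Ints_diff add_diff_cancel_left' diff_add_cancel)
    thus ?case using elim c Re nd y by (intro hyp_line_connection_generic) auto
  qed
  have u: "norm (- exp ?\<zeta>) \<le> 1" "norm (- exp (- ?\<zeta>)) \<le> 1" by auto
  have "((\<lambda>z. hyp_series a z c (- exp ?\<zeta>)) \<longlongrightarrow> hyp_series a b c (- exp ?\<zeta>)) (at b)"
    by (rule hyp_series_tendsto[OF _ _ _ c]) (use u Re in \<open>auto intro!: tendsto_intros\<close>)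
  moreover have "((\<lambda>z. conn_coeff a z c * hyp_sol_inf a z c ?\<zeta> + conn_coeff z a c * hyp_sol_inf z a c ?\<zeta>)
     \<longlongrightarrow> conn_coeff a b c * hyp_sol_inf a b c ?\<zeta> + conn_coeff b a c * hyp_sol_inf b a c ?\<zeta>) (at b)"
  proof -
    have nonpos: "b - a \<notin> \<int>\<^sub>\<le>\<^sub>0" "a - b \<notin> \<int>\<^sub>\<le>\<^sub>0" "c \<notin> \<int>\<^sub>\<le>\<^sub>0" using ab ba c nonpos_Ints_Int by blast+
    have sum1: "Re (a - b + 1 - a - (a - c + 1)) > 5" and sum2: "Re (b - a + 1 - b - (b - c + 1)) > 5"
      using Re by auto
    have 1: "((\<lambda>z. hyp_series a (a - c + 1) (a - z + 1) (- exp (- ?\<zeta>))) \<longlongrightarrow>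
        hyp_series a (a - c + 1) (a - b + 1) (- exp (- ?\<zeta>))) (at b)"
      by (rule hyp_series_tendsto[OF tendsto_const tendsto_const _ add_1_not_nonpos_Ints[OF ab] sum1 trivial_limit_at u(2)])
         (intro tendsto_intros)
    have 2: "((\<lambda>z. hyp_series z (z - c + 1) (z - a + 1) (- exp (- ?\<zeta>))) \<longlongrightarrow>
        hyp_series b (b - c + 1) (b - a + 1) (- exp (- ?\<zeta>))) (at b)"
      by (rule hyp_series_tendsto[OF _ _ _ add_1_not_nonpos_Ints[OF ba] sum2 trivial_limit_at u(2)])
         (intro tendsto_intros)+
    have 3: "((\<lambda>z. conn_coeff a z c) \<longlongrightarrow> conn_coeff a b c) (at b)"
       "((\<lambda>z. conn_coeff z a c) \<longlongrightarrow> conn_coeff b a c) (at b)"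
      unfolding conn_coeff_def
      by (intro tendsto_mult tendsto_Gamma tendsto_rGamma tendsto_diff tendsto_const tendsto_ident_at nonpos)+
    show ?thesis unfolding hyp_sol_inf_def
      by (intro tendsto_add tendsto_mult 1 2 3 tendsto_exp tendsto_minus tendsto_const tendsto_ident_at)
  qed
  ultimately show ?thesis
    using tendsto_unique[OF trivial_limit_at] tendsto_cong[OF ev] by blast
qed

text \<open>At most one of \<open>a\<close>, \<open>b\<close> can be exceptional, because both being
  integers would make \<open>a - b\<close> an integer. The formula is symmetric, so the exceptional
  one may be called \<open>b\<close>.\<close>

lemma hyp_line_connection:
  assumes ab: "a - b \<notin> \<int>" and c: "c \<notin> \<int>\<^sub>\<le>\<^sub>0" and Re: "Re (c - a - b) > 5" "Re (c - a) > 0" "Re (c - b) > 0"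
    and y: "\<bar>y\<bar> \<le> pi"
  shows "hyp_series a b c (- exp (\<i> * of_real y)) =
     conn_coeff a b c * hyp_sol_inf a b c (\<i> * of_real y) + conn_coeff b a c * hyp_sol_inf b a c (\<i> * of_real y)"
proof (cases "1 - a \<in> \<int>\<^sub>\<le>\<^sub>0")
  case False
  thus ?thesis using assms by (intro hyp_line_connection_half)
next
  case True
  have "1 - b \<notin> \<int>\<^sub>\<le>\<^sub>0"
  proof
    assume "1 - b \<in> \<int>\<^sub>\<le>\<^sub>0"
    hence "(1 - b) - (1 - a) \<in> \<int>" using True by (meson Ints_diff nonpos_Ints_Int)
    thus False using ab by simp
  qed
  moreover have "b - a \<notin> \<int>" using ab by (metis Ints_minus minus_diff_eq)
  ultimately have "hyp_series b a c (- exp (\<i> * of_real y)) =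
     conn_coeff b a c * hyp_sol_inf b a c (\<i> * of_real y) + conn_coeff a b c * hyp_sol_inf a b c (\<i> * of_real y)"
    using assms by (intro hyp_line_connection_half) auto
  thus ?thesis by (simp add: hyp_series_commute[of a b] add.commute)
qed

section \<open>Convergence and contiguous relations in the unit disc\<close>

lemma hyp_ratio_tendsto:
  "(\<lambda>n. (a + of_nat n) * (b + of_nat n) / ((c + of_nat n) * of_nat (Suc n)) :: complex) \<longlonglongrightarrow> 1"
proof -
  have *: "(\<lambda>n. (a + of_nat n) / (c + of_nat n) :: complex) \<longlonglongrightarrow> 1" for a c :: complex
  proof -
    have inf: "filterlim (\<lambda>n. c + of_nat n :: complex) at_infinity sequentially"
      by (rule tendsto_add_filterlim_at_infinity[OF tendsto_const tendsto_of_nat])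
    have "(\<lambda>n. 1 + (a - c) / (c + of_nat n)) \<longlonglongrightarrow> 1 + 0"
      by (intro tendsto_intros tendsto_divide_0[OF tendsto_const inf])
    moreover have "eventually (\<lambda>n. c + of_nat n \<noteq> 0) sequentially"
      using filterlim_at_infinity_imp_eventually_ne[OF inf, of 0] by simp
    hence "eventually (\<lambda>n. 1 + (a - c) / (c + of_nat n) = (a + of_nat n) / (c + of_nat n)) sequentially"
      by eventually_elim (simp add: field_simps)
    ultimately show ?thesis using tendsto_cong by fastforce
  qed
  from tendsto_mult[OF *[of a c] *[of b 1]] show ?thesis by (simp add: algebra_simps)
qed

lemma summable_hyp_series:
  assumes "norm u < 1"
  shows "summable (\<lambda>n. hyp_coeff a b c n * u ^ n)"
proof (cases "u = 0")
  case False
  \<comment> \<open>The midpoint of 1 and \<open>1 / norm u\<close>: above the limit of the ratios,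
    and still small enough for the ratio test.\<close>
  define r where "r = (1 / norm u + 1) / 2"
  have r: "r > 1" "r * norm u < 1" using assms False unfolding r_def by (auto simp: field_simps)
  have "eventually (\<lambda>n. norm ((a + of_nat n) * (b + of_nat n) / ((c + of_nat n) * of_nat (Suc n)) :: complex) < r) sequentially"
    by (rule order_tendstoD[OF tendsto_norm[OF hyp_ratio_tendsto]]) (use r in simp)
  then obtain N where N: "\<And>n. n \<ge> N \<Longrightarrow> norm ((a + of_nat n) * (b + of_nat n) / ((c + of_nat n) * of_nat (Suc n)) :: complex) < r"
    unfolding eventually_sequentially by blast
  show ?thesis
  proof (rule summable_ratio_test[OF r(2)])
    fix n assume n: "n \<ge> N"
    have "norm (hyp_coeff a b c (Suc n) * u ^ Suc n) =
        norm (hyp_coeff a b c n * u ^ n) * norm u * norm ((a + of_nat n) * (b + of_nat n) / ((c + of_nat n) * of_nat (Suc n)))"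
      unfolding hyp_coeff_Suc by (simp only: norm_mult power_Suc mult_ac)
    also have "\<dots> \<le> norm (hyp_coeff a b c n * u ^ n) * norm u * r"
      using N[OF n] by (intro mult_left_mono) auto
    finally show "norm (hyp_coeff a b c (Suc n) * u ^ Suc n) \<le> r * norm u * norm (hyp_coeff a b c n * u ^ n)"
      by (simp only: mult_ac)
  qed
qed (simp add: sums_summable[OF powser_sums_zero])

lemma hyp_series_sums:
  "norm u < 1 \<Longrightarrow> (\<lambda>n. hyp_coeff a b c n * u ^ n) sums hyp_series a b c u"
  unfolding hyp_series_def by (intro summable_sums summable_hyp_series)

definition hyp_series' :: "complex \<Rightarrow> complex \<Rightarrow> complex \<Rightarrow> complex \<Rightarrow> complex"
  where "hyp_series' a b c u = (\<Sum>n. diffs (hyp_coeff a b c) n * u ^ n)"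

lemma hyp_series_has_field_derivative:
  "norm u < 1 \<Longrightarrow> (hyp_series a b c has_field_derivative hyp_series' a b c u) (at u)"
  unfolding hyp_series_def[abs_def] hyp_series'_def
  by (rule termdiffs_strong'[of 1]) (auto intro: summable_hyp_series)

lemma hyp_series_holomorphic: "hyp_series a b c holomorphic_on ball 0 1"
  unfolding holomorphic_on_open[OF open_ball]
proof
  fix u :: complex assume "u \<in> ball 0 1"
  hence "norm u < 1" by simp
  thus "\<exists>f'. (hyp_series a b c has_field_derivative f') (at u)"
    using hyp_series_has_field_derivative by blast
qed

lemma hyp_series'_sums:
  assumes "norm u < 1"
  shows "(\<lambda>n. of_nat n * (hyp_coeff a b c n * u ^ n)) sums (u * hyp_series' a b c u)"
proof -
  have "summable (\<lambda>n. diffs (hyp_coeff a b c) n * u ^ n)"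
    using termdiff_converges[OF assms] summable_hyp_series by blast
  from sums_mult[OF diffs_equiv[OF this], of u]
  have "(\<lambda>n. u * (of_nat n * hyp_coeff a b c n * u ^ (n - Suc 0))) sums (u * hyp_series' a b c u)"
    unfolding hyp_series'_def .
  moreover have "(\<lambda>n. u * (of_nat n * hyp_coeff a b c n * u ^ (n - Suc 0))) = (\<lambda>n. of_nat n * (hyp_coeff a b c n * u ^ n))"
  proof
    fix n show "u * (of_nat n * hyp_coeff a b c n * u ^ (n - Suc 0)) = of_nat n * (hyp_coeff a b c n * u ^ n)"
      by (cases n) auto
  qed
  ultimately show ?thesis by simp
qed

lemma hyp_series_lower_c:
  assumes c: "c \<notin> \<int>\<^sub>\<le>\<^sub>0" and u: "norm u < 1"
  shows "u * hyp_series' a b (c + 1) u + c * hyp_series a b (c + 1) u = c * hyp_series a b c u"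
proof -
  have rel: "of_nat n * hyp_coeff a b (c + 1) n + c * hyp_coeff a b (c + 1) n = c * hyp_coeff a b c n" for n
    using hyp_coeff_lower_c[OF c, of n a b] by (simp add: algebra_simps)
  have "(\<lambda>n. of_nat n * (hyp_coeff a b (c + 1) n * u ^ n) + c * (hyp_coeff a b (c + 1) n * u ^ n)) sums
     (u * hyp_series' a b (c + 1) u + c * hyp_series a b (c + 1) u)"
    by (intro sums_add sums_mult hyp_series'_sums hyp_series_sums u)
  moreover have "(\<lambda>n. of_nat n * (hyp_coeff a b (c + 1) n * u ^ n) + c * (hyp_coeff a b (c + 1) n * u ^ n)) =
      (\<lambda>n. c * (hyp_coeff a b c n * u ^ n))"
  proof
    fix n
    have "of_nat n * (hyp_coeff a b (c + 1) n * u ^ n) + c * (hyp_coeff a b (c + 1) n * u ^ n) =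
       (of_nat n * hyp_coeff a b (c + 1) n + c * hyp_coeff a b (c + 1) n) * u ^ n"
      by (simp add: algebra_simps)
    thus "of_nat n * (hyp_coeff a b (c + 1) n * u ^ n) + c * (hyp_coeff a b (c + 1) n * u ^ n) = c * (hyp_coeff a b c n * u ^ n)"
      unfolding rel by (simp only: mult_ac)
  qed
  moreover have "(\<lambda>n. c * (hyp_coeff a b c n * u ^ n)) sums (c * hyp_series a b c u)"
    by (intro sums_mult hyp_series_sums u)
  ultimately show ?thesis using sums_unique2 by metis
qed

text \<open>The counterpart for the terms at infinity: there \<open>c\<close> occurs in the second
  parameter \<open>a - c + 1\<close>, so lowering \<open>c\<close> raises that parameter.\<close>

lemma hyp_series_raise_b:
  assumes u: "norm u < 1"
  shows "u * hyp_series' a b c u + b * hyp_series a b c u = b * hyp_series a (b + 1) c u"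
proof -
  have rel: "of_nat n * hyp_coeff a b c n + b * hyp_coeff a b c n = b * hyp_coeff a (b + 1) c n" for n
  proof -
    have "pochhammer b n * (b + of_nat n) = b * pochhammer (b + 1) n"
      by (metis pochhammer_Suc pochhammer_rec)
    hence "(pochhammer b n * (b + of_nat n)) * (pochhammer a n / (pochhammer c n * fact n)) =
       (b * pochhammer (b + 1) n) * (pochhammer a n / (pochhammer c n * fact n))" by (simp only:)
    thus ?thesis by (simp add: hyp_coeff_def add_divide_distrib algebra_simps)
  qed
  have "(\<lambda>n. of_nat n * (hyp_coeff a b c n * u ^ n) + b * (hyp_coeff a b c n * u ^ n)) sums
     (u * hyp_series' a b c u + b * hyp_series a b c u)"
    by (intro sums_add sums_mult hyp_series'_sums hyp_series_sums u)
  moreover have "(\<lambda>n. of_nat n * (hyp_coeff a b c n * u ^ n) + b * (hyp_coeff a b c n * u ^ n)) =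
      (\<lambda>n. b * (hyp_coeff a (b + 1) c n * u ^ n))"
  proof
    fix n
    have "of_nat n * (hyp_coeff a b c n * u ^ n) + b * (hyp_coeff a b c n * u ^ n) =
       (of_nat n * hyp_coeff a b c n + b * hyp_coeff a b c n) * u ^ n"
      by (simp add: algebra_simps)
    thus "of_nat n * (hyp_coeff a b c n * u ^ n) + b * (hyp_coeff a b c n * u ^ n) = b * (hyp_coeff a (b + 1) c n * u ^ n)"
      unfolding rel by (simp only: mult_ac)
  qed
  moreover have "(\<lambda>n. b * (hyp_coeff a (b + 1) c n * u ^ n)) sums (b * hyp_series a (b + 1) c u)"
    by (intro sums_mult hyp_series_sums u)
  ultimately show ?thesis using sums_unique2 by metis
qed

section \<open>Continuation to the slit plane together with the formula at infinity\<close>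

definition hyp_term_inf :: "complex \<Rightarrow> complex \<Rightarrow> complex \<Rightarrow> complex \<Rightarrow> complex"
  where "hyp_term_inf a b c u = (- u) powr (- a) * hyp_series a (a - c + 1) (a - b + 1) (1 / u)"

text \<open>The formula at infinity is part of the predicate so that it descends in \<open>c\<close>
  together with the continuation. The two formulas are required on open sets only, where they can be
  differentiated; on the unit circle holomorphy suffices.\<close>

definition hyp_continuation :: "complex \<Rightarrow> complex \<Rightarrow> complex \<Rightarrow> (complex \<Rightarrow> complex) \<Rightarrow> bool"
  where "hyp_continuation a b c f \<longleftrightarrow>
    f holomorphic_on - (complex_of_real ` {1..}) \<and>
    (\<forall>u. norm u < 1 \<longrightarrow> f u = hyp_series a b c u) \<and>
    (\<forall>u. norm u > 1 \<and> u \<notin> complex_of_real ` {1..} \<longrightarrow>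
       f u = conn_coeff a b c * hyp_term_inf a b c u + conn_coeff b a c * hyp_term_inf b a c u)"

lemma closed_of_real_atLeast: "closed (complex_of_real ` {x..})"
proof -
  have "complex_of_real ` {x..} = {z. Im z = 0} \<inter> {z. Re z \<ge> x}"
    by (auto simp: image_iff complex_eq_iff intro!: bexI[of _ "Re _"])
  moreover have "closed \<dots>"
    by (intro closed_Int closed_halfspace_Re_ge closed_hyperplane[of "\<i>" 0, simplified]) 
  ultimately show ?thesis by simp
qed

lemma of_real_image_iff: "u \<in> complex_of_real ` {x..} \<longleftrightarrow> Im u = 0 \<and> Re u \<ge> x"
  by (auto simp: image_iff complex_eq_iff intro!: bexI[of _ "Re u"])

lemma hyp_term_inf_eq_sol:
  assumes "u \<noteq> 0"
  shows "hyp_term_inf a b c u = hyp_sol_inf a b c (Ln (- u))"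
  using assms by (simp add: hyp_term_inf_def hyp_sol_inf_def powr_def exp_minus field_simps)

text \<open>Both pieces are holomorphic on their open sides and continuous up to
  \<open>Re \<zeta> = 0\<close>, where they agree by the formula on the line; a continuous function
  of this kind is holomorphic across the line.\<close>

lemma hyp_strip_holomorphic:
  assumes ab: "a - b \<notin> \<int>" and c: "c \<notin> \<int>\<^sub>\<le>\<^sub>0" and Re: "Re (c - a - b) > 5" "Re (c - a) > 0" "Re (c - b) > 0"
  defines "S \<equiv> {\<zeta>. Im \<zeta> < pi} \<inter> {\<zeta>. Im \<zeta> > - pi}"
  shows "(\<lambda>\<zeta>. if Re \<zeta> \<le> 0 then hyp_series a b c (- exp \<zeta>)
            else conn_coeff a b c * hyp_sol_inf a b c \<zeta> + conn_coeff b a c * hyp_sol_inf b a c \<zeta>) holomorphic_on S"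
    (is "?f holomorphic_on S")
proof (rule holomorphic_on_paste_across_line[of S 1 ?f 0])
  let ?F = "exp_series (hyp_coeff a b c)"
  let ?G = "\<lambda>\<zeta>. conn_coeff a b c * hyp_sol_inf a b c \<zeta> + conn_coeff b a c * hyp_sol_inf b a c \<zeta>"
  have inner_1: "1 \<bullet> \<zeta> = Re \<zeta>" for \<zeta> :: complex by (simp add: inner_complex_def)
  have S: "open S" unfolding S_def by (intro open_Int open_halfspace_Im_lt open_halfspace_Im_gt)
  thus "open S" .
  let ?L = "S \<inter> {\<zeta>. Re \<zeta> \<le> 0}" and ?R = "S \<inter> {\<zeta>. Re \<zeta> \<ge> 0}"
  have dF: "(?F has_field_derivative exp_series (\<lambda>n. of_nat n * hyp_coeff a b c n) \<zeta>) (at \<zeta> within ?L)" if "\<zeta> \<in> ?L" for \<zeta>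
    by (rule exp_series_has_field_derivative[OF summable_n_hyp_coeff]) (use Re that in auto)
  have ba: "b - a \<notin> \<int>" using ab by (metis Ints_minus minus_diff_eq)
  have oR: "hyp_ode a b c ?R (hyp_sol_inf a b c) (hyp_sol_inf' a b c)"
    by (rule hyp_ode_at_inf[OF ab]) (use Re in \<open>auto simp: S_def\<close>)
  have oR': "hyp_ode b a c ?R (hyp_sol_inf b a c) (hyp_sol_inf' b a c)"
    by (rule hyp_ode_at_inf[OF ba]) (use Re in \<open>auto simp: S_def\<close>)
  have dG: "(?G has_field_derivative conn_coeff a b c * hyp_sol_inf' a b c \<zeta> + conn_coeff b a c * hyp_sol_inf' b a c \<zeta>) (at \<zeta> within ?R)"
    if "\<zeta> \<in> ?R" for \<zeta>
    using oR oR' that unfolding hyp_ode_def by (intro DERIV_add DERIV_cmult) blast+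
  have "?F holomorphic_on (S \<inter> {\<zeta>. Re \<zeta> < 0})"
    unfolding holomorphic_on_def field_differentiable_def
  proof
    fix \<zeta> assume \<zeta>: "\<zeta> \<in> S \<inter> {\<zeta>. Re \<zeta> < 0}"
    hence "(?F has_field_derivative exp_series (\<lambda>n. of_nat n * hyp_coeff a b c n) \<zeta>) (at \<zeta> within S \<inter> {\<zeta>. Re \<zeta> < 0})"
      by (intro has_field_derivative_subset[OF dF]) auto
    thus "\<exists>f'. (?F has_field_derivative f') (at \<zeta> within S \<inter> {\<zeta>. Re \<zeta> < 0})" by blast
  qed
  thus "?f holomorphic_on S \<inter> {\<zeta>. 1 \<bullet> \<zeta> < 0}"
    unfolding inner_1 by (rule holomorphic_transform) (auto simp: hyp_series_eq_exp_series)
  have "?G holomorphic_on (S \<inter> {\<zeta>. Re \<zeta> > 0})"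
    unfolding holomorphic_on_def field_differentiable_def
  proof
    fix \<zeta> assume \<zeta>: "\<zeta> \<in> S \<inter> {\<zeta>. Re \<zeta> > 0}"
    hence "(?G has_field_derivative conn_coeff a b c * hyp_sol_inf' a b c \<zeta> + conn_coeff b a c * hyp_sol_inf' b a c \<zeta>) (at \<zeta> within S \<inter> {\<zeta>. Re \<zeta> > 0})"
      by (intro has_field_derivative_subset[OF dG]) auto
    thus "\<exists>f'. (?G has_field_derivative f') (at \<zeta> within S \<inter> {\<zeta>. Re \<zeta> > 0})" by blast
  qed
  thus "?f holomorphic_on S \<inter> {\<zeta>. 0 < 1 \<bullet> \<zeta>}"
    unfolding inner_1
    by (rule holomorphic_transform) auto
  have "continuous_on (?L \<union> ?R) (\<lambda>\<zeta>. if Re \<zeta> \<le> 0 then ?F \<zeta> else ?G \<zeta>)"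
  proof (rule continuous_on_cases_local)
    have LR: "?L \<union> ?R = S" by auto
    show "closedin (top_of_set (?L \<union> ?R)) ?L" "closedin (top_of_set (?L \<union> ?R)) ?R"
      unfolding LR by (intro closedin_closed_Int closed_halfspace_Re_le closed_halfspace_Re_ge)+
    show "continuous_on ?L ?F" by (rule DERIV_continuous_on[OF dF])
    show "continuous_on ?R ?G" by (rule DERIV_continuous_on[OF dG])
    fix \<zeta> assume "\<zeta> \<in> ?L \<and> \<not> Re \<zeta> \<le> 0 \<or> \<zeta> \<in> ?R \<and> Re \<zeta> \<le> 0"
    hence "\<zeta> = \<i> * of_real (Im \<zeta>)" "\<bar>Im \<zeta>\<bar> \<le> pi" by (auto simp: S_def complex_eq_iff)
    thus "?F \<zeta> = ?G \<zeta>"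
      using hyp_line_connection[OF ab c Re, of "Im \<zeta>"] by (simp add: hyp_series_eq_exp_series)
  qed
  moreover have "?L \<union> ?R = S" by auto
  ultimately show "continuous_on S ?f" by (simp only: hyp_series_eq_exp_series)
qed auto

text \<open>The strip function at \<open>Ln (- u)\<close> is cut along all of
  \<open>[0, \<infinity>)\<close>. The disc series fills in the part \<open>[0, 1)\<close>; on the
  overlap \<open>Re (Ln (- u)) = ln (norm u)\<close> is nonpositive, so that the strip function is
  the same series.\<close>

lemma hyp_continuation_large_c:
  assumes ab: "a - b \<notin> \<int>" and c: "c \<notin> \<int>\<^sub>\<le>\<^sub>0" and Re: "Re (c - a - b) > 5" "Re (c - a) > 0" "Re (c - b) > 0"
  shows "\<exists>f. hyp_continuation a b c f"
proof -
  let ?A = "ball 0 1 :: complex set" and ?B = "- (complex_of_real ` {0..})"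
  define g where "g = (\<lambda>\<zeta>. if Re \<zeta> \<le> 0 then hyp_series a b c (- exp \<zeta>)
            else conn_coeff a b c * hyp_sol_inf a b c \<zeta> + conn_coeff b a c * hyp_sol_inf b a c \<zeta>)"
  define f where "f u = (if u \<in> ?A then hyp_series a b c u else g (Ln (- u)))" for u
  have B: "- u \<notin> \<real>\<^sub>\<le>\<^sub>0" "u \<noteq> 0" if "u \<in> ?B" for u
    using that by (auto simp: of_real_image_iff complex_nonpos_Reals_iff)
  have Ln: "Re (Ln (- u)) = ln (norm u)" if "u \<noteq> 0" for u :: complex using that by simp
  have hol_Ln: "(\<lambda>u. Ln (- u)) holomorphic_on ?B"
    using B by (intro holomorphic_intros) auto
  have im: "(\<lambda>u. Ln (- u)) ` ?B \<subseteq> {\<zeta>. Im \<zeta> < pi} \<inter> {\<zeta>. Im \<zeta> > - pi}"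
  proof
    fix \<zeta> assume "\<zeta> \<in> (\<lambda>u. Ln (- u)) ` ?B"
    then obtain u where u: "u \<in> ?B" "\<zeta> = Ln (- u)" by blast
    have "Im (Ln (- u)) \<noteq> pi"
    proof
      assume "Im (Ln (- u)) = pi"
      hence "Re (- u) < 0 \<and> Im (- u) = 0" using B[OF u(1)] by (subst (asm) Im_Ln_eq_pi) auto
      thus False using B(1)[OF u(1)] by (auto simp: complex_nonpos_Reals_iff)
    qed
    thus "\<zeta> \<in> {\<zeta>. Im \<zeta> < pi} \<inter> {\<zeta>. Im \<zeta> > - pi}"
      using mpi_less_Im_Ln[of "- u"] Im_Ln_le_pi[of "- u"] B(2)[OF u(1)] u(2) by auto
  qed
  have "(g \<circ> (\<lambda>u. Ln (- u))) holomorphic_on ?B"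
    by (rule holomorphic_on_compose_gen[OF hol_Ln _ im])
       (unfold g_def, rule hyp_strip_holomorphic[OF ab c Re])
  hence "f holomorphic_on (?A \<union> ?B)"
    unfolding f_def[abs_def]
  proof (intro holomorphic_on_If_Un[OF hyp_series_holomorphic] open_ball)
    show "open ?B" by (intro open_Compl closed_of_real_atLeast)
    fix u assume u: "u \<in> ?A" "u \<in> ?B"
    hence "ln (norm u) \<le> 0" using B[OF u(2)] by (subst ln_le_zero_iff) auto
    thus "hyp_series a b c u = g (Ln (- u))"
      using B[OF u(2)] by (simp add: g_def)
  qed (simp add: o_def)
  moreover have "?A \<union> ?B = - (complex_of_real ` {1..})"
  proof -
    have "norm u < 1 \<longleftrightarrow> \<bar>Re u\<bar> < 1" if "Im u = 0" for u :: complex using that by (simp add: cmod_eq_Re)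
    thus ?thesis by (auto simp: of_real_image_iff)
  qed
  ultimately have "f holomorphic_on - (complex_of_real ` {1..})" by simp
  moreover have "f u = hyp_series a b c u" if "norm u < 1" for u using that by (simp add: f_def)
  moreover have "f u = conn_coeff a b c * hyp_term_inf a b c u + conn_coeff b a c * hyp_term_inf b a c u"
    if u: "norm u > 1" for u
  proof -
    have "u \<noteq> 0" "ln (norm u) > 0" using u by (auto intro: ln_gt_zero)
    thus ?thesis using u by (simp add: f_def g_def hyp_term_inf_eq_sol)
  qed
  ultimately show ?thesis unfolding hyp_continuation_def by blast
qed

text \<open>In the variable \<open>v = 1 / u\<close> the operator changes sign: on the factor behind
  the power, \<open>u d/du + c\<close> acts as the negative of \<open>v d/dv + (a - c)\<close>. Here
  \<open>a - c\<close> is the second parameter belonging to \<open>c + 1\<close>.\<close>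

lemma hyp_term_inf_lower_c:
  assumes u: "norm u > 1" "u \<notin> complex_of_real ` {1..}"
  shows "\<exists>T'. (hyp_term_inf a b (c + 1) has_field_derivative T') (at u) \<and>
     u * T' + c * hyp_term_inf a b (c + 1) u = (c - a) * hyp_term_inf a b c u"
proof -
  let ?e = "a - c" and ?d = "a - b + 1"
  have u0: "u \<noteq> 0" using u by auto
  have nr: "- u \<notin> \<real>\<^sub>\<le>\<^sub>0"
  proof
    assume "- u \<in> \<real>\<^sub>\<le>\<^sub>0"
    hence "Im u = 0" "Re u \<ge> 0" by (auto simp: complex_nonpos_Reals_iff)
    thus False using u by (auto simp: of_real_image_iff cmod_eq_Re)
  qed
  have v: "norm (1 / u) < 1" using u u0 by (simp add: norm_divide divide_less_eq)
  have d1: "((\<lambda>u. (- u) powr (- a)) has_field_derivative - a * (- u) powr (- a) / u) (at u)"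
    using nr u0 by (auto intro!: derivative_eq_intros simp: powr_diff field_simps)
  have d2: "((\<lambda>u. hyp_series a ?e ?d (1 / u)) has_field_derivative hyp_series' a ?e ?d (1 / u) * (- 1 / u\<^sup>2)) (at u)"
    by (rule DERIV_chain2[where f = "hyp_series a ?e ?d" and g = "\<lambda>u. 1 / u", OF hyp_series_has_field_derivative[OF v]])
       (use u0 in \<open>auto intro!: derivative_eq_intros simp: power2_eq_square field_simps\<close>)
  let ?T' = "- a * (- u) powr (- a) / u * hyp_series a ?e ?d (1 / u) + hyp_series' a ?e ?d (1 / u) * (- 1 / u\<^sup>2) * (- u) powr (- a)"
  have "hyp_term_inf a b (c + 1) = (\<lambda>u. (- u) powr (- a) * hyp_series a ?e ?d (1 / u))"
    by (simp add: hyp_term_inf_def[abs_def] algebra_simps)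
  hence "(hyp_term_inf a b (c + 1) has_field_derivative ?T') (at u)"
    using DERIV_mult[OF d1 d2] by simp
  moreover have "u * ?T' + c * hyp_term_inf a b (c + 1) u = (c - a) * hyp_term_inf a b c u"
  proof -
    have "u * ?T' + c * hyp_term_inf a b (c + 1) u =
      - ((- u) powr (- a)) * (1 / u * hyp_series' a ?e ?d (1 / u) + ?e * hyp_series a ?e ?d (1 / u))"
      using u0 by (simp add: hyp_term_inf_def field_simps power2_eq_square)
    also have "\<dots> = - ((- u) powr (- a)) * (?e * hyp_series a (?e + 1) ?d (1 / u))"
      unfolding hyp_series_raise_b[OF v] ..
    also have "\<dots> = (c - a) * hyp_term_inf a b c u" by (simp add: hyp_term_inf_def algebra_simps)
    finally show ?thesis .
  qed
  ultimately show ?thesis by blast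
qed

lemma conn_coeff_lower_c:
  assumes "c \<notin> \<int>\<^sub>\<le>\<^sub>0"
  shows "conn_coeff a b (c + 1) * (c - a) = c * conn_coeff a b c"
proof -
  have "(c - a) * rGamma (c + 1 - a) = rGamma (c - a)"
    using rGamma_plus1[of "c - a"] by (simp add: algebra_simps)
  moreover have "conn_coeff a b (c + 1) * (c - a) =
     Gamma (c + 1) * Gamma (b - a) * rGamma b * ((c - a) * rGamma (c + 1 - a))"
    by (simp only: conn_coeff_def mult_ac)
  ultimately show ?thesis using Gamma_plus1[OF assms] by (simp add: conn_coeff_def mult_ac)
qed

text \<open>The formulas for \<open>f1\<close> hold on open sets and therefore determine
  \<open>deriv f1\<close> there; the contiguous relations then apply to the disc series and to each
  term at infinity separately.\<close>

lemma hyp_continuation_lower_c: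
  assumes f1: "hyp_continuation a b (c + 1) f1" and c: "c \<notin> \<int>\<^sub>\<le>\<^sub>0"
  shows "\<exists>f. hyp_continuation a b c f"
proof -
  let ?D = "- (complex_of_real ` {1..})"
  have c0: "c \<noteq> 0" using c by auto
  have D: "open ?D" by (intro open_Compl closed_of_real_atLeast)
  note f1 = f1[unfolded hyp_continuation_def]
  define f where "f u = (u * deriv f1 u + c * f1 u) / c" for u
  have "f holomorphic_on ?D"
    unfolding f_def using f1 D c0 by (intro holomorphic_intros holomorphic_deriv) auto
  moreover have "f u = hyp_series a b c u" if u: "norm u < 1" for u
  proof -
    have "(f1 has_field_derivative hyp_series' a b (c + 1) u) (at u)"
      by (rule has_field_derivative_transform_within_open[OF hyp_series_has_field_derivative[OF u] open_ball[of 0 1]])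
         (use u f1 in auto)
    hence "deriv f1 u = hyp_series' a b (c + 1) u" by (rule DERIV_imp_deriv)
    thus ?thesis using hyp_series_lower_c[OF c u, of a b] f1 u c0 by (simp add: f_def)
  qed
  moreover have "f u = conn_coeff a b c * hyp_term_inf a b c u + conn_coeff b a c * hyp_term_inf b a c u"
    if u: "norm u > 1" "u \<notin> complex_of_real ` {1..}" for u
  proof -
    obtain A where A: "(hyp_term_inf a b (c + 1) has_field_derivative A) (at u)"
     "u * A + c * hyp_term_inf a b (c + 1) u = (c - a) * hyp_term_inf a b c u"
      using hyp_term_inf_lower_c[OF u] by blast
    obtain B where B: "(hyp_term_inf b a (c + 1) has_field_derivative B) (at u)"
     "u * B + c * hyp_term_inf b a (c + 1) u = (c - b) * hyp_term_inf b a c u"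
      using hyp_term_inf_lower_c[OF u] by blast
    let ?P = "conn_coeff a b (c + 1)" and ?Q = "conn_coeff b a (c + 1)"
    have "open (- cball 0 1 \<inter> ?D)" by (intro open_Int D open_Compl closed_cball)
    hence "(f1 has_field_derivative ?P * A + ?Q * B) (at u)"
      by (rule has_field_derivative_transform_within_open[OF DERIV_add[OF DERIV_cmult[OF A(1)] DERIV_cmult[OF B(1)]]])
         (use u f1 in auto)
    hence "deriv f1 u = ?P * A + ?Q * B" by (rule DERIV_imp_deriv)
    moreover have "f1 u = ?P * hyp_term_inf a b (c + 1) u + ?Q * hyp_term_inf b a (c + 1) u" using f1 u by blast
    ultimately have "u * deriv f1 u + c * f1 u = ?P * (u * A + c * hyp_term_inf a b (c + 1) u) +
        ?Q * (u * B + c * hyp_term_inf b a (c + 1) u)" by (simp add: algebra_simps)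
    also have "\<dots> = (?P * (c - a)) * hyp_term_inf a b c u + (?Q * (c - b)) * hyp_term_inf b a c u"
      unfolding A B by (simp only: mult.assoc)
    also have "\<dots> = c * (conn_coeff a b c * hyp_term_inf a b c u + conn_coeff b a c * hyp_term_inf b a c u)"
      unfolding conn_coeff_lower_c[OF c] by (simp add: algebra_simps)
    finally show ?thesis using c0 by (simp add: f_def)
  qed
  ultimately show ?thesis unfolding hyp_continuation_def by blast
qed

theorem hyp_continuation_exists:
  assumes ab: "a - b \<notin> \<int>" and c: "c \<notin> \<int>\<^sub>\<le>\<^sub>0"
  shows "\<exists>f. hyp_continuation a b c f"
proof -
  \<comment> \<open>Large enough for the real part of \<open>c + m - a - b\<close> to exceed 5. The
    induction then comes down from \<open>c + m\<close> to \<open>c\<close>.\<close>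
  define m where "m = nat \<lceil>6 + norm a + norm b + norm c\<rceil>"
  have m: "real m \<ge> 6 + norm a + norm b + norm c" unfolding m_def by (rule of_nat_ceiling)
  note shift = nonpos_Ints_add_of_nat[OF c]
  have "\<exists>f. hyp_continuation a b (c + of_nat (m - k)) f" if "k \<le> m" for k
    using that
  proof (induction k)
    case 0
    have "\<bar>Re a\<bar> \<le> norm a" "\<bar>Re b\<bar> \<le> norm b" "\<bar>Re c\<bar> \<le> norm c" by (rule abs_Re_le_cmod)+
    thus ?case using m norm_ge_zero[of a] norm_ge_zero[of b]
      by (intro hyp_continuation_large_c[OF ab shift]) auto
  next
    case (Suc k)
    have "of_nat (m - k) = (of_nat (m - Suc k) + 1 :: complex)"
      using Suc.prems by (metis Suc_diff_Suc Suc_le_lessD add.commute of_nat_Suc)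
    hence "\<exists>f. hyp_continuation a b ((c + of_nat (m - Suc k)) + 1) f" using Suc by (simp add: add.assoc)
    thus ?case using hyp_continuation_lower_c[OF _ shift] by blast
  qed
  from this[of m] show ?thesis by simp
qed

section \<open>Uniqueness of the continuation and its identification with
  \<open>hyp2F1\<close>\<close>

lemma connected_slit: "connected (- (complex_of_real ` {y..}))"
proof (rule starlike_imp_connected, unfold starlike_def, intro bexI[of _ "of_real (y - 1)"] ballI subsetI)
  fix z w assume z: "z \<in> - (complex_of_real ` {y..})" and "w \<in> closed_segment (complex_of_real (y - 1)) z"
  then obtain t where t: "0 \<le> t" "t \<le> 1" "w = (1 - t) *\<^sub>R of_real (y - 1) + t *\<^sub>R z"
    by (auto simp: in_segment)
  show "w \<in> - (complex_of_real ` {y..})"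
  proof
    assume "w \<in> complex_of_real ` {y..}"
    hence w: "t * Im z = 0" "(1 - t) * (y - 1) + t * Re z \<ge> y"
      unfolding of_real_image_iff t(3) by (auto simp: algebra_simps)
    have "t \<noteq> 0" using w by auto
    hence "Im z = 0" using w by simp
    hence "Re z < y" using z by (auto simp: of_real_image_iff)
    hence "t * Re z < t * y" using t \<open>t \<noteq> 0\<close> by simp
    moreover have "(1 - t) * (y - 1) \<le> (1 - t) * y" using t by (intro mult_left_mono) auto
    ultimately have "(1 - t) * (y - 1) + t * Re z < y" by (simp add: algebra_simps)
    thus False using w by simp
  qed
qed (auto simp: of_real_image_iff)

lemma open_slit: "open (- (complex_of_real ` {y..}))"
  by (intro open_Compl closed_of_real_atLeast)

lemma norm_less_1_not_in_slit: "norm u < 1 \<Longrightarrow> u \<in> - (complex_of_real ` {1..})"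
  using complex_Re_le_cmod[of u] by (auto simp: of_real_image_iff)

text \<open>The slit plane is connected, so the identity theorem makes any two continuations agree
  and the definite description is settled by exhibiting one.\<close>

lemma hyp2F1_eqI:
  assumes f: "f holomorphic_on - (complex_of_real ` {1..})" "\<And>u. norm u < 1 \<Longrightarrow> f u = hyp_series a b c u"
    and w: "w \<in> - (complex_of_real ` {1..})"
  shows "hyp2F1 a b c w = f w"
  unfolding hyp2F1_def
proof (rule the_equality)
  have coeff: "(\<lambda>n. pochhammer a n * pochhammer b n / pochhammer c n * u ^ n / fact n) = (\<lambda>n. hyp_coeff a b c n * u ^ n)"
    for u by (simp add: hyp_coeff_def fun_eq_iff)
  show "\<exists>g. g holomorphic_on - complex_of_real ` {1..} \<and>
      (\<forall>u. norm u < 1 \<longrightarrow> (\<lambda>n. pochhammer a n * pochhammer b n / pochhammer c n * u ^ n / fact n) sums g u) \<and> f w = g w"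
    unfolding coeff using f hyp_series_sums by metis
  fix v assume "\<exists>g. g holomorphic_on - complex_of_real ` {1..} \<and>
      (\<forall>u. norm u < 1 \<longrightarrow> (\<lambda>n. pochhammer a n * pochhammer b n / pochhammer c n * u ^ n / fact n) sums g u) \<and> v = g w"
  then obtain g where g: "g holomorphic_on - complex_of_real ` {1..}" "v = g w"
    "\<And>u. norm u < 1 \<Longrightarrow> (\<lambda>n. hyp_coeff a b c n * u ^ n) sums g u"
    unfolding coeff by blast
  have "g w = f w"
  proof (rule analytic_continuation_open[OF open_ball[of 0 1] open_slit _ connected_slit _ g(1) f(1) _ w])
    show "ball (0::complex) 1 \<subseteq> - (complex_of_real ` {1..})" using norm_less_1_not_in_slit by auto
    fix z :: complex assume "z \<in> ball 0 1"
    hence z: "norm z < 1" by simp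
    show "g z = f z" using sums_unique2[OF g(3)[OF z] hyp_series_sums[OF z]] f(2)[OF z] by simp
  qed auto
  thus "v = f w" using g by simp
qed

lemma hyp_continuation_hyp2F1:
  assumes ab: "a - b \<notin> \<int>" and c: "c \<notin> \<int>\<^sub>\<le>\<^sub>0"
  shows "hyp_continuation a b c (hyp2F1 a b c)"
proof -
  obtain f where f: "hyp_continuation a b c f" using hyp_continuation_exists[OF assms] by blast
  note f' = f[unfolded hyp_continuation_def]
  have eq: "hyp2F1 a b c w = f w" if "w \<in> - (complex_of_real ` {1..})" for w
    by (rule hyp2F1_eqI[OF _ _ that]) (use f' in auto)
  have "hyp2F1 a b c holomorphic_on - (complex_of_real ` {1..})"
    by (rule holomorphic_transform[OF f'[THEN conjunct1]]) (simp add: eq)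
  thus ?thesis unfolding hyp_continuation_def using f' eq norm_less_1_not_in_slit by auto
qed

lemmas hyp2F1_holomorphic = hyp_continuation_hyp2F1[unfolded hyp_continuation_def, THEN conjunct1]

lemma hyp2F1_eq_hyp_series:
  assumes "a - b \<notin> \<int>" "c \<notin> \<int>\<^sub>\<le>\<^sub>0" "norm u < 1"
  shows "hyp2F1 a b c u = hyp_series a b c u"
  using hyp_continuation_hyp2F1[OF assms(1,2)] assms(3) unfolding hyp_continuation_def by blast

text \<open>Outside the closed disc this is the formula carried by the continuation. Both sides are
  holomorphic off \<open>[0, \<infinity>)\<close>, a region mapped into the domain of
  \<open>hyp2F1\<close> by inversion, and the identity theorem does the rest.\<close>

theorem hyp2F1_connection_inf:
  assumes ab: "a - b \<notin> \<int>" and c: "c \<notin> \<int>" and u: "u \<in> - (complex_of_real ` {0..})"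
  shows "hyp2F1 a b c u =
     Gamma c * Gamma (b - a) * rGamma b * rGamma (c - a) *
       (- u) powr (- a) * hyp2F1 a (a - c + 1) (a - b + 1) (1 / u) +
     Gamma c * Gamma (a - b) * rGamma a * rGamma (c - b) *
       (- u) powr (- b) * hyp2F1 b (b - c + 1) (b - a + 1) (1 / u)"
proof -
  define G where "G a b u = (- u) powr (- a) * hyp2F1 a (a - c + 1) (a - b + 1) (1 / u)" for a b u
  let ?S = "- (complex_of_real ` {0..})" and ?D = "- (complex_of_real ` {1..})"
  have ba: "b - a \<notin> \<int>" using ab by (metis Ints_minus minus_diff_eq)
  have c': "c \<notin> \<int>\<^sub>\<le>\<^sub>0" using c nonpos_Ints_Int by blast
  \<comment> \<open>The functions on the right have numerator parameters differing by
    \<open>c - 1\<close>. As \<open>c\<close> is no integer, the continuation theorem is available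
    for them as well.\<close>
  have ae: "a - (a - c + 1) \<notin> \<int>" for a
  proof
    assume "a - (a - c + 1) \<in> \<int>"
    hence "(a - (a - c + 1)) + 1 \<in> \<int>" by (intro Ints_add Ints_1)
    thus False using c by simp
  qed
  have nr: "- u \<notin> \<real>\<^sub>\<le>\<^sub>0" "u \<noteq> 0" if "u \<in> ?S" for u
    using that by (auto simp: of_real_image_iff complex_nonpos_Reals_iff)
  have inv: "1 / u \<in> ?D" if "u \<in> ?S" for u
  proof
    assume "1 / u \<in> complex_of_real ` {1..}"
    then obtain r where r: "r \<ge> 1" "1 / u = of_real r" by auto
    hence "u = of_real (1 / r)" by (metis inverse_eq_divide inverse_inverse_eq of_real_inverse)
    moreover have "1 / r \<ge> 0" using r by simp
    ultimately show False using that by blast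
  qed
  have hG: "G a b holomorphic_on ?S" if "a - b \<notin> \<int>" for a b
  proof -
    have "(hyp2F1 a (a - c + 1) (a - b + 1) \<circ> (\<lambda>u. 1 / u)) holomorphic_on ?S"
      by (rule holomorphic_on_compose_gen[OF _ hyp2F1_holomorphic[OF ae add_1_not_nonpos_Ints[OF that]]])
         (use nr inv in \<open>auto intro!: holomorphic_intros\<close>)
    thus ?thesis unfolding G_def[abs_def] o_def
      using nr by (intro holomorphic_intros) auto
  qed
  have "hyp2F1 a b c u = conn_coeff a b c * G a b u + conn_coeff b a c * G b a u"
  proof (rule analytic_continuation_open[where s = "- cball 0 1 \<inter> ?S" and s' = ?S and z = u])
    show "open (- cball 0 1 \<inter> ?S)" by (intro open_Int open_slit open_Compl closed_cball)
    have "- 2 \<in> - cball 0 1 \<inter> ?S" by (auto simp: of_real_image_iff)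
    thus "- cball 0 1 \<inter> ?S \<noteq> {}" by blast
    show "hyp2F1 a b c holomorphic_on ?S"
      by (rule holomorphic_on_subset[OF hyp2F1_holomorphic[OF ab c']]) auto
    show "(\<lambda>u. conn_coeff a b c * G a b u + conn_coeff b a c * G b a u) holomorphic_on ?S"
      by (intro holomorphic_intros hG ab ba)
    fix z assume z: "z \<in> - cball 0 1 \<inter> ?S"
    hence "norm z > 1" "z \<notin> complex_of_real ` {1..}" by auto
    moreover have "G a b z = hyp_term_inf a b c z" if "a - b \<notin> \<int>" for a b
      unfolding G_def hyp_term_inf_def using \<open>norm z > 1\<close> that
      by (subst hyp2F1_eq_hyp_series[OF ae add_1_not_nonpos_Ints[OF that]]) (auto simp: norm_divide divide_less_eq)
    ultimately show "hyp2F1 a b c z = conn_coeff a b c * G a b z + conn_coeff b a c * G b a z"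
      using hyp_continuation_hyp2F1[OF ab c'] ab ba unfolding hyp_continuation_def by simp
  qed (use u in \<open>auto intro: open_slit connected_slit\<close>)
  thus ?thesis unfolding G_def conn_coeff_def by (simp only: mult.assoc)
qed

section \<open>A quadratic transformation\<close>

lemma pochhammer_minus_of_nat:
  assumes "i \<le> m"
  shows "pochhammer (- of_nat m :: complex) i * fact (m - i) = (- 1) ^ i * fact m"
  using assms
proof (induction i)
  case (Suc i)
  have "fact (m - i) = (of_nat (m - i) * fact (m - Suc i) :: complex)"
    using Suc.prems by (metis Suc_diff_Suc Suc_le_lessD fact_Suc)
  also have "of_nat (m - i) = (of_nat m - of_nat i :: complex)" using Suc.prems by simp
  finally have "- 1 * (pochhammer (- of_nat m :: complex) i * fact (m - i)) =
     pochhammer (- of_nat m) (Suc i) * fact (m - Suc i)"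
    by (simp only: pochhammer_Suc) (simp add: algebra_simps)
  thus ?case using Suc by simp
qed auto

text \<open>Duplication merges the two half-step Pochhammer symbols and \<open>4 ^ i\<close> into
  \<open>pochhammer a (2 * i)\<close>. Together with the one from the binomial coefficient this
  gives \<open>pochhammer a (m + i)\<close>, which splits off \<open>pochhammer a m\<close>. What is
  left is a terminating sum at argument 1, evaluated by Chu-Vandermonde.\<close>

lemma quadratic_coeff_sum:
  fixes a b :: complex
  assumes d: "a - b + 1 \<notin> \<int>\<^sub>\<le>\<^sub>0"
  shows "(\<Sum>i=0..m. hyp_coeff ((a + 1) / 2) (a / 2) (a - b + 1) i * (4 ^ i * ((- a - 2 * of_nat i) gchoose (m - i)))) =
     hyp_coeff a b (a - b + 1) m"
proof -
  let ?d = "a - b + 1"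
  have summand: "hyp_coeff ((a + 1) / 2) (a / 2) ?d i * (4 ^ i * ((- a - 2 * of_nat i) gchoose (m - i))) =
     (- 1) ^ m * pochhammer a m / fact m *
       (pochhammer (a + of_nat m) i * pochhammer (- of_nat m) i / (of_nat (fact i) * pochhammer ?d i))"
    if "i \<le> m" for i
  proof -
    have "pochhammer (2 * (a / 2)) (2 * i) = of_nat (2 ^ (2 * i)) * pochhammer (a / 2) i * pochhammer (a / 2 + 1 / 2) i"
      by (rule pochhammer_double)
    moreover have "of_nat (2 ^ (2 * i)) = (4 ^ i :: complex)" by (simp add: power_mult)
    ultimately have P: "pochhammer ((a + 1) / 2) i * pochhammer (a / 2) i * 4 ^ i = pochhammer a (2 * i)"
      by (simp add: add_divide_distrib)
    have "pochhammer a (2 * i) * pochhammer (a + 2 * of_nat i) (m - i) = pochhammer a (2 * i + (m - i))"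
      using pochhammer_product'[of a "2 * i" "m - i"] by simp
    also have "2 * i + (m - i) = m + i" using that by simp
    also have "pochhammer a (m + i) = pochhammer a m * pochhammer (a + of_nat m) i" by (rule pochhammer_product')
    finally have Q: "pochhammer a (2 * i) * pochhammer (a + 2 * of_nat i) (m - i) = pochhammer a m * pochhammer (a + of_nat m) i" .
    have "(- 1) ^ m * (pochhammer (- of_nat m) i :: complex) * fact (m - i) = (- 1) ^ (m - i) * fact m"
      unfolding mult.assoc pochhammer_minus_of_nat[OF that]
      using that by (simp add: power_diff mult_ac power_add[symmetric] uminus_power_if)
    hence R: "(- 1) ^ (m - i) / fact (m - i) = (- 1) ^ m * (pochhammer (- of_nat m) i :: complex) / fact m"
      by (simp add: field_simps)
    have "hyp_coeff ((a + 1) / 2) (a / 2) ?d i * (4 ^ i * ((- a - 2 * of_nat i) gchoose (m - i))) =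
       (pochhammer ((a + 1) / 2) i * pochhammer (a / 2) i * 4 ^ i) * pochhammer (a + 2 * of_nat i) (m - i)
         * ((- 1) ^ (m - i) / fact (m - i)) / (pochhammer ?d i * fact i)"
      unfolding hyp_coeff_def gbinomial_pochhammer by (simp add: mult_ac add_ac)
    also have "\<dots> = pochhammer a m * pochhammer (a + of_nat m) i
         * ((- 1) ^ m * (pochhammer (- of_nat m) i :: complex) / fact m) / (pochhammer ?d i * fact i)"
      unfolding P Q R ..
    finally show ?thesis by (simp add: mult_ac)
  qed
  have "(\<Sum>i=0..m. hyp_coeff ((a + 1) / 2) (a / 2) ?d i * (4 ^ i * ((- a - 2 * of_nat i) gchoose (m - i)))) =
     (- 1) ^ m * pochhammer a m / fact m *
       (\<Sum>i=0..m. pochhammer (a + of_nat m) i * pochhammer (- of_nat m) i / (of_nat (fact i) * pochhammer ?d i))"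
    unfolding sum_distrib_left by (rule sum.cong) (auto simp: summand)
  also have "(\<Sum>i=0..m. pochhammer (a + of_nat m) i * pochhammer (- of_nat m) i / (of_nat (fact i) * pochhammer ?d i)) =
      pochhammer (?d - (a + of_nat m)) m / pochhammer ?d m"
    by (rule Vandermonde_pochhammer) (use nonpos_Ints_add_of_nat_neq_0[OF d] in \<open>auto simp: eq_neg_iff_add_eq_0\<close>)
  also have "?d - (a + of_nat m) = - (b + of_nat m - 1)" by (simp add: algebra_simps)
  also have "pochhammer (- (b + of_nat m - 1)) m = (- 1) ^ m * pochhammer b m"
    by (subst pochhammer_minus) simp
  also have "(- 1) ^ m * pochhammer a m / fact m * ((- 1) ^ m * pochhammer b m / pochhammer ?d m) =
      ((- 1) ^ m * (- 1) ^ m) * hyp_coeff a b ?d m"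
    by (simp add: hyp_coeff_def mult_ac)
  also have "(- 1) ^ m * (- 1) ^ m = (1 :: complex)"
    by (simp flip: power_mult_distrib)
  finally show ?thesis by simp
qed

text \<open>The quadratic transformation as an identity of formal power series, with the factor
  \<open>(1 + w) powr (- a)\<close> moved to the left. Each power of
  \<open>4 * w / (1 + w)^2\<close> times this factor is again a monomial times a binomial
  series.\<close>

lemma quadratic_fps:
  fixes a b :: complex
  assumes d: "a - b + 1 \<notin> \<int>\<^sub>\<le>\<^sub>0"
  shows "fps_compose (Abs_fps (hyp_coeff ((a + 1) / 2) (a / 2) (a - b + 1))) (fps_const 4 * fps_X * fps_binomial (- 2))
     * fps_binomial (- a) = Abs_fps (hyp_coeff a b (a - b + 1))"
proof (rule fps_ext)
  fix m
  define G :: "complex fps" where "G = fps_const 4 * fps_X * fps_binomial (- 2)"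
  let ?B = "fps_binomial (- a)"
  define H where "H = hyp_coeff ((a + 1) / 2) (a / 2) (a - b + 1)"
  have G0: "G $ 0 = 0" unfolding G_def by simp
  have GB: "G ^ i * ?B = fps_const (4 ^ i) * (fps_X ^ i * fps_binomial (- a - 2 * of_nat i))" for i
  proof (induction i)
    case (Suc i)
    have "G ^ Suc i * ?B = G * (G ^ i * ?B)" by (simp add: mult_ac)
    also have "\<dots> = fps_const (4 ^ Suc i) * (fps_X ^ Suc i * (fps_binomial (- 2) * fps_binomial (- a - 2 * of_nat i)))"
      unfolding Suc by (simp add: G_def mult_ac flip: fps_const_mult)
    also have "fps_binomial (- 2) * fps_binomial (- a - 2 * of_nat i) = fps_binomial (- 2 + (- a - 2 * of_nat i))"
      by (rule fps_binomial_add_mult[symmetric])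
    finally show ?case by (simp add: algebra_simps)
  qed auto
  have "(fps_compose (Abs_fps H) G * ?B) $ m = (\<Sum>k=0..m. (\<Sum>i=0..k. H i * (G ^ i) $ k) * ?B $ (m - k))"
    by (simp add: fps_mult_nth fps_compose_nth)
  \<comment> \<open>The inner range may be enlarged because \<open>G ^ i\<close> has no terms below
    degree \<open>i\<close>; with a rectangular range the sums can be exchanged.\<close>
  also have "\<dots> = (\<Sum>k=0..m. (\<Sum>i=0..m. H i * (G ^ i) $ k) * ?B $ (m - k))"
  proof (rule sum.cong[OF refl], rule arg_cong[of _ _ "\<lambda>x. x * _"], rule sum.mono_neutral_left)
    fix k assume "k \<in> {0..m}"
    thus "{0..k} \<subseteq> {0..m}" by auto
    show "\<forall>i\<in>{0..m} - {0..k}. H i * (G ^ i) $ k = 0"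
      using startsby_zero_power_prefix[OF G0] by auto
  qed auto
  also have "\<dots> = (\<Sum>i=0..m. H i * (\<Sum>k=0..m. (G ^ i) $ k * ?B $ (m - k)))"
    unfolding sum_distrib_right sum_distrib_left mult.assoc by (rule sum.swap)
  also have "\<dots> = (\<Sum>i=0..m. H i * (G ^ i * ?B) $ m)" by (simp only: fps_mult_nth)
  also have "\<dots> = (\<Sum>i=0..m. H i * (4 ^ i * ((- a - 2 * of_nat i) gchoose (m - i))))"
    unfolding GB by (intro sum.cong refl) (simp add: fps_X_power_mult_nth)
  also have "\<dots> = hyp_coeff a b (a - b + 1) m"
    unfolding H_def by (rule quadratic_coeff_sum[OF d])
  finally show "(fps_compose (Abs_fps (hyp_coeff ((a + 1) / 2) (a / 2) (a - b + 1))) (fps_const 4 * fps_X * fps_binomial (- 2))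
     * fps_binomial (- a)) $ m = Abs_fps (hyp_coeff a b (a - b + 1)) $ m"
    unfolding G_def H_def by simp
qed

lemma hyp_series_has_fps_expansion: "hyp_series a b c has_fps_expansion Abs_fps (hyp_coeff a b c)"
proof (rule has_fps_expansionI)
  have "eventually (\<lambda>u. u \<in> ball (0::complex) 1) (nhds 0)" by (intro eventually_nhds_in_open) auto
  thus "eventually (\<lambda>u. (\<lambda>n. fps_nth (Abs_fps (hyp_coeff a b c)) n * u ^ n) sums hyp_series a b c u) (nhds 0)"
    by eventually_elim (simp add: hyp_series_sums)
qed

text \<open>If the value were a real \<open>r \<ge> 1\<close>, then \<open>w + 1/w = 4/r - 2\<close>
  would lie in \<open>(-2, 2]\<close>, and this forces \<open>w\<close> onto the unit
  circle.\<close>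

lemma quadratic_map_in_slit:
  assumes w: "norm (w :: complex) < 1"
  shows "4 * w / (1 + w)\<^sup>2 \<in> - (complex_of_real ` {1..})"
proof
  assume "4 * w / (1 + w)\<^sup>2 \<in> complex_of_real ` {1..}"
  then obtain r :: real where r: "r \<ge> 1" "4 * w / (1 + w)\<^sup>2 = of_real r" by auto
  have w1: "1 + w \<noteq> 0"
  proof
    assume "1 + w = 0"
    hence "w = - 1" by (simp add: eq_neg_iff_add_eq_0 add.commute)
    thus False using w by simp
  qed
  have "w \<noteq> 0" using r by auto
  have "4 * w = of_real r * (1 + w)\<^sup>2" using r(2) w1 by (simp add: field_simps)
  hence "(1 + w)\<^sup>2 = of_real (4 / r) * w" using r(1) by (simp add: field_simps)
  moreover have "w\<^sup>2 + 1 = (1 + w)\<^sup>2 - 2 * w" by (simp add: power2_eq_square algebra_simps)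
  moreover define s where "s = 4 / r - 2"
  ultimately have eq: "w\<^sup>2 + 1 = of_real s * w" by (simp add: left_diff_distrib)
  have s: "- 2 < s" "s \<le> 2" using r(1) unfolding s_def by (auto simp: field_simps)
  have re: "(Re w)\<^sup>2 - (Im w)\<^sup>2 + 1 = s * Re w" and im: "2 * Re w * Im w = s * Im w"
    using arg_cong[OF eq, of Re] arg_cong[OF eq, of Im] by (simp_all add: power2_eq_square)
  have n: "(Re w)\<^sup>2 + (Im w)\<^sup>2 < 1" using w by (simp add: cmod_def)
  show False
  proof (cases "Im w = 0")
    case True
    have "(Re w)\<^sup>2 < 1" using n True by simp
    hence "\<bar>Re w\<bar> < 1" by (simp add: abs_square_less_1)
    hence pos: "(1 - Re w)\<^sup>2 > 0" "(1 + Re w)\<^sup>2 > 0" by auto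
    show False
    proof (cases "Re w \<ge> 0")
      case True
      hence "s * Re w \<le> 2 * Re w" using s by (intro mult_right_mono) auto
      thus False using re pos \<open>Im w = 0\<close> by (simp add: power2_eq_square algebra_simps)
    next
      case False
      hence "s * Re w \<le> (- 2) * Re w" using s by (intro mult_right_mono_neg) auto
      thus False using re pos \<open>Im w = 0\<close> by (simp add: power2_eq_square algebra_simps)
    qed
  next
    case False
    hence "s = 2 * Re w" using im by simp
    hence "(Re w)\<^sup>2 + (Im w)\<^sup>2 = 1" using re by (simp add: power2_eq_square algebra_simps)
    thus False using n by simp
  qed
qed

text \<open>Equal expansions give the identity near 0. The quadratic map keeps the disc off the cut,
  so both sides are holomorphic on the disc and the identity spreads. With
  \<open>w = exp (- 2 * \<i> * \<theta>)\<close> the argument on the left becomes the inverse square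
  of \<open>cos \<theta>\<close>.\<close>

theorem hyp2F1_quadratic:
  assumes d: "a - b + 1 \<notin> \<int>\<^sub>\<le>\<^sub>0" and w: "norm w < 1"
  shows "hyp2F1 ((a + 1) / 2) (a / 2) (a - b + 1) (4 * w / (1 + w)\<^sup>2) = (1 + w) powr a * hyp_series a b (a - b + 1) w"
proof -
  let ?d = "a - b + 1"
  \<comment> \<open>The parameters on the left differ by 1/2, so \<open>hyp2F1\<close> is known to
    be holomorphic there.\<close>
  have half: "(a + 1) / 2 - a / 2 \<notin> \<int>"
  proof
    assume "(a + 1) / 2 - a / 2 \<in> \<int>"
    moreover have "(a + 1) / 2 - a / 2 = complex_of_real (1 / 2)" by (simp add: add_divide_distrib)
    ultimately have "complex_of_real (1 / 2) \<in> \<int>" by simp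
    hence "(1 / 2 :: real) \<in> \<int>" by (simp only: of_real_in_Ints_iff)
    thus False by (auto elim!: Ints_cases simp: field_simps)
  qed
  define q where "q w = 4 * w / (1 + w)\<^sup>2" for w :: complex
  have w1: "1 + w \<noteq> 0" "1 + w \<notin> \<real>\<^sub>\<le>\<^sub>0" if "norm w < 1" for w :: complex
  proof -
    have "Re w > - 1" using that abs_Re_le_cmod[of w] by linarith
    thus "1 + w \<notin> \<real>\<^sub>\<le>\<^sub>0" by (auto simp: complex_nonpos_Reals_iff)
    thus "1 + w \<noteq> 0" by auto
  qed
  let ?lhs = "\<lambda>w. hyp2F1 ((a + 1) / 2) (a / 2) ?d (q w)"
  have near0: "eventually (\<lambda>w. ?lhs w = (1 + w) powr a * hyp_series a b ?d w) (nhds 0)"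
  proof -
    \<comment> \<open>The map \<open>q\<close> written with a complex power, the form for which a
      binomial expansion is at hand; the two agree for \<open>norm w < 1\<close>.\<close>
    define G where "G w = 4 * w * (1 + w) powr (- 2)" for w :: complex
    have "G has_fps_expansion fps_const 4 * fps_X * fps_binomial (- 2)"
      unfolding G_def by (intro fps_expansion_intros)
    hence "(hyp_series ((a + 1) / 2) (a / 2) ?d \<circ> G) has_fps_expansion
        fps_compose (Abs_fps (hyp_coeff ((a + 1) / 2) (a / 2) ?d)) (fps_const 4 * fps_X * fps_binomial (- 2))"
      by (rule has_fps_expansion_compose[OF hyp_series_has_fps_expansion]) simp
    from has_fps_expansion_mult[OF this has_fps_expansion_binomial_complex[of "- a"]]
    have "(\<lambda>w. (hyp_series ((a + 1) / 2) (a / 2) ?d \<circ> G) w * (1 + w) powr (- a)) has_fps_expansion Abs_fps (hyp_coeff a b ?d)"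
      unfolding quadratic_fps[OF d] .
    hence "eventually (\<lambda>w. (hyp_series ((a + 1) / 2) (a / 2) ?d \<circ> G) w * (1 + w) powr (- a) = hyp_series a b ?d w) (nhds 0)"
      using hyp_series_has_fps_expansion[of a b ?d, unfolded has_fps_expansion_def, THEN conjunct2]
      unfolding has_fps_expansion_def by (auto elim: eventually_elim2)
    moreover have "eventually (\<lambda>w. norm (q w) < 1) (nhds 0)"
    proof -
      have "(q \<longlongrightarrow> q 0) (nhds 0)" unfolding q_def
        by (intro tendsto_intros filterlim_ident) auto
      moreover have "q 0 = 0" by (simp add: q_def)
      ultimately have "((\<lambda>w. norm (q w)) \<longlongrightarrow> 0) (nhds 0)"
        by (simp only:) (rule tendsto_norm_zero)
      thus ?thesis by (rule order_tendstoD) simp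
    qed
    moreover have "eventually (\<lambda>w. w \<in> ball (0::complex) 1) (nhds 0)" by (intro eventually_nhds_in_open) auto
    ultimately show ?thesis
    proof eventually_elim
      case (elim w)
      note nz = w1[of w]
      have "(1 + w) powr (- 2) = inverse ((1 + w) powr 2)" by (simp add: powr_minus)
      also have "(1 + w) powr 2 = (1 + w)\<^sup>2" using nz elim by (simp add: powr_def exp_double)
      finally have "G w = q w" unfolding G_def q_def by (simp add: field_simps)
      hence "hyp_series ((a + 1) / 2) (a / 2) ?d (q w) * (1 + w) powr (- a) = hyp_series a b ?d w" using elim by simp
      hence "(1 + w) powr a * hyp_series a b ?d w = hyp_series ((a + 1) / 2) (a / 2) ?d (q w) * ((1 + w) powr a * (1 + w) powr (- a))"
        by (simp add: mult_ac)
      also have "(1 + w) powr a * (1 + w) powr (- a) = 1" using nz elim by (simp add: powr_minus)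
      finally show ?case using elim by (simp add: hyp2F1_eq_hyp_series[OF half d])
    qed
  qed
  then obtain S where S: "open S" "0 \<in> S" "\<And>w. w \<in> S \<Longrightarrow> ?lhs w = (1 + w) powr a * hyp_series a b ?d w"
    unfolding eventually_nhds by blast
  have "?lhs w = (1 + w) powr a * hyp_series a b ?d w"
  proof (rule analytic_continuation_open[where s = "S \<inter> ball 0 1" and s' = "ball 0 1" and z = w])
    have "(hyp2F1 ((a + 1) / 2) (a / 2) ?d \<circ> q) holomorphic_on ball 0 1"
    proof (rule holomorphic_on_compose_gen[OF _ hyp2F1_holomorphic[OF half d]])
      show "q holomorphic_on ball 0 1"
        unfolding q_def[abs_def] using w1 by (intro holomorphic_intros) auto
      show "q ` ball 0 1 \<subseteq> - (complex_of_real ` {1..})"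
        unfolding q_def by (intro image_subsetI quadratic_map_in_slit) simp
    qed
    thus "?lhs holomorphic_on ball 0 1" by (simp add: o_def)
    show "(\<lambda>w. (1 + w) powr a * hyp_series a b ?d w) holomorphic_on ball 0 1"
      using w1 by (intro holomorphic_intros hyp_series_holomorphic) auto
    have "0 \<in> S \<inter> ball 0 1" using S by simp
    thus "S \<inter> ball 0 1 \<noteq> {}" by blast
  qed (use S w in auto)
  thus ?thesis by (simp add: q_def)
qed

section \<open>Legendre and Ferrers functions\<close>

lemma hyp2F1_commute: "hyp2F1 a b c w = hyp2F1 b a c w"
  unfolding hyp2F1_def by (simp add: mult.commute[of "pochhammer a _"])

section \<open>The cosine as a parametrization of \<open>D1\<close> by a vertical strip\<close>

lemma D1_iff: "x \<in> D1 \<longleftrightarrow> Im x \<noteq> 0 \<or> \<bar>Re x\<bar> < 1"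
  by (auto simp: D1_def image_Un image_iff complex_eq_iff abs_less_iff not_le)

lemma cos_in_D1:
  assumes "0 < Re \<theta>" "Re \<theta> < pi"
  shows "cos \<theta> \<in> D1"
proof (rule ccontr)
  assume "cos \<theta> \<notin> D1"
  hence im: "Im (cos \<theta>) = 0" and re: "\<bar>Re (cos \<theta>)\<bar> \<ge> 1" by (auto simp: D1_iff)
  have s: "sin (Re \<theta>) > 0" using assms by (rule sin_gt_zero)
  have "sin (Re \<theta>) * (exp (- Im \<theta>) - exp (Im \<theta>)) = 0" using im by (simp add: Im_cos)
  hence "exp (- Im \<theta>) = exp (Im \<theta>)" using s by simp
  hence "Im \<theta> = 0" by simp
  hence "\<bar>cos (Re \<theta>)\<bar> \<ge> 1" using re by (simp add: Re_cos)
  hence "(cos (Re \<theta>))\<^sup>2 \<ge> 1" by (metis abs_square_less_1 not_le)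
  hence "(sin (Re \<theta>))\<^sup>2 \<le> 0" using sin_cos_squared_add[of "Re \<theta>"] by linarith
  thus False using s by simp
qed

text \<open>The cosine maps the lines \<open>Re \<theta> = 0\<close> and
  \<open>Re \<theta> = pi\<close> into the two rays removed from \<open>D1\<close>, so the
  inequalities are strict.\<close>

lemma Re_Arccos_D1:
  assumes "x \<in> D1"
  shows "0 < Re (Arccos x)" "Re (Arccos x) < pi"
proof -
  \<comment> \<open>The general bounds leave the sign of \<open>Re (Arccos x)\<close> open; as the
    cosine is even, the sign can be adjusted first and shown to be right afterwards.\<close>
  define \<theta> where "\<theta> = (if Re (Arccos x) < 0 then - Arccos x else Arccos x)"
  have c: "cos \<theta> = x" by (simp add: \<theta>_def)
  have "0 \<le> Re \<theta>" "Re \<theta> \<le> pi" using Re_Arccos_bounds[of x] by (auto simp: \<theta>_def)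
  moreover have "sin (Re \<theta>) \<noteq> 0"
  proof
    assume s: "sin (Re \<theta>) = 0"
    hence "(cos (Re \<theta>))\<^sup>2 = 1" using sin_cos_squared_add[of "Re \<theta>"] by simp
    hence c1: "\<bar>cos (Re \<theta>)\<bar> = 1" by (simp add: power2_eq_1_iff abs_if split: if_splits) (metis abs_1 abs_minus abs_if_raw)
    have "(exp (Im \<theta>) + exp (- Im \<theta>)) / 2 \<ge> 1"
      using cosh_real_ge_1[of "Im \<theta>"] by (simp add: cosh_def)
    hence "\<bar>Re (cos \<theta>)\<bar> \<ge> 1" by (simp add: Re_cos abs_mult c1 add.commute)
    moreover have "Im (cos \<theta>) = 0" by (simp add: Im_cos s)
    ultimately show False using assms unfolding c by (simp add: D1_iff)
  qed
  hence "Re \<theta> \<noteq> 0" "Re \<theta> \<noteq> pi" by auto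
  ultimately have \<theta>: "0 < Re \<theta>" "Re \<theta> < pi" by linarith+
  hence "Arccos x = \<theta>" using Arccos_cos[of \<theta>] c by simp
  thus "0 < Re (Arccos x)" "Re (Arccos x) < pi" using \<theta> by auto
qed

lemma D1_eq_cos_image: "D1 = cos ` {\<theta>. 0 < Re \<theta> \<and> Re \<theta> < pi}"
  using cos_in_D1 Re_Arccos_D1 by (force simp: image_iff intro!: exI[of _ "Arccos _"])

lemma open_D1: "open D1"
proof -
  have eq: "D1 = ({z. Im z < 0} \<union> {z. Im z > 0}) \<union> ({z. Re z < 1} \<inter> {z. Re z > - 1})"
    by (auto simp: D1_iff abs_less_iff)
  show ?thesis unfolding eq
    by (intro open_Un open_Int open_halfspace_Im_lt open_halfspace_Im_gt open_halfspace_Re_lt open_halfspace_Re_gt)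
qed

lemma connected_D1: "connected D1"
proof -
  have "{\<theta>. 0 < Re \<theta> \<and> Re \<theta> < pi} = {\<theta>. Re \<theta> > 0} \<inter> {\<theta>. Re \<theta> < pi}" by auto
  hence "convex {\<theta>. 0 < Re \<theta> \<and> Re \<theta> < pi}"
    by (simp add: convex_Int convex_halfspace_Re_gt convex_halfspace_Re_lt)
  thus ?thesis unfolding D1_eq_cos_image
    by (intro connected_continuous_image convex_connected continuous_intros)
qed

lemma Re_sin_pos:
  assumes "0 < Re \<theta>" "Re \<theta> < pi"
  shows "Re (sin \<theta>) > 0"
  using sin_gt_zero[OF assms] by (simp add: Re_sin add_pos_pos)

text \<open>The sine has positive real part on the strip, so its argument is below
  \<open>pi / 2\<close> in absolute value and may be doubled. This matches the principal powers of
  \<open>1 - x\<^sup>2\<close> with those of \<open>sin \<theta>\<close>.\<close>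

lemma Ln_sin_squared:
  assumes "0 < Re \<theta>" "Re \<theta> < pi"
  shows "Ln ((sin \<theta>)\<^sup>2) = 2 * Ln (sin \<theta>)"
proof (rule Ln_unique)
  have r: "Re (sin \<theta>) > 0" by (rule Re_sin_pos[OF assms])
  hence "sin \<theta> \<noteq> 0" by auto
  thus "exp (2 * Ln (sin \<theta>)) = (sin \<theta>)\<^sup>2" by (simp add: exp_double)
  show "- pi < Im (2 * Ln (sin \<theta>))" "Im (2 * Ln (sin \<theta>)) \<le> pi"
    using Re_Ln_pos_lt_imp[OF r] by auto
qed

text \<open>The argument of the exponential is \<open>2 * Re \<theta>\<close> up to sign, strictly
  between 0 and a full turn.\<close>

lemma exp_double_in_slit:
  assumes "0 < Re \<theta>" "Re \<theta> < pi" "s \<in> {1, -1}"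
  shows "exp (2 * s * \<i> * \<theta>) \<in> - (complex_of_real ` {0..})"
proof
  assume "exp (2 * s * \<i> * \<theta>) \<in> complex_of_real ` {0..}"
  hence im: "Im (exp (2 * s * \<i> * \<theta>)) = 0" and re: "Re (exp (2 * s * \<i> * \<theta>)) \<ge> 0"
    unfolding of_real_image_iff by auto
  have "sin (2 * Re \<theta>) = 0" "cos (2 * Re \<theta>) \<ge> 0" using im re assms(3)
    by (auto simp: Im_exp Re_exp zero_le_mult_iff)
  hence "sin (Re \<theta>) * cos (Re \<theta>) = 0" "cos (2 * Re \<theta>) \<ge> 0" by (auto simp: sin_double)
  moreover have "sin (Re \<theta>) > 0" by (rule sin_gt_zero[OF assms(1,2)])
  ultimately show False by (simp add: cos_double)
qed

text \<open>
  Up to a constant factor, the continuation of \<open>legendreQ\<close> from the upper half-plane (\<open>s = 1\<close>) or the lower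
  half-plane (\<open>s = -1\<close>), as a function of \<open>\<theta> = Arccos x\<close>.
\<close>

definition ferrers_half :: "complex \<Rightarrow> complex \<Rightarrow> complex \<Rightarrow> complex \<Rightarrow> complex"
  where "ferrers_half \<nu> \<mu> s \<theta> =
    of_real (sqrt pi) * 2 powr \<mu> * (Gamma (\<nu> + \<mu> + 1) * rGamma (\<nu> + 3/2)) * (sin \<theta>) powr \<mu> *
      exp (- s * \<i> * (\<nu> + \<mu> + 1) * \<theta>) * hyp2F1 (1/2 + \<mu>) (\<nu> + \<mu> + 1) (\<nu> + 3/2) (exp (- s * 2 * \<i> * \<theta>))"

lemma half_Ints_shift:
  fixes \<nu> :: complex
  assumes "\<nu> + 1/2 \<notin> \<int>"
  shows "\<nu> + 3/2 \<notin> \<int>" "- (\<nu> + 1/2) \<notin> \<int>"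
proof -
  have "\<nu> + 3/2 = (\<nu> + 1/2) + 1" by simp
  thus "\<nu> + 3/2 \<notin> \<int>" using assms by (metis Ints_1 Ints_diff add_diff_cancel_right')
  show "- (\<nu> + 1/2) \<notin> \<int>" using assms by (metis Ints_minus minus_minus)
qed

lemma ferrers_half_holomorphic:
  assumes \<nu>: "\<nu> + 1/2 \<notin> \<int>" and s: "s \<in> {1, -1}"
  shows "(\<lambda>x. ferrers_half \<nu> \<mu> s (Arccos x)) holomorphic_on D1"
proof -
  \<comment> \<open>The difference is \<open>- (\<nu> + 1/2)\<close>: the hypothesis on \<nu> is
    exactly the condition of the continuation theorem.\<close>
  have ab: "1/2 + \<mu> - (\<nu> + \<mu> + 1) \<notin> \<int>" using half_Ints_shift(2)[OF \<nu>] by (simp add: algebra_simps)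
  have c: "\<nu> + 3/2 \<notin> \<int>\<^sub>\<le>\<^sub>0" using half_Ints_shift(1)[OF \<nu>] nonpos_Ints_Int by blast
  have A: "Arccos holomorphic_on D1" by (rule holomorphic_on_Arccos) (auto simp: D1_iff)
  have "(hyp2F1 (1/2 + \<mu>) (\<nu> + \<mu> + 1) (\<nu> + 3/2) \<circ> (\<lambda>x. exp (- s * 2 * \<i> * Arccos x))) holomorphic_on D1"
  proof (rule holomorphic_on_compose_gen[OF _ hyp2F1_holomorphic[OF ab c]])
    show "(\<lambda>x. exp (- s * 2 * \<i> * Arccos x)) holomorphic_on D1" using A by (intro holomorphic_intros)
    show "(\<lambda>x. exp (- s * 2 * \<i> * Arccos x)) ` D1 \<subseteq> - complex_of_real ` {1..}"
    proof
      fix w assume "w \<in> (\<lambda>x. exp (- s * 2 * \<i> * Arccos x)) ` D1"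
      then obtain x where x: "x \<in> D1" "w = exp (2 * (- s) * \<i> * Arccos x)" by (auto simp: mult_ac)
      have "w \<in> - complex_of_real ` {0..}"
        unfolding x by (rule exp_double_in_slit[OF Re_Arccos_D1[OF x(1)]]) (use s in auto)
      thus "w \<in> - complex_of_real ` {1..}" by auto
    qed
  qed
  moreover have "sin (Arccos x) \<notin> \<real>\<^sub>\<le>\<^sub>0" if "x \<in> D1" for x
    using Re_sin_pos[OF Re_Arccos_D1[OF that]] by (auto simp: complex_nonpos_Reals_iff)
  ultimately show ?thesis
    unfolding ferrers_half_def o_def using A by (intro holomorphic_intros) auto
qed

section \<open>Boundary values of \<open>legendreQ\<close> and the analytic extension\<close>

lemma Im_Ln_neg_imp: "Im z < 0 \<Longrightarrow> - pi < Im (Ln z) \<and> Im (Ln z) < 0"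
proof -
  assume z: "Im z < 0"
  hence "z \<noteq> 0" by auto
  thus ?thesis using z Im_Ln_pos_le[of z] mpi_less_Im_Ln[of z] Im_Ln_le_pi[of z] by force
qed

text \<open>The quadratic transformation with parameters \<open>\<nu> + \<mu> + 1\<close> and
  \<open>1/2 + \<mu>\<close>. Apart from it, the work lies in the branches: every logarithm is split
  into parts whose arguments have opposite signs.\<close>

lemma legendreQ_cos:
  assumes \<nu>: "\<nu> + 1/2 \<notin> \<int>" and s: "s \<in> {1, -1}"
    and \<theta>: "0 < Re \<theta>" "Re \<theta> < pi" "Re s * Im \<theta> < 0"
  shows "legendreQ \<nu> \<mu> (cos \<theta>) = exp (\<i> * of_real pi * \<mu>) * exp (s * \<i> * of_real pi * \<mu> / 2) * ferrers_half \<nu> \<mu> s \<theta>"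
proof -
  define z where "z = cos \<theta>"
  \<comment> \<open>The exponent has real part \<open>2 * Re s * Im \<theta>\<close>, so the sign
    condition on \<theta> puts \<open>w\<close> inside the unit disc.\<close>
  define w where "w = exp (- s * 2 * \<i> * \<theta>)"
  define a where "a = \<nu> + \<mu> + 1"
  have imz: "Re s * Im z > 0"
  proof -
    have "Im z = sin (Re \<theta>) * (exp (- Im \<theta>) - exp (Im \<theta>)) / 2" by (simp add: z_def Im_cos)
    hence "Re s * Im z = sin (Re \<theta>) * (Re s * (exp (- Im \<theta>) - exp (Im \<theta>))) / 2" by simp
    moreover have "Re s * (exp (- Im \<theta>) - exp (Im \<theta>)) > 0" using s \<theta> by auto
    moreover have "sin (Re \<theta>) > 0" by (rule sin_gt_zero[OF \<theta>(1,2)])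
    ultimately show ?thesis by (simp only: mult_pos_pos half_gt_zero)
  qed
  hence z0: "z \<noteq> 0" "1 + z \<noteq> 0" "1 - z \<noteq> 0" "z - 1 \<noteq> 0"
    by (auto simp: complex_eq_iff)
  have nw: "norm w < 1" using \<theta> s by (auto simp: w_def norm_exp_eq_Re)
  have w1: "1 + w = 2 * z * exp (- s * \<i> * \<theta>)"
    using s unfolding w_def z_def cos_exp_eq
    by (auto simp: algebra_simps exp_add[symmetric] exp_minus[symmetric])
  have w2: "4 * w / (1 + w)\<^sup>2 = 1 / z\<^sup>2"
    unfolding w1 using z0 by (simp add: power_mult_distrib w_def exp_double[symmetric] field_simps)
  \<comment> \<open>\<open>Im z\<close> has the sign of \<open>s\<close>, hence so has the argument
    of \<open>z\<close>, while \<open>- s * \<i> * \<theta>\<close> contributes an argument of the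
    opposite sign; both are below \<open>pi\<close>, so the sum stays principal.\<close>
  have bounds: "\<bar>Im (Ln z - s * \<i> * \<theta>)\<bar> < pi"
    using s imz \<theta> Im_Ln_pos_lt_imp[of z] Im_Ln_neg_imp[of z] by auto
  have "Ln (1 + w) = of_real (ln 2) + Ln z - s * \<i> * \<theta>"
    by (rule Ln_unique) (use bounds z0 in \<open>auto simp: w1 exp_add exp_diff exp_minus exp_of_real field_simps\<close>)
  moreover have "1 + w \<noteq> 0" unfolding w1 using z0 by simp
  moreover have "Ln 2 = of_real (ln 2)" using Ln_of_real[of 2] by simp
  ultimately have "(1 + w) powr a = exp (a * (Ln 2 + Ln z - s * \<i> * \<theta>))"
    by (simp add: powr_def)
  also have "a * (Ln 2 + Ln z - s * \<i> * \<theta>) = a * Ln 2 + a * Ln z + (- s * \<i> * a * \<theta>)"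
    by (simp add: algebra_simps)
  finally have p1: "(1 + w) powr a = 2 powr a * z powr a * exp (- s * \<i> * a * \<theta>)"
    unfolding exp_add using z0 by (simp add: powr_def)
  \<comment> \<open>\<open>1 + z\<close> and \<open>1 - z\<close> lie in opposite
    half-planes.\<close>
  have bz: "\<bar>Im (Ln (1 + z) + Ln (1 - z))\<bar> < pi"
    using s imz Im_Ln_pos_lt_imp[of "1 + z"] Im_Ln_neg_imp[of "1 + z"] Im_Ln_pos_lt_imp[of "1 - z"] Im_Ln_neg_imp[of "1 - z"] by auto
  have "Ln ((sin \<theta>)\<^sup>2) = Ln (1 + z) + Ln (1 - z)"
  proof (rule Ln_unique)
    show "exp (Ln (1 + z) + Ln (1 - z)) = (sin \<theta>)\<^sup>2"
      using z0 by (simp add: exp_add sin_squared_eq z_def algebra_simps power2_eq_square)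
  qed (use bz in auto)
  hence L: "Ln (1 + z) + Ln (1 - z) = 2 * Ln (sin \<theta>)" by (simp add: Ln_sin_squared[OF \<theta>(1,2)])
  \<comment> \<open>The half turn between \<open>1 - z\<close> and \<open>z - 1\<close> produces the
    phase \<open>exp (s * \<i> * of_real pi * \<mu> / 2)\<close>, which the weights of the Ferrers
    function undo.\<close>
  have L2: "Ln (z - 1) = Ln (1 - z) + s * \<i> * of_real pi"
  proof (rule Ln_unique)
    show "exp (Ln (1 - z) + s * \<i> * of_real pi) = z - 1"
      using z0 s by (auto simp: exp_add exp_ii_pi)
  qed (use s imz Im_Ln_pos_lt_imp[of "1 - z"] Im_Ln_neg_imp[of "1 - z"] in auto)
  have sn0: "sin \<theta> \<noteq> 0" using Re_sin_pos[OF \<theta>(1,2)] by auto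
  have "(z + 1) powr (\<mu> / 2) * (z - 1) powr (\<mu> / 2) = exp (\<mu> / 2 * ((Ln (1 + z) + Ln (1 - z)) + s * \<i> * of_real pi))"
    using z0 by (simp add: powr_def L2 exp_add[symmetric] algebra_simps)
  also have "\<dots> = exp (s * \<i> * of_real pi * \<mu> / 2) * (sin \<theta>) powr \<mu>"
    unfolding L using sn0 by (simp add: powr_def exp_add[symmetric] algebra_simps)
  finally have p2: "(z + 1) powr (\<mu> / 2) * (z - 1) powr (\<mu> / 2) = exp (s * \<i> * of_real pi * \<mu> / 2) * (sin \<theta>) powr \<mu>" .
  have d: "a - (1/2 + \<mu>) + 1 = \<nu> + 3/2" by (simp add: a_def)
  have dn: "a - (1/2 + \<mu>) + 1 \<notin> \<int>\<^sub>\<le>\<^sub>0" unfolding d using half_Ints_shift(1)[OF \<nu>] nonpos_Ints_Int by blast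
  have ab: "1/2 + \<mu> - a \<notin> \<int>" using half_Ints_shift(2)[OF \<nu>] by (simp add: a_def algebra_simps)
  have "hyp2F1 ((\<nu> + \<mu> + 2) / 2) ((\<nu> + \<mu> + 1) / 2) (\<nu> + 3/2) (1 / z\<^sup>2) = hyp2F1 ((a + 1) / 2) (a / 2) (a - (1/2 + \<mu>) + 1) (4 * w / (1 + w)\<^sup>2)"
    unfolding d w2 by (simp add: a_def add.assoc)
  also have "\<dots> = (1 + w) powr a * hyp_series a (1/2 + \<mu>) (a - (1/2 + \<mu>) + 1) w"
    by (rule hyp2F1_quadratic[OF dn nw])
  also have "hyp_series a (1/2 + \<mu>) (a - (1/2 + \<mu>) + 1) w = hyp2F1 (1/2 + \<mu>) a (\<nu> + 3/2) w"
    using hyp2F1_eq_hyp_series[OF ab dn nw] unfolding d by (simp add: hyp_series_commute)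
  finally have H: "hyp2F1 ((\<nu> + \<mu> + 2) / 2) ((\<nu> + \<mu> + 1) / 2) (\<nu> + 3/2) (1 / z\<^sup>2) =
      2 powr a * z powr a * exp (- s * \<i> * a * \<theta>) * hyp2F1 (1/2 + \<mu>) a (\<nu> + 3/2) w" unfolding p1 .
  have two: "2 powr a / 2 powr (\<nu> + 1) = (2 powr \<mu> :: complex)"
    by (simp add: powr_diff[symmetric] a_def)
  have "legendreQ \<nu> \<mu> z = of_real (sqrt pi) * exp (\<i> * of_real pi * \<mu>) * Gamma a
      * (exp (s * \<i> * of_real pi * \<mu> / 2) * (sin \<theta>) powr \<mu>)
      * (2 powr a / 2 powr (\<nu> + 1)) * (z powr a / z powr a) * rGamma (\<nu> + 3/2)
      * (exp (- s * \<i> * a * \<theta>) * hyp2F1 (1/2 + \<mu>) a (\<nu> + 3/2) w)"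
    unfolding legendreQ_def p2 H unfolding a_def[symmetric] by (simp add: mult_ac)
  also have "z powr a / z powr a = 1" using z0 by simp
  finally show ?thesis
    unfolding two z_def ferrers_half_def w_def a_def[symmetric] by (simp only: mult_ac mult_1)
qed

lemma half_plane_Arccos:
  assumes s: "s \<in> {1, -1 :: complex}" and z: "Re s * Im z > 0"
  shows "z \<in> D1" "Re s * Im (Arccos z) < 0"
proof -
  show D: "z \<in> D1" using z by (auto simp: D1_iff)
  let ?\<theta> = "Arccos z"
  have "Im (cos ?\<theta>) = sin (Re ?\<theta>) * (exp (- Im ?\<theta>) - exp (Im ?\<theta>)) / 2" by (simp only: Im_cos)
  hence "Re s * Im z = sin (Re ?\<theta>) * (Re s * (exp (- Im ?\<theta>) - exp (Im ?\<theta>))) / 2" by simp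
  moreover have "sin (Re ?\<theta>) > 0" by (rule sin_gt_zero[OF Re_Arccos_D1[OF D]])
  ultimately have "Re s * (exp (- Im ?\<theta>) - exp (Im ?\<theta>)) > 0"
    using z zero_less_mult_pos half_gt_zero_iff by metis
  thus "Re s * Im ?\<theta> < 0" using s by auto
qed

text \<open>On its half-plane \<open>legendreQ\<close> equals a function holomorphic on all of
  \<open>D1\<close>, so the boundary value is the value of that function.\<close>

lemma Lim_legendreQ:
  assumes \<nu>: "\<nu> + 1/2 \<notin> \<int>" and s: "s \<in> {1, -1}" and t: "-1 < t" "t < 1"
  shows "Lim (at (of_real t) within {z. Re s * Im z > 0}) (legendreQ \<nu> \<mu>) =
     exp (\<i> * of_real pi * \<mu>) * exp (s * \<i> * of_real pi * \<mu> / 2) * ferrers_half \<nu> \<mu> s (Arccos (of_real t))"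
proof (rule tendsto_Lim)
  let ?S = "{z. Re s * Im z > 0}" and ?t = "complex_of_real t"
  let ?K = "exp (\<i> * of_real pi * \<mu>) * exp (s * \<i> * of_real pi * \<mu> / 2)"
  \<comment> \<open>\<open>Lim\<close> is determined only along a nontrivial filter, so
    \<open>?t\<close> must be approached from within the half-plane.\<close>
  have "?t islimpt ?S"
    unfolding islimpt_approachable
  proof (intro allI impI)
    fix e :: real assume e: "e > 0"
    have "?t + s * \<i> * of_real (e / 2) \<in> ?S" using s e by auto
    moreover have "dist (?t + s * \<i> * of_real (e / 2)) ?t < e" using s e by (auto simp: dist_norm norm_mult)
    moreover have "?t + s * \<i> * of_real (e / 2) \<noteq> ?t" using s e by auto
    ultimately show "\<exists>x'\<in>?S. x' \<noteq> ?t \<and> dist x' ?t < e" by blast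
  qed
  thus "\<not> trivial_limit (at ?t within ?S)" by (simp add: trivial_limit_within)
  have tD: "?t \<in> D1" using t by (simp add: D1_iff)
  have "isCont (\<lambda>x. ferrers_half \<nu> \<mu> s (Arccos x)) ?t"
    using holomorphic_on_imp_continuous_on[OF ferrers_half_holomorphic[OF \<nu> s]] tD open_D1
    by (simp add: continuous_on_eq_continuous_at)
  hence "((\<lambda>x. ?K * ferrers_half \<nu> \<mu> s (Arccos x)) \<longlongrightarrow> ?K * ferrers_half \<nu> \<mu> s (Arccos ?t)) (at ?t within ?S)"
    by (intro tendsto_intros) (auto simp: isCont_def intro: tendsto_within_subset)
  moreover have "eventually (\<lambda>z. ?K * ferrers_half \<nu> \<mu> s (Arccos z) = legendreQ \<nu> \<mu> z) (at ?t within ?S)"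
    unfolding eventually_at_filter
  proof (intro always_eventually allI impI)
    fix z assume "z \<noteq> ?t" "z \<in> ?S"
    hence "Re s * Im z > 0" by simp
    note h = half_plane_Arccos[OF s this]
    show "?K * ferrers_half \<nu> \<mu> s (Arccos z) = legendreQ \<nu> \<mu> z"
      using legendreQ_cos[OF \<nu> s Re_Arccos_D1[OF h(1)] h(2), of \<mu>] by simp
  qed
  ultimately show "(legendreQ \<nu> \<mu> \<longlongrightarrow> ?K * ferrers_half \<nu> \<mu> s (Arccos ?t)) (at ?t within ?S)"
    by (rule Lim_transform_eventually)
qed

text \<open>The exponential weights are the inverses of the phases of the two boundary values, so a
  plain mean remains.\<close>

lemma ferrersQ_interval_eq:
  assumes \<nu>: "\<nu> + 1/2 \<notin> \<int>" and t: "-1 < t" "t < 1"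
  shows "ferrersQ_interval \<nu> \<mu> t =
     (ferrers_half \<nu> \<mu> 1 (Arccos (of_real t)) + ferrers_half \<nu> \<mu> (- 1) (Arccos (of_real t))) / 2"
proof -
  have e1: "exp (- (1/2) * \<i> * of_real pi * \<mu>) * exp (- \<i> * of_real pi * \<mu>) * (exp (\<i> * of_real pi * \<mu>) * exp (1 * \<i> * of_real pi * \<mu> / 2) * X) = X"
   and e2: "exp (1/2 * \<i> * of_real pi * \<mu>) * exp (- \<i> * of_real pi * \<mu>) * (exp (\<i> * of_real pi * \<mu>) * exp (- 1 * \<i> * of_real pi * \<mu> / 2) * X) = X"
    for X
    by (simp_all add: exp_minus field_simps)
  have "{z. Im z > 0} = {z. Re 1 * Im z > 0}" "{z. Im z < 0} = {z. Re (- 1) * Im z > 0}" by auto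
  thus ?thesis unfolding ferrersQ_interval_def
    using Lim_legendreQ[OF \<nu> _ t, of 1 \<mu>] Lim_legendreQ[OF \<nu> _ t, of "- 1" \<mu>]
    by (simp only: e1 e2 insert_iff simp_thms) simp
qed

lemma ferrersQ_eq:
  assumes \<nu>: "\<nu> + 1/2 \<notin> \<int>" and x: "x \<in> D1"
  shows "ferrersQ \<nu> \<mu> x = (ferrers_half \<nu> \<mu> 1 (Arccos x) + ferrers_half \<nu> \<mu> (- 1) (Arccos x)) / 2"
  unfolding ferrersQ_def
proof (rule the_equality)
  let ?f = "\<lambda>x. (ferrers_half \<nu> \<mu> 1 (Arccos x) + ferrers_half \<nu> \<mu> (- 1) (Arccos x)) / 2"
  have hol: "?f holomorphic_on D1"
    using ferrers_half_holomorphic[OF \<nu>] by (intro holomorphic_intros) auto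
  have int: "?f (of_real t) = ferrersQ_interval \<nu> \<mu> t" if "t \<in> {-1<..<1}" for t
    using ferrersQ_interval_eq[OF \<nu>, of t] that by simp
  show "\<exists>f. f holomorphic_on D1 \<and> (\<forall>t\<in>{-1<..<1}. f (complex_of_real t) = ferrersQ_interval \<nu> \<mu> t) \<and> ?f x = f x"
    using hol int by (intro exI[of _ ?f]) auto
  fix v assume "\<exists>f. f holomorphic_on D1 \<and> (\<forall>t\<in>{-1<..<1}. f (complex_of_real t) = ferrersQ_interval \<nu> \<mu> t) \<and> v = f x"
  then obtain g where g: "g holomorphic_on D1" "v = g x" "\<And>t. t \<in> {-1<..<1} \<Longrightarrow> g (of_real t) = ferrersQ_interval \<nu> \<mu> t"
    by blast
  \<comment> \<open>The interval accumulates at 0 inside the connected set \<open>D1\<close>, so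
    agreement there determines the extension.\<close>
  have "g x - ?f x = 0"
  proof (rule analytic_continuation[where f = "\<lambda>x. g x - ?f x" and U = "complex_of_real ` {-1<..<1}" and \<xi> = 0])
    show "(\<lambda>x. g x - ?f x) holomorphic_on D1" by (intro holomorphic_on_diff g hol)
    show "complex_of_real ` {-1<..<1} \<subseteq> D1" "0 \<in> D1" by (auto simp: D1_iff)
    show "0 islimpt complex_of_real ` {-1<..<1}"
      unfolding islimpt_approachable
    proof (intro allI impI)
      fix e :: real assume e: "e > 0"
      have "of_real (min (1/2) (e/2)) \<in> complex_of_real ` {-1<..<1}" using e by (intro imageI) auto
      moreover have "dist (complex_of_real (min (1/2) (e/2))) 0 < e" using e by (auto simp: dist_norm simp del: of_real_divide)
      moreover have "complex_of_real (min (1/2) (e/2)) \<noteq> 0" using e by (auto simp: min_def)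
      ultimately show "\<exists>x'\<in>complex_of_real ` {-1<..<1}. x' \<noteq> 0 \<and> dist x' 0 < e" by blast
    qed
    fix z assume "z \<in> complex_of_real ` {-1<..<1}"
    then obtain t where "t \<in> {-1<..<1}" "z = of_real t" by blast
    thus "g z - ?f z = 0" using g(3)[of t] int[of t] by simp
  qed (use open_D1 connected_D1 x in auto)
  thus "v = ?f x" using g(2) by simp
qed

text \<open>The two halves have mutually inverse arguments \<open>u\<close> and
  \<open>1 / u\<close>. In the connection formula for the half at \<open>- s\<close>, the term with
  exponent \<open>a\<close> is a multiple of the half at \<open>s\<close>; the other term is the new
  function in the theorem.\<close>

lemma ferrers_half_connection:
  assumes \<nu>\<mu>: "\<nu> + \<mu> \<notin> neg_naturals" and \<nu>: "\<nu> + 1/2 \<notin> \<int>" and s: "s \<in> {1, -1}"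
    and \<theta>: "0 < Re \<theta>" "Re \<theta> < pi"
  shows "ferrers_half \<nu> \<mu> (- s) \<theta> = of_real (sqrt pi) * 2 powr \<mu> * (sin \<theta>) powr \<mu> *
      (exp (s * \<i> * of_real pi * (\<mu> + 1/2)) * (Gamma (\<nu> + 1/2) * rGamma (\<nu> - \<mu> + 1))
         * exp (s * \<i> * (\<nu> - \<mu>) * \<theta>)
         * hyp2F1 (1/2 + \<mu>) (\<mu> - \<nu>) (1/2 - \<nu>) (exp (- s * 2 * \<i> * \<theta>))
       + Gamma (\<nu> + \<mu> + 1) * rGamma (\<nu> + 3/2)
         * (exp (s * \<i> * of_real pi * (\<nu> + \<mu>)) * (cos (of_real pi * \<mu>) / cos (of_real pi * \<nu>)))
         * exp (- s * \<i> * (\<nu> + \<mu> + 1) * \<theta>)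
         * hyp2F1 (1/2 + \<mu>) (\<nu> + \<mu> + 1) (\<nu> + 3/2) (exp (- s * 2 * \<i> * \<theta>)))"
proof -
  define a where "a = \<nu> + \<mu> + 1" define b where "b = 1/2 + \<mu>" define d where "d = \<nu> + 3/2"
  define u where "u = exp (2 * s * \<i> * \<theta>)"
  \<comment> \<open>The hypothesis on \<open>\<nu> + \<mu>\<close> says that \<open>Gamma a\<close>
    has no pole, which allows \<open>Gamma a * rGamma a\<close> to be cancelled below.\<close>
  have a: "a \<notin> \<int>\<^sub>\<le>\<^sub>0"
  proof
    assume "a \<in> \<int>\<^sub>\<le>\<^sub>0"
    then obtain n where "a = - of_nat n" by (elim nonpos_Ints_cases')
    moreover have "\<nu> + \<mu> = a - 1" by (simp add: a_def)
    ultimately have "\<nu> + \<mu> = - of_nat (Suc n)" by simp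
    thus False using \<nu>\<mu> by (auto simp: neg_naturals_def simp del: of_nat_Suc)
  qed
  have ba: "b - a \<notin> \<int>" using half_Ints_shift(2)[OF \<nu>] by (simp add: a_def b_def algebra_simps)
  have d: "d \<notin> \<int>" using half_Ints_shift(1)[OF \<nu>] by (simp add: d_def)
  hence d': "d \<notin> \<int>\<^sub>\<le>\<^sub>0" using nonpos_Ints_Int by blast
  have u: "u \<in> - (complex_of_real ` {0..})" unfolding u_def by (rule exp_double_in_slit[OF \<theta> s])
  have inv: "1 / u = exp (- s * 2 * \<i> * \<theta>)" by (simp add: u_def exp_minus field_simps)
  \<comment> \<open>On the strip the imaginary part of the right side lies strictly between
    \<open>- pi\<close> and \<open>pi\<close>. The shift by half a turn is the source of the phases
    in the theorem.\<close>
  have "Ln (- u) = 2 * s * \<i> * \<theta> - s * \<i> * of_real pi"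
    by (rule Ln_unique) (use s \<theta> in \<open>auto simp: u_def exp_diff exp_add exp_ii_pi exp_minus\<close>)
  moreover have "u \<noteq> 0" by (simp add: u_def)
  ultimately have "(- u) powr (- c) = exp (- c * (2 * s * \<i> * \<theta> - s * \<i> * of_real pi))" for c
    by (simp add: powr_def)
  hence pw: "(- u) powr (- c) = exp (- c * (2 * s * \<i> * \<theta>)) * exp (s * \<i> * of_real pi * c)" for c
    unfolding exp_add[symmetric] by (simp add: algebra_simps)
  have Gd: "rGamma d * Gamma d = 1" and Ga: "Gamma a * rGamma a = 1"
    using a d' by (auto simp: rGamma_inverse_Gamma Gamma_eq_zero_iff)
  have sd: "sin (of_real pi * d) = - cos (of_real pi * \<nu>)"
  proof -
    have "of_real pi * d = (of_real pi * \<nu> + of_real pi / 2) + of_real pi" by (simp add: d_def algebra_simps)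
    moreover have "sin (complex_of_real pi / 2) = 1" "cos (complex_of_real pi / 2) = 0"
      using sin_of_real[of "pi / 2", where 'a = complex] cos_of_real[of "pi / 2", where 'a = complex] by simp_all
    ultimately show ?thesis by (simp only: sin_add cos_add) simp
  qed
  have sb: "sin (of_real pi * b) = cos (of_real pi * \<mu>)"
    by (simp add: b_def sin_add algebra_simps)
  have cn: "cos (of_real pi * \<nu>) \<noteq> 0" using sin_pi_times_nonzero[OF d] unfolding sd by simp
  have "Gamma d * Gamma (1 - d) = of_real pi / sin (of_real pi * d)" by (rule Gamma_reflection_complex)
  hence "(rGamma d * Gamma d) * Gamma (1 - d) = rGamma d * (of_real pi / sin (of_real pi * d))"
    by (simp only: mult.assoc)
  hence G1: "Gamma (1 - d) = - (rGamma d * of_real pi / cos (of_real pi * \<nu>))" unfolding Gd sd by simp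
  \<comment> \<open>Since \<open>b - a = 1 - d\<close> and \<open>d - a = 1 - b\<close>, reflection
    at \<open>d\<close> yields the cosine of \<nu> in the denominator and reflection at
    \<open>b\<close> the cosine of \<mu> in the numerator.\<close>
  have "rGamma b * rGamma (1 - b) = cos (of_real pi * \<mu>) / of_real pi"
    unfolding rGamma_reflection_complex sb ..
  hence G2: "Gamma (1 - d) * (rGamma b * rGamma (1 - b)) = - (rGamma d * (cos (of_real pi * \<mu>) / cos (of_real pi * \<nu>)))"
    unfolding G1 by simp
  let ?E = "exp (s * \<i> * a * \<theta>)"
  let ?F1 = "hyp2F1 b (\<mu> - \<nu>) (1/2 - \<nu>) (1 / u)" and ?F2 = "hyp2F1 b a d (1 / u)"
  have "hyp2F1 b a d u =
     Gamma d * Gamma (a - b) * rGamma a * rGamma (d - b) * (- u) powr (- b) * hyp2F1 b (b - d + 1) (b - a + 1) (1 / u) +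
     Gamma d * Gamma (b - a) * rGamma b * rGamma (d - a) * (- u) powr (- a) * hyp2F1 a (a - d + 1) (a - b + 1) (1 / u)"
    by (rule hyp2F1_connection_inf[OF ba d u])
  \<comment> \<open>For these parameters \<open>a - d + 1 = b\<close> and
    \<open>a - b + 1 = d\<close>, so the original function reappears at
    \<open>1 / u\<close>.\<close>
  also have "hyp2F1 a (a - d + 1) (a - b + 1) (1 / u) = ?F2"
    by (subst hyp2F1_commute) (simp add: a_def b_def d_def algebra_simps)
  also have "hyp2F1 b (b - d + 1) (b - a + 1) (1 / u) = ?F1"
    by (simp add: a_def b_def d_def algebra_simps)
  finally have "Gamma a * rGamma d * ?E * hyp2F1 b a d u =
     (rGamma d * Gamma d) * (Gamma a * rGamma a) * (Gamma (a - b) * rGamma (d - b)) * (?E * (- u) powr (- b)) * ?F1 +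
     (rGamma d * Gamma d) * Gamma a * (Gamma (b - a) * (rGamma b * rGamma (d - a))) * (?E * (- u) powr (- a)) * ?F2"
    by (simp add: algebra_simps)
  also have "?E * (- u) powr (- b) = exp (s * \<i> * of_real pi * (\<mu> + 1/2)) * exp (s * \<i> * (\<nu> - \<mu>) * \<theta>)"
    unfolding pw exp_add[symmetric] by (simp add: a_def b_def algebra_simps)
  \<comment> \<open>The summand 1 in \<open>a\<close> gives a factor -1, which later meets the minus
    sign from \<open>Gamma (1 - d)\<close>.\<close>
  also have "?E * (- u) powr (- a) = - (exp (s * \<i> * of_real pi * (\<nu> + \<mu>)) * exp (- s * \<i> * a * \<theta>))"
  proof -
    have "exp (s * \<i> * of_real pi) = - 1" using s exp_ii_pi by auto
    moreover have "?E * (- u) powr (- a) = exp (s * \<i> * of_real pi) * (exp (s * \<i> * of_real pi * (\<nu> + \<mu>)) * exp (- s * \<i> * a * \<theta>))"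
      unfolding pw exp_add[symmetric] by (simp add: a_def algebra_simps)
    ultimately show ?thesis by simp
  qed
  also have "Gamma (b - a) * (rGamma b * rGamma (d - a)) = - (rGamma d * (cos (of_real pi * \<mu>) / cos (of_real pi * \<nu>)))"
    unfolding G2[symmetric] by (simp add: a_def b_def d_def algebra_simps)
  finally have main: "Gamma a * rGamma d * ?E * hyp2F1 b a d u =
      exp (s * \<i> * of_real pi * (\<mu> + 1/2)) * (Gamma (\<nu> + 1/2) * rGamma (\<nu> - \<mu> + 1)) * exp (s * \<i> * (\<nu> - \<mu>) * \<theta>) * ?F1
       + Gamma a * rGamma d * (exp (s * \<i> * of_real pi * (\<nu> + \<mu>)) * (cos (of_real pi * \<mu>) / cos (of_real pi * \<nu>)))
         * exp (- s * \<i> * a * \<theta>) * ?F2"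
    unfolding Gd Ga by (simp add: a_def b_def d_def algebra_simps)
  have "ferrers_half \<nu> \<mu> (- s) \<theta> = of_real (sqrt pi) * 2 powr \<mu> * (sin \<theta>) powr \<mu> * (Gamma a * rGamma d * ?E * hyp2F1 b a d u)"
    unfolding ferrers_half_def a_def b_def d_def u_def by (simp add: mult_ac)
  thus ?thesis unfolding main inv unfolding a_def b_def d_def .
qed

text \<open>Only the half at \<open>- s\<close> is rewritten. The untouched half at \<open>s\<close>
  supplies the 1 in the bracket \<open>1 + ...\<close>, and the mean turns
  \<open>2 powr \<mu>\<close> into \<open>2 powr (\<mu> - 1)\<close>.\<close>

theorem theorem5p2:
  fixes \<nu> \<mu> s :: complex
  assumes "\<nu> + \<mu> \<notin> neg_naturals" and "\<nu> + 1/2 \<notin> \<int>" and "s \<in> {1, -1}"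
  shows "(\<forall>x\<in>D1. ferrersQ \<nu> \<mu> x =
      of_real (sqrt pi) * 2 powr (\<mu> - 1) * (1 - x\<^sup>2) powr (\<mu> / 2) *
      (exp (s * \<i> * of_real pi * (\<mu> + 1/2)) * (Gamma (\<nu> + 1/2) * rGamma (\<nu> - \<mu> + 1))
         * (x + s * \<i> * csqrt (1 - x\<^sup>2)) powr (\<nu> - \<mu>)
         * hyp2F1 (1/2 + \<mu>) (\<mu> - \<nu>) (1/2 - \<nu>)
             ((x - s * \<i> * csqrt (1 - x\<^sup>2)) / (x + s * \<i> * csqrt (1 - x\<^sup>2)))
       + Gamma (\<nu> + \<mu> + 1) * rGamma (\<nu> + 3/2)
         * (1 + exp (s * \<i> * of_real pi * (\<nu> + \<mu>)) * (cos (of_real pi * \<mu>) / cos (of_real pi * \<nu>)))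
         * (x - s * \<i> * csqrt (1 - x\<^sup>2)) powr (\<nu> + \<mu> + 1)
         * hyp2F1 (1/2 + \<mu>) (\<nu> + \<mu> + 1) (\<nu> + 3/2)
             ((x - s * \<i> * csqrt (1 - x\<^sup>2)) / (x + s * \<i> * csqrt (1 - x\<^sup>2)))))
    \<and>
    (\<forall>\<theta>. 0 < Re \<theta> \<and> Re \<theta> < pi \<longrightarrow> ferrersQ \<nu> \<mu> (cos \<theta>) =
      of_real (sqrt pi) * 2 powr (\<mu> - 1) * (sin \<theta>) powr \<mu> *
      (exp (s * \<i> * of_real pi * (\<mu> + 1/2)) * (Gamma (\<nu> + 1/2) * rGamma (\<nu> - \<mu> + 1))
         * exp (s * \<i> * (\<nu> - \<mu>) * \<theta>)
         * hyp2F1 (1/2 + \<mu>) (\<mu> - \<nu>) (1/2 - \<nu>) (exp (- s * 2 * \<i> * \<theta>))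
       + Gamma (\<nu> + \<mu> + 1) * rGamma (\<nu> + 3/2)
         * (1 + exp (s * \<i> * of_real pi * (\<nu> + \<mu>)) * (cos (of_real pi * \<mu>) / cos (of_real pi * \<nu>)))
         * exp (- s * \<i> * (\<nu> + \<mu> + 1) * \<theta>)
         * hyp2F1 (1/2 + \<mu>) (\<nu> + \<mu> + 1) (\<nu> + 3/2) (exp (- s * 2 * \<i> * \<theta>))))"
    (is "(\<forall>x\<in>D1. ferrersQ \<nu> \<mu> x = ?X x) \<and> (\<forall>\<theta>. 0 < Re \<theta> \<and> Re \<theta> < pi \<longrightarrow> ferrersQ \<nu> \<mu> (cos \<theta>) = ?T \<theta>)")
proof -
  have T: "ferrersQ \<nu> \<mu> (cos \<theta>) = ?T \<theta>" if \<theta>: "0 < Re \<theta>" "Re \<theta> < pi" for \<theta>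
  proof -
    have "Arccos (cos \<theta>) = \<theta>" using \<theta> by (intro Arccos_cos) simp
    hence "ferrersQ \<nu> \<mu> (cos \<theta>) = (ferrers_half \<nu> \<mu> 1 \<theta> + ferrers_half \<nu> \<mu> (- 1) \<theta>) / 2"
      using ferrersQ_eq[OF assms(2) cos_in_D1[OF \<theta>]] by simp
    \<comment> \<open>The mean is symmetric in the two halves, so either sign may be chosen.\<close>
    also have "\<dots> = (ferrers_half \<nu> \<mu> s \<theta> + ferrers_half \<nu> \<mu> (- s) \<theta>) / 2"
      using assms(3) by auto
    also have "\<dots> = ?T \<theta>"
      unfolding ferrers_half_connection[OF assms \<theta>] unfolding ferrers_half_def
      by (simp add: powr_diff algebra_simps add_divide_distrib)
    finally show ?thesis .
  qed
  have "ferrersQ \<nu> \<mu> x = ?X x" if x: "x \<in> D1" for x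
  proof -
    define \<theta> where "\<theta> = Arccos x"
    have \<theta>: "0 < Re \<theta>" "Re \<theta> < pi" using Re_Arccos_D1[OF x] by (simp_all add: \<theta>_def)
    have xc: "x = cos \<theta>" by (simp add: \<theta>_def)
    have sn: "Re (sin \<theta>) > 0" by (rule Re_sin_pos[OF \<theta>])
    hence sn0: "sin \<theta> \<noteq> 0" by auto
    have sq: "1 - x\<^sup>2 = (sin \<theta>)\<^sup>2" by (simp add: xc sin_squared_eq)
    have root: "csqrt (1 - x\<^sup>2) = sin \<theta>" unfolding sq by (rule csqrt_unique) (use sn in auto)
    have pw: "(1 - x\<^sup>2) powr (\<mu> / 2) = (sin \<theta>) powr \<mu>"
      unfolding sq using sn0 by (simp add: powr_def Ln_sin_squared[OF \<theta>])
    have plus: "x + s * \<i> * sin \<theta> = exp (s * \<i> * \<theta>)" and minus: "x - s * \<i> * sin \<theta> = exp (- s * \<i> * \<theta>)"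
      using assms(3) exp_Euler[of \<theta>] exp_minus_Euler[of \<theta>] by (auto simp: xc)
    \<comment> \<open>The imaginary parts are \<open>Re \<theta>\<close> up to sign, within the
      principal range; hence the powers in the first form are plain exponentials.\<close>
    have "Ln (exp (s * \<i> * \<theta>)) = s * \<i> * \<theta>" "Ln (exp (- s * \<i> * \<theta>)) = - s * \<i> * \<theta>"
      using assms(3) \<theta> by (auto intro!: Ln_exp)
    hence powrs: "exp (s * \<i> * \<theta>) powr (\<nu> - \<mu>) = exp (s * \<i> * (\<nu> - \<mu>) * \<theta>)"
      "exp (- s * \<i> * \<theta>) powr (\<nu> + \<mu> + 1) = exp (- s * \<i> * (\<nu> + \<mu> + 1) * \<theta>)"
      unfolding powr_def by (simp_all add: mult_ac)
    have quot: "exp (- s * \<i> * \<theta>) / exp (s * \<i> * \<theta>) = exp (- s * 2 * \<i> * \<theta>)"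
      unfolding exp_diff[symmetric] by (simp add: algebra_simps)
    have "ferrersQ \<nu> \<mu> x = ?T \<theta>" using T[OF \<theta>] by (simp only: xc)
    also have "\<dots> = ?X x"
      unfolding pw root plus minus powrs quot ..
    finally show ?thesis .
  qed
  thus ?thesis using T by blast
qed

end
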